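(* Let $\{k_n\}$ be a sequence of positive integers satisfying $$\liminf_{n\to\infty}\frac{k_n}{(n\log n)^{1/2}}>0\qquad\text{and}\qquad \frac{k_n}{n}\to0\quad\text{as }n\to\infty,$$ and let $a=c_{\rm out}/c_{\rm in}$. Then, as $n\to\infty$, $$\frac1{k_n}\sum_{v=1}^n\epsilon_{\big(D^{\rm in}_v(n)/(n/k_n)^{c_{\rm in}},\,D^{\rm out}_v(n)/(n/k_n)^{c_{\rm out}}\big)}(\cdot)\ \Rightarrow\ \gamma V_1(\cdot)+\alpha V_2(\cdot)$$ weakly as random elements of $M_+([0,\infty]^2\setminus\{\boldsymbol 0\})$, where $V_1$ and $V_2$ concentrate on $(0,\infty)^2$ with Lebesgue densities $$f_1(x,y)=\frac{x^{\delta_{\rm in}}y^{\delta_{\rm out}-1}}{c_{\rm in}\Gamma(1+\delta_{\rm in})\Gamma(\delta_{\rm out})}\int_0^\infty z^{-(2+1/c_{\rm in}+\delta_{\rm in}+a\delta_{\rm out})}e^{-(x/z+y/z^a)}\,dz$$ and $$f_2(x,y)=\frac{x^{\delta_{\rm in}-1}y^{\delta_{\rm out}}}{c_{\rm in}\Gamma(\delta_{\rm in})\Gamma(1+\delta_{\rm out})}\int_0^\infty z^{-(1+a+1/c_{\rm in}+\delta_{\rm in}+a\delta_{\rm out})}e^{-(x/z+y/z^a)}\,dz,$$ respectively.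
   Context: Parameters: $\alpha\in(0,1)$, $\gamma=1-\alpha$, $\delta_{\rm in},\delta_{\rm out}>0$, $c_{\rm in}=\alpha/(1+\delta_{\rm in})$, $c_{\rm out}=\gamma/(1+\delta_{\rm out})$. Preferential attachment model: $G(1)$ has one node, labeled $1$, with a self loop (in-degree and out-degree both $1$). Given $G(n)$ with node set $[n]=\{1,\dots,n\}$ and $n$ directed edges, $G(n+1)$ is obtained by adding node $n+1$ and one directed edge: with probability $\alpha$ the edge goes from $n+1$ to $v\in[n]$, chosen with probability $\frac{D^{\rm in}_v(n)+\delta_{\rm in}}{(1+\delta_{\rm in})n}$; with probability $\gamma$ the edge goes from $v\in[n]$ to $n+1$, with $v$ chosen with probability $\frac{D^{\rm out}_v(n)+\delta_{\rm out}}{(1+\delta_{\rm out})n}$. Here $(D^{\rm in}_v(n),D^{\rm out}_v(n))$ are the in- and out-degree of $v$ in $G(n)$. $M_+([0,\infty]^2\setminus\{\boldsymbol 0\})$ is the space of Radon measures on $[0,\infty]^2\setminus\{\boldsymbol 0\}$ with the topology of vague convergence (test functions: continuous functions with compact support in $[0,\infty]^2\setminus\{\boldsymbol 0\}$); $\epsilon_x$ is the unit point mass at $x$, and point masses at $\boldsymbol 0$ are disregarded. *)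

theory Defs
  imports "HOL-Probability.Probability" "Graph_Theory.Pair_Digraph"
begin

section \<open>Linear preferential attachment\<close>

text \<open>
  All arcs are distinct, since every new arc is incident to the new node, so a digraph
  without parallel arcs suffices; an arc is a pair (tail, head). The self loop \<open>(1, 1)\<close> counts
  once for the in-degree and once for the out-degree of node \<open>1\<close>.
\<close>

abbreviation D_in :: "nat pair_pre_digraph \<Rightarrow> nat \<Rightarrow> nat" where
  "D_in G v \<equiv> in_degree (with_proj G) v"

abbreviation D_out :: "nat pair_pre_digraph \<Rightarrow> nat \<Rightarrow> nat" where
  "D_out G v \<equiv> out_degree (with_proj G) v"

text \<open>
  The choice of an existing node when the graph has \<open>n\<close> nodes and degree function \<open>d\<close>. The weights
  add up to \<open>1\<close> because the in-degrees, and likewise the out-degrees, add up to the number \<open>n\<close>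
  of arcs; see \<open>pmf_choose_node_in\<close> and \<open>pmf_choose_node_out\<close> below.
\<close>

definition choose_node :: "real \<Rightarrow> nat \<Rightarrow> (nat \<Rightarrow> nat) \<Rightarrow> nat pmf" where
  "choose_node \<delta> n d =
     embed_pmf (\<lambda>v. if v \<in> {1..n} then (real (d v) + \<delta>) / ((1 + \<delta>) * real n) else 0)"

definition attach :: "nat pair_pre_digraph \<Rightarrow> nat \<Rightarrow> nat \<times> nat \<Rightarrow> nat pair_pre_digraph" where
  "attach G w e = \<lparr> pverts = insert w (pverts G), parcs = insert e (parcs G) \<rparr>"

text \<open>
  The law of \<open>G(n)\<close>. Since nodes are labelled by their time of arrival, \<open>G(n)\<close> determines its
  predecessors \<open>G(1), \<dots>, G(n - 1)\<close>, so this is also the law of the history up to time \<open>n\<close>.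
  \<open>G(0)\<close> is a dummy.
\<close>

fun pref_attach :: "real \<Rightarrow> real \<Rightarrow> real \<Rightarrow> nat \<Rightarrow> nat pair_pre_digraph pmf" where
  "pref_attach \<alpha> \<delta>\<^sub>i\<^sub>n \<delta>\<^sub>o\<^sub>u\<^sub>t 0 = return_pmf \<lparr> pverts = {}, parcs = {} \<rparr>"
| "pref_attach \<alpha> \<delta>\<^sub>i\<^sub>n \<delta>\<^sub>o\<^sub>u\<^sub>t (Suc 0) = return_pmf \<lparr> pverts = {1}, parcs = {(1, 1)} \<rparr>"
| "pref_attach \<alpha> \<delta>\<^sub>i\<^sub>n \<delta>\<^sub>o\<^sub>u\<^sub>t (Suc (Suc m)) =
     (let n = Suc m in
      bind_pmf (pref_attach \<alpha> \<delta>\<^sub>i\<^sub>n \<delta>\<^sub>o\<^sub>u\<^sub>t n) (\<lambda>G.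
      bind_pmf (bernoulli_pmf \<alpha>) (\<lambda>from_new.
        if from_new
        then map_pmf (\<lambda>v. attach G (n + 1) (n + 1, v)) (choose_node \<delta>\<^sub>i\<^sub>n n (D_in G))
        else map_pmf (\<lambda>v. attach G (n + 1) (v, n + 1)) (choose_node \<delta>\<^sub>o\<^sub>u\<^sub>t n (D_out G)))))"


section \<open>Weak convergence of random elements of a topological space\<close>

definition borel_of :: "'a topology \<Rightarrow> 'a measure" where
  "borel_of T = sigma (topspace T) {U. openin T U}"

definition random_element :: "'w measure \<Rightarrow> 'a topology \<Rightarrow> ('w \<Rightarrow> 'a) \<Rightarrow> bool" where
  "random_element M T X \<longleftrightarrow> prob_space M \<and> X \<in> measurable M (borel_of T)"

definition converges_weakly ::
  "'a topology \<Rightarrow> (nat \<Rightarrow> 'w measure) \<Rightarrow> (nat \<Rightarrow> 'w \<Rightarrow> 'a) \<Rightarrow> 'v measure \<Rightarrow> ('v \<Rightarrow> 'a) \<Rightarrow> bool" where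
  "converges_weakly T M X N Y \<longleftrightarrow>
     (\<forall>n. random_element (M n) T (X n)) \<and> random_element N T Y \<and>
     (\<forall>F. continuous_map T euclideanreal F \<and> bounded (F ` topspace T) \<longrightarrow>
        (\<lambda>n. LINT w|M n. F (X n w)) \<longlonglongrightarrow> (LINT w|N. F (Y w)))"


section \<open>Radon measures on the punctured extended quadrant\<close>

definition EE :: "(ennreal \<times> ennreal) set" where
  "EE = UNIV - {(0, 0)}"

text \<open>
  \<open>EE\<close> is locally compact with a countable base, so a Borel measure on it is Radon iff
  it is finite on compact sets.
\<close>

definition radon_measures :: "(ennreal \<times> ennreal) measure set" where
  "radon_measures = {\<mu>. sets \<mu> = sets (restrict_space borel EE) \<and>
                        (\<forall>K. compact K \<and> K \<subseteq> EE \<longrightarrow> emeasure \<mu> K < \<infinity>)}"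

text \<open>
  \<open>EE \<inter> closure {\<dots>}\<close> is the support of \<open>f\<close>, that is, the closure relative to \<open>EE\<close>. The value of
  \<open>f\<close> at the origin is irrelevant.
\<close>

definition test_functions :: "(ennreal \<times> ennreal \<Rightarrow> real) set" where
  "test_functions = {f. continuous_on EE f \<and> compact (EE \<inter> closure {p \<in> EE. f p \<noteq> 0})}"

text \<open>
  The coarsest topology on \<open>radon_measures\<close> that makes integration of every test function continuous.
\<close>

definition vague_topology :: "(ennreal \<times> ennreal) measure topology" where
  "vague_topology = topology_generated_by
     {{\<mu> \<in> radon_measures. (LINT p|\<mu>. f p) \<in> U} | f U. f \<in> test_functions \<and> open U}"

definition add_measure :: "'a measure \<Rightarrow> 'a measure \<Rightarrow> 'a measure" where
  "add_measure \<mu> \<nu> = measure_of (space \<mu>) (sets \<mu>) (\<lambda>A. emeasure \<mu> A + emeasure \<nu> A)"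

text \<open>
  The image of counting measure on \<open>{1..n}\<close> under \<open>v \<mapsto> p v\<close> is the sum of the unit masses at the
  \<open>p v\<close>, and restriction to \<open>EE\<close> discards mass at the origin; see
  \<open>emeasure_degree_measure\<close> below.
\<close>

definition degree_measure ::
  "real \<Rightarrow> real \<Rightarrow> nat \<Rightarrow> nat \<Rightarrow> nat pair_pre_digraph \<Rightarrow> (ennreal \<times> ennreal) measure" where
  "degree_measure c\<^sub>i\<^sub>n c\<^sub>o\<^sub>u\<^sub>t n k G =
     scale_measure (ennreal (1 / real k)) (restrict_space (distr (count_space {1..n}) borel
       (\<lambda>v. (ennreal (real (D_in G v) / (real n / real k) powr c\<^sub>i\<^sub>n),
             ennreal (real (D_out G v) / (real n / real k) powr c\<^sub>o\<^sub>u\<^sub>t)))) EE)"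

text \<open>The measure concentrated on \<open>(0, \<infinity>)\<^sup>2\<close> with Lebesgue density \<open>f\<close> there, as a measure on \<open>EE\<close>.\<close>

definition quadrant_density :: "(real \<Rightarrow> real \<Rightarrow> real) \<Rightarrow> (ennreal \<times> ennreal) measure" where
  "quadrant_density f =
     restrict_space
       (distr (density lborel (\<lambda>(x, y). indicator ({0<..} \<times> {0<..}) (x, y) * ennreal (f x y))) borel
         (\<lambda>(x, y). (ennreal x, ennreal y)))
       EE"

definition f1 :: "real \<Rightarrow> real \<Rightarrow> real \<Rightarrow> real \<Rightarrow> real \<Rightarrow> real \<Rightarrow> real" where
  "f1 c\<^sub>i\<^sub>n a \<delta>\<^sub>i\<^sub>n \<delta>\<^sub>o\<^sub>u\<^sub>t x y =
     x powr \<delta>\<^sub>i\<^sub>n * y powr (\<delta>\<^sub>o\<^sub>u\<^sub>t - 1) / (c\<^sub>i\<^sub>n * Gamma (1 + \<delta>\<^sub>i\<^sub>n) * Gamma \<delta>\<^sub>o\<^sub>u\<^sub>t) *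
     (LINT z:{0<..}|lborel.
        z powr (- (2 + 1 / c\<^sub>i\<^sub>n + \<delta>\<^sub>i\<^sub>n + a * \<delta>\<^sub>o\<^sub>u\<^sub>t)) * exp (- (x / z + y / z powr a)))"

definition f2 :: "real \<Rightarrow> real \<Rightarrow> real \<Rightarrow> real \<Rightarrow> real \<Rightarrow> real \<Rightarrow> real" where
  "f2 c\<^sub>i\<^sub>n a \<delta>\<^sub>i\<^sub>n \<delta>\<^sub>o\<^sub>u\<^sub>t x y =
     x powr (\<delta>\<^sub>i\<^sub>n - 1) * y powr \<delta>\<^sub>o\<^sub>u\<^sub>t / (c\<^sub>i\<^sub>n * Gamma \<delta>\<^sub>i\<^sub>n * Gamma (1 + \<delta>\<^sub>o\<^sub>u\<^sub>t)) *
     (LINT z:{0<..}|lborel.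
        z powr (- (1 + a + 1 / c\<^sub>i\<^sub>n + \<delta>\<^sub>i\<^sub>n + a * \<delta>\<^sub>o\<^sub>u\<^sub>t)) * exp (- (x / z + y / z powr a)))"


section \<open>Consistency of the definitions\<close>

lemma EE_in_borel: "EE \<in> sets borel"
  unfolding EE_def by (intro borel_open) auto

lemma emeasure_degree_measure:
  assumes "A \<in> sets borel" "A \<subseteq> EE"
  shows "emeasure (degree_measure c\<^sub>i\<^sub>n c\<^sub>o\<^sub>u\<^sub>t n k G) A = ennreal (1 / real k) *
    (\<Sum>v = 1..n. indicator A
       (ennreal (real (D_in G v) / (real n / real k) powr c\<^sub>i\<^sub>n),
        ennreal (real (D_out G v) / (real n / real k) powr c\<^sub>o\<^sub>u\<^sub>t)))"
proof -
  let ?p = "\<lambda>v. (ennreal (real (D_in G v) / (real n / real k) powr c\<^sub>i\<^sub>n),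
        ennreal (real (D_out G v) / (real n / real k) powr c\<^sub>o\<^sub>u\<^sub>t))"
  have m: "?p \<in> measurable (count_space {1..n}) borel" by simp
  have "emeasure (distr (count_space {1..n}) borel ?p) A
      = (\<integral>\<^sup>+ x. indicator A x \<partial>distr (count_space {1..n}) borel ?p)"
    using assms by simp
  also have "\<dots> = (\<integral>\<^sup>+ v. indicator A (?p v) \<partial>count_space {1..n})"
    using assms by (intro nn_integral_distr m) auto
  also have "\<dots> = (\<Sum>v = 1..n. indicator A (?p v))"
    by (rule nn_integral_count_space_finite) simp
  finally have "emeasure (distr (count_space {1..n}) borel ?p) A = (\<Sum>v = 1..n. indicator A (?p v))" .
  then show ?thesis
    unfolding degree_measure_def using assms EE_in_borel
    by (simp add: emeasure_restrict_space)
qed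

lemma emeasure_add_measure:
  assumes "sets \<mu> = sets \<nu>" "A \<in> sets \<mu>"
  shows "emeasure (add_measure \<mu> \<nu>) A = emeasure \<mu> A + emeasure \<nu> A"
proof (rule emeasure_measure_of[OF add_measure_def])
  show "sets \<mu> \<subseteq> Pow (space \<mu>)" by (rule sets.space_closed)
  show "positive (sets (add_measure \<mu> \<nu>)) (\<lambda>A. emeasure \<mu> A + emeasure \<nu> A)"
    by (simp add: positive_def)
  have s: "sets (add_measure \<mu> \<nu>) = sets \<mu>"
    unfolding add_measure_def by (rule sets.sets_measure_of_eq)
  show "A \<in> sets (add_measure \<mu> \<nu>)" using assms(2) s by blast
  show "countably_additive (sets (add_measure \<mu> \<nu>)) (\<lambda>A. emeasure \<mu> A + emeasure \<nu> A)"
    unfolding countably_additive_def s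
  proof (intro allI impI)
    fix B :: "nat \<Rightarrow> 'a set"
    assume B: "range B \<subseteq> sets \<mu>" "disjoint_family B" "\<Union> (range B) \<in> sets \<mu>"
    have "(\<Sum>i. emeasure \<mu> (B i) + emeasure \<nu> (B i)) = (\<Sum>i. emeasure \<mu> (B i)) + (\<Sum>i. emeasure \<nu> (B i))"
      by (simp add: suminf_add)
    also have "\<dots> = emeasure \<mu> (\<Union> (range B)) + emeasure \<nu> (\<Union> (range B))"
      using B assms(1) by (simp add: suminf_emeasure)
    finally show "(\<Sum>i. emeasure \<mu> (B i) + emeasure \<nu> (B i)) = emeasure \<mu> (\<Union> (range B)) + emeasure \<nu> (\<Union> (range B))" .
  qed
qed

lemma topspace_vague_topology: "topspace vague_topology = radon_measures"
proof -
  have "{\<mu> \<in> radon_measures. (LINT p|\<mu>. (0::real)) \<in> UNIV} \<in>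
     {{\<mu> \<in> radon_measures. (LINT p|\<mu>. f p) \<in> U} | f U. f \<in> test_functions \<and> open U}"
    by (rule CollectI, rule exI[of _ "\<lambda>_. 0"], rule exI[of _ UNIV]) (simp add: test_functions_def)
  then show ?thesis
    unfolding vague_topology_def topology_generated_by_topspace by auto
qed

lemma pmf_choose_node:
  assumes "\<delta> > 0" "n > 0" "(\<Sum>v = 1..n. d v) = n"
  shows "pmf (choose_node \<delta> n d) v =
    (if v \<in> {1..n} then (real (d v) + \<delta>) / ((1 + \<delta>) * real n) else 0)"
  unfolding choose_node_def
proof (rule pmf_embed_pmf)
  let ?g = "\<lambda>v. if v \<in> {1..n} then (real (d v) + \<delta>) / ((1 + \<delta>) * real n) else 0"
  show nonneg: "0 \<le> ?g v" for v using assms by auto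
  have "(\<integral>\<^sup>+ v. ennreal (?g v) \<partial>count_space UNIV) = (\<Sum>v = 1..n. ennreal (?g v))"
    by (rule nn_integral_count_space'[where A = "{1..n}"]) auto
  also have "\<dots> = ennreal (\<Sum>v = 1..n. ?g v)"
    by (rule sum_ennreal) (use nonneg in blast)
  also have "(\<Sum>v = 1..n. ?g v) = (\<Sum>v = 1..n. (real (d v) + \<delta>)) / ((1 + \<delta>) * real n)"
    by (simp add: sum_divide_distrib)
  also have "(\<Sum>v = 1..n. (real (d v) + \<delta>)) = (1 + \<delta>) * real n"
    using assms(3) by (simp add: sum.distrib algebra_simps flip: of_nat_sum)
  finally show "(\<integral>\<^sup>+ v. ennreal (?g v) \<partial>count_space UNIV) = 1"
    using assms by simp
qed

lemma sum_degrees: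
  assumes "finite (parcs G)" "parcs G \<subseteq> {1..n} \<times> {1..n}"
  shows "(\<Sum>v = 1..n. D_in G v) = card (parcs G)" "(\<Sum>v = 1..n. D_out G v) = card (parcs G)"
proof -
  have "(\<Sum>v = 1..n. card {e \<in> parcs G. snd e = v}) = card (\<Union>v\<in>{1..n}. {e \<in> parcs G. snd e = v})"
    using assms by (intro card_UN_disjoint[symmetric]) auto
  moreover have "(\<Union>v\<in>{1..n}. {e \<in> parcs G. snd e = v}) = parcs G" using assms(2) by auto
  ultimately show "(\<Sum>v = 1..n. D_in G v) = card (parcs G)"
    by (simp add: in_degree_def in_arcs_def)
  have "(\<Sum>v = 1..n. card {e \<in> parcs G. fst e = v}) = card (\<Union>v\<in>{1..n}. {e \<in> parcs G. fst e = v})"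
    using assms by (intro card_UN_disjoint[symmetric]) auto
  moreover have "(\<Union>v\<in>{1..n}. {e \<in> parcs G. fst e = v}) = parcs G" using assms(2) by auto
  ultimately show "(\<Sum>v = 1..n. D_out G v) = card (parcs G)"
    by (simp add: out_degree_def out_arcs_def)
qed

lemma pref_attach_support:
  assumes "\<delta>\<^sub>i\<^sub>n > 0" "\<delta>\<^sub>o\<^sub>u\<^sub>t > 0" "n \<ge> 1" "G \<in> set_pmf (pref_attach \<alpha> \<delta>\<^sub>i\<^sub>n \<delta>\<^sub>o\<^sub>u\<^sub>t n)"
  shows "pverts G = {1..n}" "finite (parcs G)" "parcs G \<subseteq> {1..n} \<times> {1..n}" "card (parcs G) = n"
proof -
  have "pverts G = {1..n} \<and> finite (parcs G) \<and> parcs G \<subseteq> {1..n} \<times> {1..n} \<and> card (parcs G) = n"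
    using assms(3,4)
  proof (induction n arbitrary: G rule: dec_induct)
    case base
    then show ?case by auto
  next
    case (step n)
    obtain m where m: "n = Suc m" using step.hyps by (cases n) auto
    from step.prems obtain H v where H: "H \<in> set_pmf (pref_attach \<alpha> \<delta>\<^sub>i\<^sub>n \<delta>\<^sub>o\<^sub>u\<^sub>t n)"
      and G: "v \<in> set_pmf (choose_node \<delta>\<^sub>i\<^sub>n n (D_in H)) \<and> G = attach H (Suc n) (Suc n, v) \<or>
              v \<in> set_pmf (choose_node \<delta>\<^sub>o\<^sub>u\<^sub>t n (D_out H)) \<and> G = attach H (Suc n) (v, Suc n)"
      unfolding m by (auto simp: Let_def split: if_splits)
    from step.IH[OF H] have IH: "pverts H = {1..n}" "finite (parcs H)"
      "parcs H \<subseteq> {1..n} \<times> {1..n}" "card (parcs H) = n" by auto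
    have n: "n > 0" using m by simp
    have "v \<in> {1..n}"
      using G pmf_choose_node[OF assms(1) n, of "D_in H" v] pmf_choose_node[OF assms(2) n, of "D_out H" v]
        sum_degrees[OF IH(2,3)] IH(4)
      unfolding set_pmf_iff by (auto split: if_splits)
    then have v: "v \<in> {1..Suc n}" by simp
    have new: "(Suc n, v) \<notin> parcs H" "(v, Suc n) \<notin> parcs H" using IH(3) by auto
    obtain e where e: "G = attach H (Suc n) e" "e \<in> {1..Suc n} \<times> {1..Suc n}" "e \<notin> parcs H"
      using G v new by auto
    have "pverts G = {1..Suc n}" using IH(1) by (auto simp: e(1) attach_def)
    moreover have "parcs H \<subseteq> {1..Suc n} \<times> {1..Suc n}"
      using IH(3) by (rule order_trans) (intro Sigma_mono, auto)
    ultimately show ?case using e(2,3) IH(2,4) by (simp add: e(1) attach_def)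
  qed
  then show "pverts G = {1..n}" "finite (parcs G)" "parcs G \<subseteq> {1..n} \<times> {1..n}" "card (parcs G) = n"
    by auto
qed

lemma
  assumes "\<delta>\<^sub>i\<^sub>n > 0" "\<delta>\<^sub>o\<^sub>u\<^sub>t > 0" "n \<ge> 1" "G \<in> set_pmf (pref_attach \<alpha> \<delta>\<^sub>i\<^sub>n \<delta>\<^sub>o\<^sub>u\<^sub>t n)" "v \<in> {1..n}"
  shows pmf_choose_node_in:
      "pmf (choose_node \<delta>\<^sub>i\<^sub>n n (D_in G)) v = (real (D_in G v) + \<delta>\<^sub>i\<^sub>n) / ((1 + \<delta>\<^sub>i\<^sub>n) * real n)"
    and pmf_choose_node_out:
      "pmf (choose_node \<delta>\<^sub>o\<^sub>u\<^sub>t n (D_out G)) v = (real (D_out G v) + \<delta>\<^sub>o\<^sub>u\<^sub>t) / ((1 + \<delta>\<^sub>o\<^sub>u\<^sub>t) * real n)"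
  using assms pref_attach_support[OF assms(1-4)] sum_degrees[of G n]
  by (auto simp: pmf_choose_node)

end

theory Submission
  imports Defs
begin

text \<open>
  Seen on its own, the pair (in-degree, out-degree) of a fixed node is a Markov chain, so the
  expectation of a sum over all nodes can be propagated one step backwards in time node by node.
  Adding one arc affects the old degrees of only one node, hence the martingale of
  conditional expectations has bounded increments and the variance of \<open>\<Sum>\<^sub>v f (D\<^sub>v(n))\<close> is \<open>O(n)\<close>;
  as \<open>n / k\<^sub>n\<^sup>2 \<rightarrow> 0\<close>, the normalised sum concentrates at its mean.

  For the mean, the functions \<open>B\<^sub>t ^ (i + \<delta>\<^sub>i\<^sub>n) * C\<^sub>t ^ (j + \<delta>\<^sub>o\<^sub>u\<^sub>t)\<close> with
  \<open>B\<^sub>t = t ^ c\<^sub>i\<^sub>n / (t ^ c\<^sub>i\<^sub>n + \<kappa>)\<close>, and \<open>C\<^sub>t\<close> likewise, are invariant under the one-step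
  operator at time \<open>t\<close> up to an error \<open>O(1 / t\<^sup>2)\<close> that is uniform in all parameters. This gives the
  joint Laplace transform of the scaled degrees of node \<open>\<lceil>k\<^sub>n s\<rceil>\<close>, whose limit is that of
  independent Gamma variables scaled by \<open>s ^ -c\<^sub>i\<^sub>n\<close> and \<open>s ^ -c\<^sub>o\<^sub>u\<^sub>t\<close>. By Stone-Weierstrass on the compact
  space \<open>[0, \<infinity>]\<^sup>2\<close> the convergence extends to all continuous functions, rising factorial moments
  dominate the tail in \<open>s\<close>, and the sum over the nodes becomes an integral over \<open>s\<close>. The
  substitution \<open>z = s ^ -c\<^sub>i\<^sub>n\<close> identifies the limit.
\<close>

text \<open>One arc never raises both degrees of an old node, so in- and out-degree are dependent
  before the limit. For fixed degrees, two independent chains would jump together only with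
  probability O(1 / t^2), the size of the error tolerated anyway; this is why product functions work
  and why independence appears in the limit. The nodes that matter are born at times of order k_n,
  so errors O(1 / t^2) summed from the birth on leave O(1 / k_n). The parameter
  \<open>\<kappa>\<close> must depend on n, being fixed by the terminal value at time n; hence the
  uniformity of the error. The two parts of the limit reflect the two starting positions of a node:
  \<open>(0, 1)\<close> if its first arc leaves it, with probability \<alpha>, and
  \<open>(1, 0)\<close> if it enters it, with probability \<gamma>. The limit has infinite mass near
  the origin, so test functions must vanish there; extended by 0 they are continuous on
  [0, \<infinity>]^2, and their support asks for a large degree, which late nodes rarely reach.
  Since the limit is not random, weak convergence reduces to convergence in probability, one test
  function at a time.\<close>

locale attachment =
  fixes \<alpha> \<gamma> d1 d2 c1 c2 :: real
  assumes \<alpha>_pos: "0 < \<alpha>" and \<alpha>_less: "\<alpha> < 1" and \<gamma>_eq: "\<gamma> = 1 - \<alpha>"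
    and d1_pos: "0 < d1" and d2_pos: "0 < d2"
    and c1_eq: "c1 = \<alpha> / (1 + d1)" and c2_eq: "c2 = \<gamma> / (1 + d2)"
begin

lemma \<gamma>_pos: "0 < \<gamma>" and c1_pos: "0 < c1" and c2_pos: "0 < c2"
  and c1_less: "c1 < 1" and c2_less: "c2 < 1"
  using \<alpha>_pos \<alpha>_less d1_pos d2_pos by (auto simp: \<gamma>_eq c1_eq c2_eq divide_simps)

section \<open>The degrees of a single node\<close>

text \<open>The arc added at time \<open>t\<close> enters a given node of in-degree \<open>i\<close>
  with probability \<alpha> (i + d1) / ((1 + d1) t); \<open>c1\<close> collects the constants.
  Likewise \<open>prob2\<close> for arcs that leave a node.\<close>

definition prob1 :: "nat \<Rightarrow> nat \<Rightarrow> real" where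
  "prob1 t i = c1 * (real i + d1) / real t"

definition prob2 :: "nat \<Rightarrow> nat \<Rightarrow> real" where
  "prob2 t j = c2 * (real j + d2) / real t"

text \<open>The conditional expectation of \<open>h\<close> after the arc added at time
  \<open>t\<close>, for a node with degrees \<open>(i, j)\<close>. The formula makes sense for all
  \<open>i\<close> and \<open>j\<close>, but it is an average only where its three weights are
  nonnegative, in particular for degrees at most \<open>t\<close>.\<close>

definition step :: "nat \<Rightarrow> (nat \<Rightarrow> nat \<Rightarrow> real) \<Rightarrow> nat \<Rightarrow> nat \<Rightarrow> real" where
  "step t h i j = h i j + prob1 t i * (h (Suc i) j - h i j) + prob2 t j * (h i (Suc j) - h i j)"

text \<open>The expectation of \<open>h\<close> at time \<open>v + m\<close> given the degrees at
  time \<open>v\<close>. The recursion strips off the last step, so that an induction on the final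
  time sees the same operator applied to the new function \<open>step (v + m) h\<close>.\<close>

primrec steps :: "nat \<Rightarrow> nat \<Rightarrow> (nat \<Rightarrow> nat \<Rightarrow> real) \<Rightarrow> nat \<Rightarrow> nat \<Rightarrow> real" where
  "steps v 0 h = h"
| "steps v (Suc m) h = steps v m (step (v + m) h)"

section \<open>Backward operators as averages of their argument\<close>

lemma prob1_le: "i \<le> t \<Longrightarrow> 1 \<le> t \<Longrightarrow> prob1 t i \<le> \<alpha>"
proof -
  assume a: "i \<le> t" "1 \<le> t"
  have "real i + d1 \<le> real t + d1 * real t"
    using a d1_pos by (intro add_mono) auto
  hence "\<alpha> * (real i + d1) \<le> \<alpha> * (real t * (1 + d1))"
    using \<alpha>_pos by (intro mult_left_mono) (auto simp: algebra_simps)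
  thus ?thesis using a d1_pos unfolding prob1_def by (simp add: c1_eq divide_simps mult_ac)
qed

lemma prob2_le: "j \<le> t \<Longrightarrow> 1 \<le> t \<Longrightarrow> prob2 t j \<le> \<gamma>"
proof -
  assume a: "j \<le> t" "1 \<le> t"
  have "real j + d2 \<le> real t + d2 * real t"
    using a d2_pos by (intro add_mono) auto
  hence "\<gamma> * (real j + d2) \<le> \<gamma> * (real t * (1 + d2))"
    using \<gamma>_pos by (intro mult_left_mono) (auto simp: algebra_simps)
  thus ?thesis using a d2_pos unfolding prob2_def by (simp add: c2_eq divide_simps mult_ac)
qed

text \<open>For degrees at most \<open>t\<close> the weights p \<le> \<alpha> and q \<le> \<gamma>
  leave 1 - p - q \<ge> 0, so the operator is a convex combination. A degree grows by at most one
  per step, hence the range \<open>Suc t\<close> in the hypothesis; all later comparisons inherit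
  such a range.\<close>

lemma step_mono:
  assumes "\<And>i j. i \<le> Suc t \<Longrightarrow> j \<le> Suc t \<Longrightarrow> h i j \<le> g i j" "1 \<le> t" "i \<le> t" "j \<le> t"
  shows "step t h i j \<le> step t g i j"
proof -
  define p q where "p = prob1 t i" and "q = prob2 t j"
  have pq: "0 \<le> p" "0 \<le> q" "0 \<le> 1 - p - q"
    using prob1_le[of i t] prob2_le[of j t] assms c1_pos c2_pos d1_pos d2_pos
    by (auto simp: p_def q_def \<gamma>_eq prob1_def prob2_def)
  have "step t h' i j = p * h' (Suc i) j + q * h' i (Suc j) + (1 - p - q) * h' i j" for h'
    by (simp add: step_def p_def q_def algebra_simps)
  thus ?thesis using pq assms
    by (auto intro!: add_mono mult_left_mono)
qed

lemma step_linear: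
  "step t (\<lambda>i j. a * h i j + b * g i j) = (\<lambda>i j. a * step t h i j + b * step t g i j)"
  by (intro ext) (simp add: step_def algebra_simps)

lemma step_const [simp]: "step t (\<lambda>i j. b) = (\<lambda>i j. b)"
  by (intro ext) (simp add: step_def)

lemma steps_mono:
  assumes "\<And>i j. i \<le> v + m \<Longrightarrow> j \<le> v + m \<Longrightarrow> h i j \<le> g i j" "1 \<le> v" "i \<le> v" "j \<le> v"
  shows "steps v m h i j \<le> steps v m g i j"
  using assms(1)
proof (induction m arbitrary: h g)
  case 0
  then show ?case using assms by simp
next
  case (Suc m)
  show ?case unfolding steps.simps
    by (rule Suc.IH, rule step_mono) (use Suc.prems assms(2) in auto)
qed

lemma steps_linear:
  "steps v m (\<lambda>i j. a * h i j + b * g i j) = (\<lambda>i j. a * steps v m h i j + b * steps v m g i j)"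
  by (induction m arbitrary: h g) (simp_all add: step_linear)

lemma steps_const [simp]: "steps v m (\<lambda>i j. b) = (\<lambda>i j. b)"
  by (induction m) simp_all

lemma steps_scale: "steps v m (\<lambda>i j. a * h i j) i j = a * steps v m h i j"
  using steps_linear[of v m a h 0 h] by (simp add: fun_eq_iff)

lemma steps_diff: "steps v m (\<lambda>i j. h i j - g i j) i j = steps v m h i j - steps v m g i j"
  using steps_linear[of v m 1 h "-1" g] by (simp add: fun_eq_iff)

lemma steps_abs_le:
  assumes "\<And>i j. i \<le> v + m \<Longrightarrow> j \<le> v + m \<Longrightarrow> \<bar>h i j\<bar> \<le> g i j" "1 \<le> v" "i \<le> v" "j \<le> v"
  shows "\<bar>steps v m h i j\<bar> \<le> steps v m g i j"
proof -
  have "steps v m h i j \<le> steps v m g i j"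
    using assms by (intro steps_mono) (auto simp: abs_le_iff)
  moreover have "steps v m (\<lambda>i j. -1 * h i j) i j \<le> steps v m g i j"
    using assms by (intro steps_mono) (auto simp: abs_le_iff)
  ultimately show ?thesis by (simp only: steps_scale abs_le_iff) simp
qed

lemma steps_abs_bound:
  assumes "\<And>i j. i \<le> v + m \<Longrightarrow> j \<le> v + m \<Longrightarrow> \<bar>h i j\<bar> \<le> B" "1 \<le> v" "i \<le> v" "j \<le> v"
  shows "\<bar>steps v m h i j\<bar> \<le> B"
  using steps_abs_le[of v m h "\<lambda>_ _. B" i j] assms by simp

text \<open>The solution of the logistic equation \<open>t B' = c B (1 - B)\<close>: for the pure birth process with
  rate \<open>c (i + \<delta>)\<close> in logarithmic time, \<open>B\<^sub>t ^ (i + \<delta>)\<close> is a martingale.\<close>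

definition lap :: "real \<Rightarrow> real \<Rightarrow> real \<Rightarrow> real" where
  "lap c \<kappa> t = t powr c / (t powr c + \<kappa>)"

end

text \<open>The logarithmic derivative of \<open>B\<close> is c (1 - B x) / x by the logistic
  equation, so the mean value theorem expresses \<open>L\<close> through an intermediate
  \<open>z\<close>; moving to \<open>t + 1\<close> in 1 - B and to \<open>t\<close> in the
  denominator costs a relative error 1 / t. The reference point is \<open>t + 1\<close> because
  \<open>step\<close> acts on the later function. That \<open>\<beta>\<close> remains as a factor of
  the error makes the estimate uniform in \<open>\<kappa>\<close>.\<close>

lemma ln_ratio_bound:
  fixes c \<kappa> t :: real
  assumes c: "0 < c" "c < 1" and \<kappa>: "0 \<le> \<kappa>" and t: "1 \<le> t"
  defines "B \<equiv> \<lambda>t. t powr c / (t powr c + \<kappa>)"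
  defines "L \<equiv> ln (B (t + 1)) - ln (B t)" and "\<beta> \<equiv> 1 - B (t + 1)"
  shows "0 \<le> L" "0 \<le> \<beta>" "\<bar>L - c * \<beta> / t\<bar> \<le> c * \<beta> / t\<^sup>2" "0 < B t" "0 < B (t + 1)" "B t \<le> 1"
proof -
  have pos: "0 < x powr c + \<kappa>" if "x > 0" for x using that \<kappa> by (simp add: add_pos_nonneg)
  have B1: "1 - B x = \<kappa> / (x powr c + \<kappa>)" if "x > 0" for x
    using pos[OF that] by (simp add: B_def field_simps)
  show "0 < B t" "0 < B (t + 1)" using t pos by (auto simp: B_def intro!: divide_pos_pos)
  show \<beta>0: "0 \<le> \<beta>" using t \<kappa> pos[of "t+1"] B1[of "t + 1"] by (simp add: \<beta>_def)
  show "B t \<le> 1" using t pos[of t] \<kappa> by (simp add: B_def)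
  have lnB: "ln (B x) = c * ln x - ln (x powr c + \<kappa>)" if "x > 0" for x
    using pos[OF that] that by (simp add: B_def ln_div ln_powr)
  have der: "((\<lambda>x. ln (B x)) has_real_derivative (c * (1 - B x) / x)) (at x)" if x: "x > 0" for x
  proof -
    have "((\<lambda>x. c * ln x - ln (x powr c + \<kappa>)) has_real_derivative
             (c * (1 / x) - (c * x powr (c - 1)) / (x powr c + \<kappa>))) (at x)"
      using x pos[OF x] by (auto intro!: derivative_eq_intros)
    also have "c * (1 / x) - (c * x powr (c - 1)) / (x powr c + \<kappa>) = c * (1 - B x) / x"
    proof -
      have "1 - x powr c / (x powr c + \<kappa>) = \<kappa> / (x powr c + \<kappa>)"
        using pos[OF x] by (simp add: field_simps)
      moreover have "c * (1 / x) - (c * x powr (c - 1)) / (x powr c + \<kappa>) = c / x * (1 - x powr c / (x powr c + \<kappa>))"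
        using x by (simp add: powr_diff right_diff_distrib)
      ultimately show ?thesis using B1[OF x] by simp
    qed
    finally have *: "((\<lambda>x. c * ln x - ln (x powr c + \<kappa>)) has_real_derivative c * (1 - B x) / x) (at x)" .
    show ?thesis
      by (rule DERIV_cong_ev[OF refl _ refl, THEN iffD1, OF _ *])
        (use x in \<open>auto simp: lnB eventually_nhds intro!: exI[of _ "{0<..}"]\<close>)
  qed
  have "\<exists>z>t. z < t + 1 \<and> ln (B (t + 1)) - ln (B t) = (t + 1 - t) * (c * (1 - B z) / z)"
    using t by (intro MVT2) (auto intro!: der)
  then obtain z where z: "t < z" "z < t + 1" "L = c * (1 - B z) / z"
    by (auto simp: L_def)
  have up: "(1 - B z) / z \<le> \<beta> * (t + 1) / t\<^sup>2"
  proof -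
    have "(1 - B z) / z \<le> \<kappa> / (t powr c + \<kappa>) / t"
    proof -
      have "(t powr c + \<kappa>) * t \<le> (z powr c + \<kappa>) * z"
        using z t \<kappa> c pos[of t] by (intro mult_mono add_mono powr_mono2) auto
      hence "\<kappa> / ((z powr c + \<kappa>) * z) \<le> \<kappa> / ((t powr c + \<kappa>) * t)"
        using z t \<kappa> pos[of t] pos[of z] pos[of "t + 1"] by (intro divide_left_mono mult_pos_pos) auto
      thus ?thesis using z t B1[of z] by simp
    qed
    \<comment> \<open>As c < 1, the denominator grows from t to t + 1 by at most the factor (t + 1)
      / t.\<close>
    also have "\<kappa> / (t powr c + \<kappa>) \<le> \<kappa> / ((t + 1) powr c + \<kappa>) * ((t + 1) / t)"
    proof -
      have "(t + 1) powr c = t powr c * ((t + 1) / t) powr c"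
        using t by (simp add: powr_mult[symmetric] del: powr_mult)
      also have "\<dots> \<le> t powr c * ((t + 1) / t) powr 1"
        using t c by (intro mult_left_mono powr_mono) auto
      finally have 1: "(t + 1) powr c \<le> t powr c * ((t + 1) / t)" using t by simp
      have "\<kappa> * 1 \<le> \<kappa> * ((t + 1) / t)" using \<kappa> t by (intro mult_left_mono) auto
      with 1 have "(t + 1) powr c + \<kappa> \<le> (t powr c + \<kappa>) * ((t + 1) / t)"
        by (simp only: distrib_right mult_1_right)
      hence "\<kappa> * ((t + 1) powr c + \<kappa>) \<le> \<kappa> * ((t powr c + \<kappa>) * ((t + 1) / t))"
        using \<kappa> by (rule mult_left_mono)
      moreover have "\<kappa> / D \<le> \<kappa> / E * r" if "\<kappa> * E \<le> \<kappa> * (D * r)" "0 < D" "0 < E" for D E r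
        using that by (simp add: field_simps)
      ultimately show ?thesis using pos[of t] pos[of "t + 1"] t by fastforce
    qed
    also have "\<kappa> / ((t + 1) powr c + \<kappa>) * ((t + 1) / t) / t = \<beta> * (t + 1) / t\<^sup>2"
      using t by (simp add: \<beta>_def B1 power2_eq_square)
    finally show ?thesis using t by (simp add: divide_right_mono)
  qed
  have lo: "\<beta> / (t + 1) \<le> (1 - B z) / z"
  proof -
    have "\<kappa> / ((t + 1) powr c + \<kappa>) / (t + 1) \<le> \<kappa> / (z powr c + \<kappa>) / z"
    proof -
      have "(z powr c + \<kappa>) * z \<le> ((t + 1) powr c + \<kappa>) * (t + 1)"
        using z t \<kappa> c pos[of z] pos[of "t + 1"] by (intro mult_mono add_mono powr_mono2) auto
      hence "\<kappa> / (((t + 1) powr c + \<kappa>) * (t + 1)) \<le> \<kappa> / ((z powr c + \<kappa>) * z)"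
        using z t \<kappa> pos[of z] pos[of "t + 1"] by (intro divide_left_mono mult_pos_pos) (auto simp: add.commute)
      thus ?thesis by simp
    qed
    thus ?thesis using z t by (simp add: \<beta>_def B1)
  qed
  have "\<beta> / (t + 1) \<ge> 0" using \<beta>0 t by simp
  with lo have "0 \<le> (1 - B z) / z" by linarith
  hence "0 \<le> c * ((1 - B z) / z)" using c by (intro mult_nonneg_nonneg) auto
  thus "0 \<le> L" using z(3) by simp
  have "(1 - B z) / z - \<beta> / t \<le> \<beta> / t\<^sup>2"
  proof -
    have "\<beta> * (t + 1) / t\<^sup>2 = \<beta> / t + \<beta> / t\<^sup>2"
      using t by (simp add: field_simps power2_eq_square)
    with up show ?thesis by simp
  qed
  moreover have "\<beta> / t - \<beta> / (t + 1) \<le> \<beta> / t\<^sup>2"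
  proof -
    have "\<beta> / t - \<beta> / (t + 1) = \<beta> / (t * (t + 1))" using t by (simp add: field_simps)
    also have "\<dots> \<le> \<beta> / t\<^sup>2" using t \<beta>0
      by (intro divide_left_mono) (auto simp: power2_eq_square)
    finally show ?thesis .
  qed
  ultimately have "\<bar>(1 - B z) / z - \<beta> / t\<bar> \<le> \<beta> / t\<^sup>2" using lo by linarith
  hence "c * \<bar>(1 - B z) / z - \<beta> / t\<bar> \<le> c * (\<beta> / t\<^sup>2)" using c by (intro mult_left_mono) auto
  also have "c * \<bar>(1 - B z) / z - \<beta> / t\<bar> = \<bar>L - c * \<beta> / t\<bar>"
  proof -
    have "L - c * \<beta> / t = c * ((1 - B z) / z - \<beta> / t)" by (simp add: z(3) right_diff_distrib)
    thus ?thesis using c by (simp only: abs_mult abs_of_pos)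
  qed
  finally show "\<bar>L - c * \<beta> / t\<bar> \<le> c * \<beta> / t\<^sup>2" by simp
qed

section \<open>Elementary estimates for the exponential function\<close>

lemma exp_minus_quadratic:
  fixes a :: real assumes "0 \<le> a"
  shows "\<bar>1 - a - exp (- a)\<bar> \<le> a\<^sup>2"
proof -
  have "1 - a \<le> exp (- a)" using exp_ge_add_one_self[of "-a"] by simp
  moreover have "exp (- a) \<le> 1 - a + a\<^sup>2"
  proof -
    \<comment> \<open>The product on the right is \<open>1 + a ^ 3\<close>.\<close>
    have "1 \<le> (1 - a + a\<^sup>2) * (1 + a)" using assms
      by (simp add: algebra_simps power2_eq_square)
    also have "\<dots> \<le> (1 - a + a\<^sup>2) * exp a"
    proof (rule mult_left_mono)
      have "0 \<le> (a - 1/2)\<^sup>2 + 3/4" by simp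
      thus "0 \<le> 1 - a + a\<^sup>2" by (simp add: power2_eq_square algebra_simps)
    qed simp
    finally show ?thesis by (simp add: exp_minus field_simps)
  qed
  ultimately show ?thesis by simp
qed

lemma exp_minus_lipschitz:
  fixes a b :: real assumes "0 \<le> a" "0 \<le> b"
  shows "\<bar>exp (- a) - exp (- b)\<bar> \<le> \<bar>a - b\<bar>"
proof -
  have *: "exp (- x) - exp (- y) \<le> y - x" if "0 \<le> x" "x \<le> y" for x y :: real
  proof -
    have "exp (- x) - exp (- y) = exp (- x) * (1 - exp (- (y - x)))"
      by (simp add: algebra_simps flip: exp_add)
    also have "1 - exp (- (y - x)) \<le> y - x"
      using exp_ge_add_one_self[of "- (y - x)"] by linarith
    hence "exp (- x) * (1 - exp (- (y - x))) \<le> 1 * (y - x)"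
      using that by (intro mult_mono) auto
    finally show ?thesis by simp
  qed
  show ?thesis using *[of a b] *[of b a] assms by (cases "a \<le> b") auto
qed

text \<open>Absorbs the linear and quadratic errors of one step, which would otherwise grow with the
  degrees; it is the source of the 3 in \<open>step_lap_bound\<close>.\<close>

lemma exp_decay_bound:
  fixes w :: real assumes "0 \<le> w"
  shows "exp (- w) * (w + w\<^sup>2) \<le> 3"
proof -
  have "1 + w + w\<^sup>2 / 2 \<le> exp w" using assms by (rule exp_lower_Taylor_quadratic)
  moreover have "1 \<le> exp w" using assms by simp
  ultimately have "w + w\<^sup>2 \<le> 3 * exp w" using assms by linarith
  thus ?thesis by (simp add: exp_minus field_simps)
qed

context attachment begin

text \<open>With E the value of the product at time \<open>t + 1\<close>, the two functions are E (1
  - a) and E exp (- A), where a is the first-order loss over both coordinates and A the exact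
  logarithmic increment. They differ by at most E (a^2 + |a - A|), which is at most E (w + w^2) /
  t^2. The number w = x b + y c may be large, but ln B \<le> B - 1 gives E \<le> exp (- w), which
  keeps the bound free of degrees and parameters.\<close>

lemma step_lap_bound:
  fixes \<kappa> \<mu> :: real and i j t :: nat
  assumes nn: "0 \<le> \<kappa>" "0 \<le> \<mu>" and t: "1 \<le> t"
  defines "\<Phi> \<equiv> \<lambda>t i j. lap c1 \<kappa> (real t) powr (real i + d1) * lap c2 \<mu> (real t) powr (real j + d2)"
  shows "\<bar>step t (\<Phi> (Suc t)) i j - \<Phi> t i j\<bar> \<le> 3 / (real t)\<^sup>2"
proof -
  let ?t = "real t"
  define x y where "x = real i + d1" and "y = real j + d2"
  have xy: "0 < x" "0 < y" using d1_pos d2_pos by (auto simp: x_def y_def)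
  have t1: "1 \<le> ?t" using t by simp
  note b1 = ln_ratio_bound[OF c1_pos c1_less nn(1) t1, folded lap_def]
  note b2 = ln_ratio_bound[OF c2_pos c2_less nn(2) t1, folded lap_def]
  define B B' C C' where "B = lap c1 \<kappa> ?t" and "B' = lap c1 \<kappa> (?t + 1)"
    and "C = lap c2 \<mu> ?t" and "C' = lap c2 \<mu> (?t + 1)"
  define b c where "b = 1 - B'" and "c = 1 - C'"
  define L M where "L = ln B' - ln B" and "M = ln C' - ln C"
  note b1' = b1[folded B_def B'_def, folded L_def b_def]
  note b2' = b2[folded C_def C'_def, folded M_def c_def]
  define a A w where "a = x * (c1 * b / ?t) + y * (c2 * c / ?t)" and "A = x * L + y * M"
    and "w = x * b + y * c"
  define E where "E = B' powr x * C' powr y"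
  have Bx: "B powr x * C powr y = E * exp (- A)"
    using b1' b2' by (simp add: E_def A_def L_def M_def powr_def algebra_simps flip: exp_add)
  have S: "step t (\<Phi> (Suc t)) i j = E * (1 - a)"
  proof -
    have B'C': "0 < B'" "0 < C'" using b1' b2' by auto
    have BC: "lap c1 \<kappa> (real (Suc t)) = B'" "lap c2 \<mu> (real (Suc t)) = C'"
      by (simp_all add: B'_def C'_def add.commute)
    have "\<Phi> (Suc t) i j = E" unfolding \<Phi>_def BC E_def x_def y_def ..
    moreover have "\<Phi> (Suc t) (Suc i) j = E * B'"
      unfolding \<Phi>_def BC E_def x_def y_def using B'C' by (simp add: powr_add)
    moreover have "\<Phi> (Suc t) i (Suc j) = E * C'"
      unfolding \<Phi>_def BC E_def x_def y_def using B'C' by (simp add: powr_add)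
    moreover have "prob1 t i * (E * B' - E) = - E * (x * (c1 * b / ?t))"
      by (simp add: prob1_def x_def b_def right_diff_distrib mult_ac)
    moreover have "prob2 t j * (E * C' - E) = - E * (y * (c2 * c / ?t))"
      by (simp add: prob2_def y_def c_def right_diff_distrib mult_ac)
    ultimately show ?thesis unfolding step_def a_def by (simp add: algebra_simps)
  qed
  have w0: "0 \<le> w" using b1' b2' xy by (simp add: w_def)
  have a0: "0 \<le> a" using b1' b2' xy c1_pos c2_pos by (simp add: a_def)
  have A0: "0 \<le> A" using b1' b2' xy by (simp add: A_def)
  have aw: "a \<le> w / ?t"
  proof -
    have "c1 * (x * b) \<le> 1 * (x * b)" "c2 * (y * c) \<le> 1 * (y * c)"
      using b1' b2' xy c1_less c2_less by (intro mult_right_mono; simp)+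
    hence "(c1 * (x * b) + c2 * (y * c)) / ?t \<le> w / ?t" using t1
      by (intro divide_right_mono) (auto simp: w_def)
    thus ?thesis by (simp add: a_def add_divide_distrib mult_ac)
  qed
  have Aa: "\<bar>A - a\<bar> \<le> a / ?t"
  proof -
    have "\<bar>A - a\<bar> = \<bar>x * (L - c1 * b / ?t) + y * (M - c2 * c / ?t)\<bar>"
      by (simp add: A_def a_def algebra_simps)
    also have "\<dots> \<le> x * \<bar>L - c1 * b / ?t\<bar> + y * \<bar>M - c2 * c / ?t\<bar>"
      using xy by (intro order.trans[OF abs_triangle_ineq]) (simp add: abs_mult)
    also have "\<dots> \<le> x * (c1 * b / ?t\<^sup>2) + y * (c2 * c / ?t\<^sup>2)"
      using b1' b2' xy by (intro add_mono mult_left_mono) auto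
    also have "\<dots> = a / ?t" by (simp add: a_def power2_eq_square add_divide_distrib)
    finally show ?thesis .
  qed
  have Ew: "E \<le> exp (- w)"
  proof -
    have "ln B' \<le> - b" "ln C' \<le> - c"
      using b1' b2' ln_le_minus_one[of B'] ln_le_minus_one[of C'] by (auto simp: b_def c_def)
    hence "x * ln B' + y * ln C' \<le> x * (- b) + y * (- c)"
      using xy by (intro add_mono mult_left_mono) auto
    thus ?thesis using b1' b2' by (simp add: E_def powr_def w_def flip: exp_add)
  qed
  have E0: "0 \<le> E" by (simp add: E_def)
  have "\<bar>step t (\<Phi> (Suc t)) i j - \<Phi> t i j\<bar> = E * \<bar>(1 - a - exp (- a)) + (exp (- a) - exp (- A))\<bar>"
  proof -
    have "\<Phi> t i j = E * exp (- A)" using Bx unfolding \<Phi>_def B_def C_def x_def y_def .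
    hence "step t (\<Phi> (Suc t)) i j - \<Phi> t i j = E * ((1 - a - exp (- a)) + (exp (- a) - exp (- A)))"
      unfolding S by (simp add: algebra_simps)
    thus ?thesis using E0 by (simp add: abs_mult)
  qed
  also have "\<dots> \<le> E * (a\<^sup>2 + \<bar>a - A\<bar>)"
    using exp_minus_quadratic[OF a0] exp_minus_lipschitz[OF a0 A0] E0
    by (intro mult_left_mono) auto
  also have "\<dots> \<le> exp (- w) * ((w / ?t)\<^sup>2 + w / ?t / ?t)"
  proof (intro mult_mono Ew add_mono)
    show "a\<^sup>2 \<le> (w / ?t)\<^sup>2" using a0 aw by (intro power_mono) auto
    have "a / ?t \<le> w / ?t / ?t" using aw t1 by (intro divide_right_mono) auto
    with Aa show "\<bar>a - A\<bar> \<le> w / ?t / ?t" by linarith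
  qed auto
  also have "\<dots> = exp (- w) * (w + w\<^sup>2) / ?t\<^sup>2"
    by (simp add: power2_eq_square add_divide_distrib distrib_left add.commute)
  also have "\<dots> \<le> 3 / ?t\<^sup>2" using exp_decay_bound[OF w0] by (intro divide_right_mono) auto
  finally show ?thesis .
qed

text \<open>Averaging does not enlarge the one-step errors, and 3 / t^2 \<le> 6 (1 / t - 1 / (t +
  1)) since t \<ge> 1, so they telescope to O(1 / v), uniformly in the number of steps.\<close>

lemma steps_lap_bound:
  fixes \<kappa> \<mu> :: real
  assumes nn: "0 \<le> \<kappa>" "0 \<le> \<mu>" and v: "1 \<le> v" "i \<le> v" "j \<le> v"
  defines "\<Phi> \<equiv> \<lambda>t i j. lap c1 \<kappa> (real t) powr (real i + d1) * lap c2 \<mu> (real t) powr (real j + d2)"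
  shows "\<bar>steps v m (\<Phi> (v + m)) i j - \<Phi> v i j\<bar> \<le> 6 * (1 / real v - 1 / real (v + m)) + 3 * (1 / (real v)\<^sup>2 - 1 / (real (v + m))\<^sup>2)"
proof (induction m)
  case (Suc m)
  let ?t = "v + m"
  have "\<bar>steps v (Suc m) (\<Phi> (v + Suc m)) i j - steps v m (\<Phi> ?t) i j\<bar>
      = \<bar>steps v m (\<lambda>i j. step ?t (\<Phi> (Suc ?t)) i j - \<Phi> ?t i j) i j\<bar>"
    by (simp add: steps_diff)
  also have "\<dots> \<le> 3 / (real ?t)\<^sup>2"
    using v unfolding \<Phi>_def by (intro steps_abs_bound step_lap_bound nn) auto
  also have "\<dots> \<le> 6 * (1 / real ?t - 1 / (real ?t + 1)) + 3 * (1 / (real ?t)\<^sup>2 - 1 / (real ?t + 1)\<^sup>2)"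
  proof -
    have "real ?t \<ge> 1" using v by simp
    hence "1 / (real ?t)\<^sup>2 / 2 \<le> 1 / real ?t - 1 / (real ?t + 1)"
      by (simp add: divide_simps power2_eq_square)
    moreover have "1 / (real ?t + 1)\<^sup>2 \<le> 1 / (real ?t)\<^sup>2"
      using v by (intro divide_left_mono power_mono mult_pos_pos) auto
    moreover have "3 / (real ?t)\<^sup>2 = 3 * (1 / (real ?t)\<^sup>2)" by simp
    moreover have "d \<le> 6 * a + 3 * (e - f)" if "e / 2 \<le> a" "f \<le> e" "d = 3 * e" for a d e f :: real
    proof -
      have "3 * e = 6 * (e / 2) + 3 * 0" by simp
      also have "\<dots> \<le> 6 * a + 3 * (e - f)" using that by (intro add_mono mult_left_mono) auto
      finally show ?thesis using that by simp
    qed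
    ultimately show ?thesis by blast
  qed
  finally have "\<bar>steps v (Suc m) (\<Phi> (v + Suc m)) i j - steps v m (\<Phi> ?t) i j\<bar>
    \<le> 6 * (1 / real ?t - 1 / real (v + Suc m)) + 3 * (1 / (real ?t)\<^sup>2 - 1 / (real (v + Suc m))\<^sup>2)"
    by (simp add: add.commute[of 1] add.assoc del: steps.simps)
  with Suc.IH show ?case by argo
qed simp

section \<open>Rising factorial moments\<close>

text \<open>Rising factorials are eigenfunctions: x (x + 1)_p = (x + p) (x)_p, so the jump
  probability c1 x / t, linear in x = i + d1, turns the increment into c1 p / t times the function
  itself. Ordinary powers would leave lower-order terms.\<close>

lemma step_pochhammer1:
  assumes "1 \<le> t"
  shows "step t (\<lambda>i j. pochhammer (real i + d1) p) = (\<lambda>i j. (1 + c1 * real p / real t) * pochhammer (real i + d1) p)"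
proof (intro ext)
  fix i j
  have "(real i + d1) * pochhammer (real (Suc i) + d1) p = (real i + d1 + p) * pochhammer (real i + d1) p"
    using pochhammer_rec[of "real i + d1" p] pochhammer_rec'[of "real i + d1" p] by (simp add: add_ac)
  hence "(real i + d1) * (pochhammer (real (Suc i) + d1) p - pochhammer (real i + d1) p) = real p * pochhammer (real i + d1) p"
    by (simp only: right_diff_distrib) (simp add: algebra_simps)
  hence "prob1 t i * (pochhammer (real (Suc i) + d1) p - pochhammer (real i + d1) p)
    = c1 * real p / real t * pochhammer (real i + d1) p"
    by (simp only: prob1_def times_divide_eq_left mult.assoc)
  thus "step t (\<lambda>i j. pochhammer (real i + d1) p) i j = (1 + c1 * real p / real t) * pochhammer (real i + d1) p"
    unfolding step_def by (simp only: distrib_right) simp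
qed

lemma step_pochhammer2:
  assumes "1 \<le> t"
  shows "step t (\<lambda>i j. pochhammer (real j + d2) p) = (\<lambda>i j. (1 + c2 * real p / real t) * pochhammer (real j + d2) p)"
proof (intro ext)
  fix i j
  have "(real j + d2) * pochhammer (real (Suc j) + d2) p = (real j + d2 + p) * pochhammer (real j + d2) p"
    using pochhammer_rec[of "real j + d2" p] pochhammer_rec'[of "real j + d2" p] by (simp add: add_ac)
  hence "(real j + d2) * (pochhammer (real (Suc j) + d2) p - pochhammer (real j + d2) p) = real p * pochhammer (real j + d2) p"
    by (simp only: right_diff_distrib) (simp add: algebra_simps)
  hence "prob2 t j * (pochhammer (real (Suc j) + d2) p - pochhammer (real j + d2) p)
    = c2 * real p / real t * pochhammer (real j + d2) p"
    by (simp only: prob2_def times_divide_eq_left mult.assoc)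
  thus "step t (\<lambda>i j. pochhammer (real j + d2) p) i j = (1 + c2 * real p / real t) * pochhammer (real j + d2) p"
    unfolding step_def by (simp only: distrib_right) simp
qed

end

text \<open>Both factors on the right telescope when multiplied over \<open>t\<close>: the power
  carries the true growth, the exponential a bounded correction. The bound follows from 1 + b / t
  \<le> exp (b / t) and 1 / (t + 1) \<le> ln ((t + 1) / t).\<close>

lemma one_plus_div_le_powr:
  fixes b :: real and t :: nat assumes "0 \<le> b" "1 \<le> t"
  shows "1 + b / real t \<le> exp (b / real t - b / (real t + 1)) * ((real t + 1) / real t) powr b"
proof -
  have "1 + b / real t \<le> exp (b / real t)" by (rule exp_ge_add_one_self)
  also have "b / real t \<le> (b / real t - b / (real t + 1)) + b * ln ((real t + 1) / real t)"
  proof -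
    have "ln (real t / (real t + 1)) \<le> real t / (real t + 1) - 1"
      using assms by (intro ln_le_minus_one) auto
    also have "\<dots> = - (1 / (real t + 1))" by (simp add: field_simps)
    finally have "1 / (real t + 1) \<le> ln ((real t + 1) / real t)"
      using assms by (simp add: ln_div)
    from mult_left_mono[OF this assms(1)] show ?thesis by simp
  qed
  finally show ?thesis using assms by (simp add: powr_def flip: exp_add)
qed

context attachment begin

text \<open>For an eigenfunction the expectation is a product of factors 1 + b / t, which grows like
  ((v + m) / v)^b up to a constant of at most exp (b / v).\<close>

lemma steps_multiplier:
  fixes b :: real
  assumes b: "0 \<le> b" and st: "\<And>t. 1 \<le> t \<Longrightarrow> step t g = (\<lambda>i j. (1 + b / real t) * g i j)"
    and v: "1 \<le> v" and g: "0 \<le> g i j"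
  shows "steps v m g i j \<le> exp (b / real v - b / real (v + m)) * (real (v + m) / real v) powr b * g i j"
proof (induction m)
  case 0
  then show ?case using v by simp
next
  case (Suc m)
  let ?t = "v + m"
  have t: "1 \<le> ?t" using v by simp
  have "steps v (Suc m) g i j = (1 + b / real ?t) * steps v m g i j"
    unfolding steps.simps st[OF t] steps_scale ..
  also have "\<dots> \<le> (1 + b / real ?t) * (exp (b / real v - b / real ?t) * (real ?t / real v) powr b * g i j)"
    using Suc.IH b by (intro mult_left_mono) auto
  also have "\<dots> \<le> exp (b / real ?t - b / (real ?t + 1)) * ((real ?t + 1) / real ?t) powr b *
      (exp (b / real v - b / real ?t) * (real ?t / real v) powr b * g i j)"
    using g by (intro mult_right_mono one_plus_div_le_powr b t) auto
  also have "\<dots> = exp ((b / real ?t - b / (real ?t + 1)) + (b / real v - b / real ?t)) *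
       (((real ?t + 1) / real ?t) powr b * (real ?t / real v) powr b) * g i j"
    by (simp only: exp_add mult_ac)
  also have "((real ?t + 1) / real ?t) powr b * (real ?t / real v) powr b = ((real ?t + 1) / real v) powr b"
    using t v by (subst powr_mult[symmetric]) auto
  finally show ?case by (simp add: add.assoc add.commute[of 1])
qed

end

section \<open>Sums over all nodes\<close>

text \<open>The left side is the squared bias plus the variance, and the variance is at most the
  second moment about any centre \<open>s\<close>. The free choice of \<open>s\<close> allows
  centring at a convenient value instead of the mean.\<close>

lemma pmf_second_moment_le:
  fixes Y :: "'a \<Rightarrow> real"
  assumes "finite (set_pmf p)"
  shows "measure_pmf.expectation p (\<lambda>x. (Y x - a)\<^sup>2)
    \<le> (measure_pmf.expectation p Y - a)\<^sup>2 + measure_pmf.expectation p (\<lambda>x. (Y x - s)\<^sup>2)"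
proof -
  have int: "integrable (measure_pmf p) f" for f :: "'a \<Rightarrow> real"
    by (rule integrable_measure_pmf_finite[OF assms])
  define m where "m = measure_pmf.expectation p Y"
  have "measure_pmf.expectation p (\<lambda>x. (Y x - s)\<^sup>2)
      = measure_pmf.expectation p (\<lambda>x. (Y x - a)\<^sup>2 + (2 * (a - s) * Y x + (s\<^sup>2 - a\<^sup>2)))"
    by (intro Bochner_Integration.integral_cong) (auto simp: power2_eq_square algebra_simps)
  also have "\<dots> = measure_pmf.expectation p (\<lambda>x. (Y x - a)\<^sup>2) + (2 * (a - s) * m + (s\<^sup>2 - a\<^sup>2))"
    by (simp add: int m_def)
  finally have "measure_pmf.expectation p (\<lambda>x. (Y x - s)\<^sup>2) + (m - a)\<^sup>2
     = measure_pmf.expectation p (\<lambda>x. (Y x - a)\<^sup>2) + (m - s)\<^sup>2"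
    by (simp add: power2_eq_square algebra_simps)
  moreover have "0 \<le> (m - s)\<^sup>2" by simp
  ultimately show ?thesis unfolding m_def[symmetric] by argo
qed

lemma degrees_attach:
  assumes "finite (parcs G)" "e \<notin> parcs G"
  shows "D_in (attach G u e) w = D_in G w + (if snd e = w then 1 else 0)"
    and "D_out (attach G u e) w = D_out G w + (if fst e = w then 1 else 0)"
proof -
  have "{x \<in> insert e (parcs G). snd x = w} =
      (if snd e = w then insert e {x \<in> parcs G. snd x = w} else {x \<in> parcs G. snd x = w})"
    "{x \<in> insert e (parcs G). fst x = w} =
      (if fst e = w then insert e {x \<in> parcs G. fst x = w} else {x \<in> parcs G. fst x = w})" by auto
  thus "D_in (attach G u e) w = D_in G w + (if snd e = w then 1 else 0)"
    "D_out (attach G u e) w = D_out G w + (if fst e = w then 1 else 0)"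
    using assms by (auto simp: in_degree_def in_arcs_def out_degree_def out_arcs_def attach_def)
qed

section \<open>One attachment step acting on sums over nodes\<close>

context attachment begin

abbreviation PA :: "nat \<Rightarrow> nat pair_pre_digraph pmf" where
  "PA n \<equiv> pref_attach \<alpha> d1 d2 n"

definition PA_step :: "nat \<Rightarrow> nat pair_pre_digraph \<Rightarrow> nat pair_pre_digraph pmf" where
  "PA_step n G = bind_pmf (bernoulli_pmf \<alpha>) (\<lambda>from_new.
        if from_new
        then map_pmf (\<lambda>v. attach G (n + 1) (n + 1, v)) (choose_node d1 n (D_in G))
        else map_pmf (\<lambda>v. attach G (n + 1) (v, n + 1)) (choose_node d2 n (D_out G)))"

lemma PA_Suc: "1 \<le> n \<Longrightarrow> PA (Suc n) = bind_pmf (PA n) (PA_step n)"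
  by (cases n) (simp_all add: Let_def PA_step_def[abs_def])

lemmas PA_support = pref_attach_support[OF d1_pos d2_pos, of _ _ \<alpha>]

text \<open>A graph in the support is determined by its set of arcs, a subset of a finite set. This
  makes every real function integrable and all conditional expectations finite sums.\<close>

lemma finite_PA: "1 \<le> n \<Longrightarrow> finite (set_pmf (PA n))"
proof -
  assume n: "1 \<le> n"
  have "set_pmf (PA n) \<subseteq> (\<lambda>A. \<lparr>pverts = {1..n}, parcs = A\<rparr>) ` Pow ({1..n} \<times> {1..n})"
  proof
    fix G assume "G \<in> set_pmf (PA n)"
    from PA_support[OF n this] show "G \<in> (\<lambda>A. \<lparr>pverts = {1..n}, parcs = A\<rparr>) ` Pow ({1..n} \<times> {1..n})"
      by (intro image_eqI[of _ _ "parcs G"]) auto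
  qed
  thus ?thesis by (rule finite_subset) simp
qed

lemma integrable_PA: "1 \<le> n \<Longrightarrow> integrable (measure_pmf (PA n)) (f :: _ \<Rightarrow> real)"
  by (intro integrable_measure_pmf_finite finite_PA)

lemma degrees_le:
  assumes "1 \<le> n" "G \<in> set_pmf (PA n)"
  shows "D_in G v \<le> n" "D_out G v \<le> n"
proof -
  note s = PA_support[OF assms]
  have "card {e \<in> parcs G. snd e = v} \<le> card (parcs G)" "card {e \<in> parcs G. fst e = v} \<le> card (parcs G)"
    using s by (auto intro!: card_mono)
  thus "D_in G v \<le> n" "D_out G v \<le> n"
    using s by (auto simp: in_degree_def in_arcs_def out_degree_def out_arcs_def)
qed

lemma degrees_new:
  assumes "1 \<le> n" "G \<in> set_pmf (PA n)"
  shows "D_in G (Suc n) = 0" "D_out G (Suc n) = 0"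
proof -
  note s = PA_support[OF assms]
  show "D_in G (Suc n) = 0" "D_out G (Suc n) = 0"
    using s by (auto simp: in_degree_def in_arcs_def out_degree_def out_arcs_def card_eq_0_iff)
qed

lemma set_choose_node:
  assumes n: "1 \<le> n" and G: "G \<in> set_pmf (PA n)"
  shows "set_pmf (choose_node d1 n (D_in G)) \<subseteq> {1..n}" "set_pmf (choose_node d2 n (D_out G)) \<subseteq> {1..n}"
proof -
  note s = PA_support[OF n G]
  show "set_pmf (choose_node d1 n (D_in G)) \<subseteq> {1..n}" "set_pmf (choose_node d2 n (D_out G)) \<subseteq> {1..n}"
    using n s sum_degrees[of G n] pmf_choose_node[OF d1_pos, of n "D_in G"]
      pmf_choose_node[OF d2_pos, of n "D_out G"]
    by (auto simp: set_pmf_eq split: if_splits)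
qed

lemma sum_prob:
  assumes n: "1 \<le> n" and G: "G \<in> set_pmf (PA n)"
  shows "(\<Sum>v=1..n. prob1 n (D_in G v)) = \<alpha>" "(\<Sum>v=1..n. prob2 n (D_out G v)) = \<gamma>"
proof -
  note s = PA_support[OF n G]
  have "(\<Sum>v=1..n. real (D_in G v)) = real n" "(\<Sum>v=1..n. real (D_out G v)) = real n"
    using sum_degrees[OF s(2,3)] s(4) by (simp_all flip: of_nat_sum)
  moreover have "(\<Sum>v=1..n. prob1 n (D_in G v)) = c1 * ((\<Sum>v=1..n. real (D_in G v)) + real n * d1) / real n"
    "(\<Sum>v=1..n. prob2 n (D_out G v)) = c2 * ((\<Sum>v=1..n. real (D_out G v)) + real n * d2) / real n"
    by (simp_all add: prob1_def prob2_def sum.distrib flip: sum_divide_distrib sum_distrib_left)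
  moreover have "c1 * (real n + real n * d1) / real n = c1 * (1 + d1)" "c2 * (real n + real n * d2) / real n = c2 * (1 + d2)"
    using n by (simp_all add: field_simps)
  moreover have "c1 * (1 + d1) = \<alpha>" "c2 * (1 + d2) = \<gamma>"
    using d1_pos d2_pos by (simp_all add: c1_eq c2_eq)
  ultimately show "(\<Sum>v=1..n. prob1 n (D_in G v)) = \<alpha>" "(\<Sum>v=1..n. prob2 n (D_out G v)) = \<gamma>"
    by simp_all
qed

lemma expectation_PA_step:
  assumes n: "1 \<le> n" and G: "G \<in> set_pmf (PA n)"
  shows "measure_pmf.expectation (PA_step n G) \<psi> =
    (\<Sum>v=1..n. prob1 n (D_in G v) * \<psi> (attach G (n + 1) (n + 1, v))) +
    (\<Sum>v=1..n. prob2 n (D_out G v) * (\<psi> (attach G (n + 1) (v, n + 1)) :: real))"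
proof -
  note c = set_choose_node[OF n G]
  have 1: "measure_pmf.expectation (choose_node d1 n (D_in G)) f =
      (\<Sum>v=1..n. f v * ((real (D_in G v) + d1) / ((1 + d1) * real n)))" for f :: "nat \<Rightarrow> real"
    using c pmf_choose_node_in[OF d1_pos d2_pos n G]
    by (subst integral_measure_pmf_real[of "{1..n}"]) auto
  have 2: "measure_pmf.expectation (choose_node d2 n (D_out G)) f =
      (\<Sum>v=1..n. f v * ((real (D_out G v) + d2) / ((1 + d2) * real n)))" for f :: "nat \<Rightarrow> real"
    using c pmf_choose_node_out[OF d1_pos d2_pos n G]
    by (subst integral_measure_pmf_real[of "{1..n}"]) auto
  have fin: "finite (set_pmf (if b then map_pmf (\<lambda>v. attach G (n + 1) (n + 1, v)) (choose_node d1 n (D_in G))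
        else map_pmf (\<lambda>v. attach G (n + 1) (v, n + 1)) (choose_node d2 n (D_out G))))" for b
    using c by (auto intro: finite_subset)
  have "measure_pmf.expectation (PA_step n G) \<psi> =
      \<alpha> * (\<Sum>v=1..n. \<psi> (attach G (n + 1) (n + 1, v)) * ((real (D_in G v) + d1) / ((1 + d1) * real n))) +
      (1 - \<alpha>) * (\<Sum>v=1..n. \<psi> (attach G (n + 1) (v, n + 1)) * ((real (D_out G v) + d2) / ((1 + d2) * real n)))"
    unfolding PA_step_def using \<alpha>_pos \<alpha>_less fin
    by (subst pmf_expectation_bind[of UNIV]) (auto simp: UNIV_bool 1 2)
  thus ?thesis
    unfolding sum_distrib_left prob1_def prob2_def
    unfolding c1_eq c2_eq \<gamma>_eq by (simp add: mult_ac)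
qed

lemma finite_PA_step:
  assumes n: "1 \<le> n" and G: "G \<in> set_pmf (PA n)"
  shows "finite (set_pmf (PA_step n G))"
  by (rule finite_subset[OF _ finite_PA[of "Suc n"]]) (use n G in \<open>auto simp: PA_Suc\<close>)

lemma expectation_PA_Suc:
  assumes n: "1 \<le> n"
  shows "measure_pmf.expectation (PA (Suc n)) (\<psi> :: _ \<Rightarrow> real) =
    measure_pmf.expectation (PA n) (\<lambda>G. measure_pmf.expectation (PA_step n G) \<psi>)"
  unfolding PA_Suc[OF n] using finite_PA[OF n] finite_PA_step[OF n]
  by (subst pmf_expectation_bind[of "set_pmf (PA n)"]) (auto simp: integral_measure_pmf_real[OF finite_PA[OF n]] mult.commute)

definition degree_sum :: "(nat \<Rightarrow> nat \<Rightarrow> real) \<Rightarrow> nat \<Rightarrow> nat pair_pre_digraph \<Rightarrow> real" where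
  "degree_sum h n G = (\<Sum>v=1..n. h (D_in G v) (D_out G v))"

lemma degree_sum_attach:
  assumes n: "1 \<le> n" and G: "G \<in> set_pmf (PA n)" and v: "v \<in> {1..n}"
  shows "degree_sum h (Suc n) (attach G (n + 1) (n + 1, v)) = degree_sum h n G +
      (h (Suc (D_in G v)) (D_out G v) - h (D_in G v) (D_out G v)) + h 0 1" (is ?A)
    and "degree_sum h (Suc n) (attach G (n + 1) (v, n + 1)) = degree_sum h n G +
      (h (D_in G v) (Suc (D_out G v)) - h (D_in G v) (D_out G v)) + h 1 0" (is ?B)
proof -
  note s = PA_support[OF n G]
  have new: "(n + 1, v) \<notin> parcs G" "(v, n + 1) \<notin> parcs G" using s by auto
  note deg = degrees_attach[OF s(2) new(1), unfolded Suc_eq_plus1[symmetric]]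
    degrees_attach[OF s(2) new(2), unfolded Suc_eq_plus1[symmetric]] degrees_new[OF n G]
  have split: "(\<Sum>w=1..n. f w) = f v + (\<Sum>w\<in>{1..n}-{v}. f w)" for f :: "nat \<Rightarrow> real"
    using v by (intro sum.remove) auto
  have degree_sum_Suc: "degree_sum h (Suc n) H = h (D_in H v) (D_out H v) +
      (\<Sum>w\<in>{1..n}-{v}. h (D_in H w) (D_out H w)) + h (D_in H (Suc n)) (D_out H (Suc n))" for H
    using split[of "\<lambda>w. h (D_in H w) (D_out H w)"] by (simp add: degree_sum_def)
  have "degree_sum h (Suc n) (attach G (n + 1) (n + 1, v)) = h (Suc (D_in G v)) (D_out G v) +
      (\<Sum>w\<in>{1..n}-{v}. h (D_in G w) (D_out G w)) + h 0 1"
    unfolding degree_sum_Suc using v by (intro arg_cong2[of _ _ _ _ "(+)"] sum.cong) (auto simp: deg)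
  thus ?A unfolding degree_sum_def[of h n] split by simp
  have "degree_sum h (Suc n) (attach G (n + 1) (v, n + 1)) = h (D_in G v) (Suc (D_out G v)) +
      (\<Sum>w\<in>{1..n}-{v}. h (D_in G w) (D_out G w)) + h 1 0"
    unfolding degree_sum_Suc using v by (intro arg_cong2[of _ _ _ _ "(+)"] sum.cong) (auto simp: deg)
  thus ?B unfolding degree_sum_def[of h n] split by simp
qed

text \<open>The old sum enters with total weight \<alpha> + \<gamma> = 1. What is left are the
  increments at the chosen nodes, weighted as in \<open>step\<close>, and the value at the new
  node.\<close>

lemma expectation_PA_step_degree_sum:
  assumes n: "1 \<le> n" and G: "G \<in> set_pmf (PA n)"
  shows "measure_pmf.expectation (PA_step n G) (degree_sum h (Suc n)) =
    degree_sum (step n h) n G + \<alpha> * h 0 1 + \<gamma> * h 1 0"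
proof -
  let ?S = "degree_sum h n G" and ?h = "\<lambda>v. h (D_in G v) (D_out G v)"
  have "measure_pmf.expectation (PA_step n G) (degree_sum h (Suc n)) =
     (\<Sum>v=1..n. prob1 n (D_in G v) * (?S + (h (Suc (D_in G v)) (D_out G v) - ?h v) + h 0 1)) +
     (\<Sum>v=1..n. prob2 n (D_out G v) * (?S + (h (D_in G v) (Suc (D_out G v)) - ?h v) + h 1 0))"
    unfolding expectation_PA_step[OF n G]
    by (intro arg_cong2[of _ _ _ _ "(+)"] sum.cong refl) (simp_all only: degree_sum_attach[OF n G])
  also have "\<dots> = (\<Sum>v=1..n. prob1 n (D_in G v)) * (?S + h 0 1) + (\<Sum>v=1..n. prob2 n (D_out G v)) * (?S + h 1 0)
     + ((\<Sum>v=1..n. prob1 n (D_in G v) * (h (Suc (D_in G v)) (D_out G v) - ?h v)) +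
        (\<Sum>v=1..n. prob2 n (D_out G v) * (h (D_in G v) (Suc (D_out G v)) - ?h v)))"
    by (simp add: distrib_left sum.distrib sum_distrib_right)
  also have "\<dots> = \<alpha> * (?S + h 0 1) + \<gamma> * (?S + h 1 0) + (degree_sum (step n h) n G - ?S)"
    unfolding sum_prob[OF n G] degree_sum_def step_def
    by (simp add: sum.distrib)
  finally show ?thesis by (simp add: \<gamma>_eq algebra_simps)
qed

text \<open>The conditional variance of each step is at most \<open>9 * B\<^sup>2\<close>, because the new arc changes one
  old summand and adds one new summand; the conditional means are again sums over nodes.\<close>

lemma variance_degree_sum:
  assumes "1 \<le> n" "\<And>i j. i \<le> n \<Longrightarrow> j \<le> n \<Longrightarrow> \<bar>h i j\<bar> \<le> B"
  shows "measure_pmf.expectation (PA n) (\<lambda>G. (degree_sum h n G -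
           measure_pmf.expectation (PA n) (degree_sum h n))\<^sup>2) \<le> 9 * B\<^sup>2 * real n"
  using assms
proof (induction n arbitrary: h rule: dec_induct)
  case base
  then show ?case by simp
next
  case (step n)
  have n: "1 \<le> n" by fact
  have hB: "\<bar>h i j\<bar> \<le> B" if "i \<le> Suc n" "j \<le> Suc n" for i j using step.prems that by auto
  define c where "c = \<alpha> * h 0 1 + \<gamma> * h 1 0"
  define \<mu> where "\<mu> = measure_pmf.expectation (PA n) (degree_sum (step n h) n)"
  have mean: "measure_pmf.expectation (PA (Suc n)) (degree_sum h (Suc n)) = \<mu> + c"
  proof -
    have "measure_pmf.expectation (PA (Suc n)) (degree_sum h (Suc n)) =
        measure_pmf.expectation (PA n) (\<lambda>G. degree_sum (step n h) n G + c)"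
      unfolding expectation_PA_Suc[OF n]
      by (intro integral_cong_AE AE_pmfI) (simp_all add: expectation_PA_step_degree_sum[OF n] c_def)
    thus ?thesis by (simp add: \<mu>_def integrable_PA[OF n])
  qed
  have "measure_pmf.expectation (PA (Suc n)) (\<lambda>G. (degree_sum h (Suc n) G - (\<mu> + c))\<^sup>2)
     = measure_pmf.expectation (PA n) (\<lambda>G. measure_pmf.expectation (PA_step n G)
          (\<lambda>H. (degree_sum h (Suc n) H - (\<mu> + c))\<^sup>2))"
    by (rule expectation_PA_Suc[OF n])
  also have "\<dots> \<le> measure_pmf.expectation (PA n) (\<lambda>G. (degree_sum (step n h) n G - \<mu>)\<^sup>2 + 9 * B\<^sup>2)"
  proof (intro integral_mono_AE AE_pmfI integrable_PA n)
    fix G assume G: "G \<in> set_pmf (PA n)"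
    let ?s = "degree_sum h n G"
    have sq: "(x - y + z)\<^sup>2 \<le> 9 * B\<^sup>2" if "\<bar>x\<bar> \<le> B" "\<bar>y\<bar> \<le> B" "\<bar>z\<bar> \<le> B" for x y z
    proof -
      have "\<bar>x - y + z\<bar> \<le> 3 * B" using that by linarith
      hence "(x - y + z)\<^sup>2 \<le> (3 * B)\<^sup>2" by (rule abs_le_square_iff[THEN iffD1, OF order_trans]) simp
      thus ?thesis by (simp add: power_mult_distrib)
    qed
    note le = degrees_le[OF n G]
    have pnn: "0 \<le> prob1 n i" "0 \<le> prob2 n i" for i
      using c1_pos c2_pos d1_pos d2_pos by (auto simp: prob1_def prob2_def)
    \<comment> \<open>Centring at the old sum \<open>?s\<close> instead of the conditional mean
      leaves only three values of \<open>h\<close> for each arc, and this second moment dominates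
      the conditional variance.\<close>
    have "measure_pmf.expectation (PA_step n G) (\<lambda>H. (degree_sum h (Suc n) H - ?s)\<^sup>2)
       \<le> (\<Sum>v=1..n. prob1 n (D_in G v) * (9 * B\<^sup>2)) + (\<Sum>v=1..n. prob2 n (D_out G v) * (9 * B\<^sup>2))"
      unfolding expectation_PA_step[OF n G]
    proof (intro add_mono sum_mono mult_left_mono pnn)
      fix v assume v: "v \<in> {1..n}"
      have cancel: "s + (x - y) + z - s = x - y + z" for s x y z :: real by simp
      have l: "D_in G v \<le> Suc n" "D_out G v \<le> Suc n" "Suc (D_in G v) \<le> Suc n" "Suc (D_out G v) \<le> Suc n"
        using le[of v] by auto
      show "(degree_sum h (Suc n) (attach G (n + 1) (n + 1, v)) - ?s)\<^sup>2 \<le> 9 * B\<^sup>2"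
        unfolding degree_sum_attach[OF n G v] cancel using sq[OF hB[OF l(3,2)] hB[OF l(1,2)] hB[of 0 1]] by simp
      show "(degree_sum h (Suc n) (attach G (n + 1) (v, n + 1)) - ?s)\<^sup>2 \<le> 9 * B\<^sup>2"
        unfolding degree_sum_attach[OF n G v] cancel using sq[OF hB[OF l(1,4)] hB[OF l(1,2)] hB[of 1 0]] by simp
    qed
    also have "\<dots> = (\<alpha> + \<gamma>) * (9 * B\<^sup>2)"
      by (simp only: sum_distrib_right[symmetric] sum_prob[OF n G] distrib_right)
    also have "\<alpha> + \<gamma> = 1" by (simp add: \<gamma>_eq)
    finally have "measure_pmf.expectation (PA_step n G) (\<lambda>H. (degree_sum h (Suc n) H - ?s)\<^sup>2) \<le> 9 * B\<^sup>2" by simp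
    moreover have eq: "measure_pmf.expectation (PA_step n G) (degree_sum h (Suc n)) - (\<mu> + c) = degree_sum (step n h) n G - \<mu>"
      by (simp add: expectation_PA_step_degree_sum[OF n G] c_def)
    ultimately show "measure_pmf.expectation (PA_step n G) (\<lambda>H. (degree_sum h (Suc n) H - (\<mu> + c))\<^sup>2)
        \<le> (degree_sum (step n h) n G - \<mu>)\<^sup>2 + 9 * B\<^sup>2"
      using pmf_second_moment_le[OF finite_PA_step[OF n G], of "degree_sum h (Suc n)" "\<mu> + c" ?s]
      unfolding eq by linarith
  qed
  also have "\<dots> = measure_pmf.expectation (PA n) (\<lambda>G. (degree_sum (step n h) n G - \<mu>)\<^sup>2) + 9 * B\<^sup>2"
    by (simp add: integrable_PA[OF n])
  \<comment> \<open>The induction is over all \<open>h\<close>: the conditional mean is governed by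
    \<open>step n h\<close>, which as an average keeps the bound \<open>B\<close>.\<close>
  also have "\<dots> \<le> 9 * B\<^sup>2 * real n + 9 * B\<^sup>2"
    unfolding \<mu>_def
  proof (intro add_mono step.IH order_refl)
    fix i j assume "i \<le> n" "j \<le> n"
    thus "\<bar>step n h i j\<bar> \<le> B"
      using steps_abs_bound[of n 1 h B i j] hB n by simp
  qed
  finally show ?case unfolding mean by (simp add: algebra_simps)
qed

text \<open>Node 1 starts from \<open>(1, 1)\<close> because of the self loop and is kept apart; a
  node \<open>v \<ge> 2\<close> enters at its own birth and is propagated over the remaining
  \<open>n - v\<close> steps.\<close>

lemma expectation_degree_sum:
  assumes "1 \<le> n"
  shows "measure_pmf.expectation (PA n) (degree_sum h n) = steps 1 (n - 1) h 1 1 +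
    (\<Sum>v=2..n. \<alpha> * steps v (n - v) h 0 1 + \<gamma> * steps v (n - v) h 1 0)"
  using assms
proof (induction n arbitrary: h rule: dec_induct)
  case base
  have "{e. e = (Suc 0, Suc 0) \<and> snd e = Suc 0} = {(1, 1)}" "{e. e = (Suc 0, Suc 0) \<and> fst e = Suc 0} = {(1, 1)}"
    by auto
  then show ?case
    by (simp add: degree_sum_def in_degree_def in_arcs_def out_degree_def out_arcs_def)
next
  case (step n)
  have n: "1 \<le> n" by fact
  have "measure_pmf.expectation (PA (Suc n)) (degree_sum h (Suc n)) =
      measure_pmf.expectation (PA n) (\<lambda>G. degree_sum (step n h) n G + (\<alpha> * h 0 1 + \<gamma> * h 1 0))"
    unfolding expectation_PA_Suc[OF n]
    by (intro integral_cong_AE AE_pmfI) (simp_all add: expectation_PA_step_degree_sum[OF n])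
  also have "\<dots> = measure_pmf.expectation (PA n) (degree_sum (step n h) n) + (\<alpha> * h 0 1 + \<gamma> * h 1 0)"
    by (simp add: integrable_PA[OF n])
  also have "measure_pmf.expectation (PA n) (degree_sum (step n h) n) = steps 1 (Suc n - 1) h 1 1 +
      (\<Sum>v=2..n. \<alpha> * steps v (Suc n - v) h 0 1 + \<gamma> * steps v (Suc n - v) h 1 0)"
  proof -
    have "steps v (n - v) (step n h) = steps v (Suc n - v) h" if "v \<le> n" for v
      using that by (simp add: Suc_diff_le)
    thus ?thesis unfolding step.IH using n by (auto intro!: sum.cong)
  qed
  finally show ?case using n by (simp add: sum.cl_ivl_Suc)
qed

end

section \<open>Scaling limit of a single node\<close>

text \<open>The lower growth condition appears as \<open>k_large\<close>, the form that controls a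
  variance O(n) after division by the square of \<open>k n\<close>.\<close>

locale scaled_attachment = attachment +
  fixes k :: "nat \<Rightarrow> nat"
  assumes k_pos: "\<And>n. 1 \<le> n \<Longrightarrow> 0 < k n"
    and k_small: "(\<lambda>n. real (k n) / real n) \<longlonglongrightarrow> 0"
    and k_large: "(\<lambda>n. real n / (real (k n))\<^sup>2) \<longlonglongrightarrow> 0"
begin

definition b1 :: "nat \<Rightarrow> real" where "b1 n = (real n / real (k n)) powr c1"
definition b2 :: "nat \<Rightarrow> real" where "b2 n = (real n / real (k n)) powr c2"

lemma b_pos: "1 \<le> n \<Longrightarrow> 0 < b1 n" "1 \<le> n \<Longrightarrow> 0 < b2 n"
  using k_pos[of n] by (auto simp: b1_def b2_def)

lemma real_k_at_top: "filterlim (\<lambda>n. real (k n)) at_top sequentially"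
proof (rule filterlim_at_top_mono)
  show "filterlim (\<lambda>n. sqrt (real n)) at_top sequentially"
    by (rule filterlim_compose[OF sqrt_at_top filterlim_real_sequentially])
  have "\<forall>\<^sub>F n in sequentially. real n / (real (k n))\<^sup>2 < 1"
    using k_large by (rule order_tendstoD) simp
  thus "\<forall>\<^sub>F n in sequentially. sqrt (real n) \<le> real (k n)"
    using eventually_ge_at_top[of "1::nat"]
  proof eventually_elim
    case (elim n)
    hence "real n \<le> (real (k n))\<^sup>2" using k_pos[of n] by simp
    thus ?case by (rule real_le_lsqrt[rotated]) simp
  qed
qed

lemma ceiling_ratio:
  assumes "0 < s"
  shows "(\<lambda>n. real (nat \<lceil>real (k n) * s\<rceil>) / real (k n)) \<longlonglongrightarrow> s"
proof (rule real_tendsto_sandwich[where f="\<lambda>_. s" and h="\<lambda>n. s + 1 / real (k n)"])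
  have ev: "\<forall>\<^sub>F n in sequentially. 0 < k n" using k_pos by (auto simp: eventually_sequentially)
  have nn: "0 \<le> real (k n) * s" for n using assms by simp
  show "\<forall>\<^sub>F n in sequentially. s \<le> real (nat \<lceil>real (k n) * s\<rceil>) / real (k n)"
    using ev
  proof eventually_elim
    case (elim n)
    have "real (k n) * s \<le> real (nat \<lceil>real (k n) * s\<rceil>)" by (rule real_nat_ceiling_ge)
    thus ?case using elim by (simp add: field_simps)
  qed
  show "\<forall>\<^sub>F n in sequentially. real (nat \<lceil>real (k n) * s\<rceil>) / real (k n) \<le> s + 1 / real (k n)"
    using ev
  proof eventually_elim
    case (elim n)
    have "real (nat \<lceil>real (k n) * s\<rceil>) \<le> real (k n) * s + 1"
      using nn[of n] by linarith
    hence "real (nat \<lceil>real (k n) * s\<rceil>) / real (k n) \<le> (real (k n) * s + 1) / real (k n)"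
      by (rule divide_right_mono) simp
    thus ?case using elim by (simp add: add_divide_distrib)
  qed
  have "(\<lambda>n. 1 / real (k n)) \<longlonglongrightarrow> 0"
    using real_k_at_top by (rule tendsto_divide_0[OF tendsto_const filterlim_at_top_imp_at_infinity])
  thus "(\<lambda>n. s + 1 / real (k n)) \<longlonglongrightarrow> s" using tendsto_add[OF tendsto_const] by force
qed simp

lemma eventually_ceiling_le:
  assumes "0 < s"
  shows "\<forall>\<^sub>F n in sequentially. 1 \<le> nat \<lceil>real (k n) * s\<rceil> \<and> nat \<lceil>real (k n) * s\<rceil> \<le> n"
proof -
  have "(\<lambda>n. real (nat \<lceil>real (k n) * s\<rceil>) / real (k n) * (real (k n) / real n)) \<longlonglongrightarrow> s * 0"
    by (intro tendsto_mult ceiling_ratio assms k_small)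
  hence "\<forall>\<^sub>F n in sequentially. real (nat \<lceil>real (k n) * s\<rceil>) / real (k n) * (real (k n) / real n) < 1"
    by (rule order_tendstoD(2)) simp
  thus ?thesis using eventually_ge_at_top[of "1::nat"]
  proof eventually_elim
    case (elim n)
    have "real (nat \<lceil>real (k n) * s\<rceil>) < real n" using elim k_pos[of n] by simp
    moreover have "0 < real (k n) * s" using elim k_pos[of n] assms by simp
    ultimately show ?case by linarith
  qed
qed

text \<open>\<open>\<kappa> n\<close> is the parameter for which \<open>lap\<close> at time
  \<open>n\<close> equals exp (- p / b), with b = (n / k_n)^c the degree scale. Dividing it by v^c
  gives ((exp (p u) - 1) / u) (v / k_n)^(- c) with u = (k_n / n)^c \<rightarrow> 0, and the
  difference quotient tends to p.\<close>

lemma lap_at_ceiling: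
  fixes c p s :: real
  assumes c: "0 < c" and p: "0 \<le> p" and s: "0 < s"
  defines "\<kappa> \<equiv> \<lambda>n. (exp (p / (real n / real (k n)) powr c) - 1) * real n powr c"
  shows "(\<lambda>n. lap c (\<kappa> n) (real (nat \<lceil>real (k n) * s\<rceil>))) \<longlonglongrightarrow> 1 / (1 + p * s powr (- c))"
proof -
  define u where "u n = (real (k n) / real n) powr c" for n
  define v where "v n = nat \<lceil>real (k n) * s\<rceil>" for n
  have ev: "\<forall>\<^sub>F n in sequentially. 1 \<le> n \<and> 1 \<le> v n"
    by (rule eventually_mono[OF eventually_ceiling_le[OF s]]) (unfold v_def, metis order_trans)
  have u0: "u \<longlonglongrightarrow> 0" unfolding u_def
    using c by (intro tendsto_zero_powrI[OF k_small tendsto_const _ c]) auto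
  have "((\<lambda>x. exp (p * x)) has_real_derivative p) (at 0)"
    by (auto intro!: derivative_eq_intros)
  hence D: "((\<lambda>x. (exp (p * x) - 1) / x) \<longlongrightarrow> p) (at 0)" by (simp add: DERIV_def)
  have "filterlim u (at 0) sequentially"
    unfolding filterlim_at using u0 ev k_pos by (auto simp: u_def elim!: eventually_mono)
  from filterlim_compose[OF D this] have e: "(\<lambda>n. (exp (p * u n) - 1) / u n) \<longlonglongrightarrow> p" .
  have r: "(\<lambda>n. (real (v n) / real (k n)) powr (- c)) \<longlonglongrightarrow> s powr (- c)"
    using s unfolding v_def by (intro tendsto_powr ceiling_ratio tendsto_const) auto
  have "(\<lambda>n. 1 / (1 + (exp (p * u n) - 1) / u n * (real (v n) / real (k n)) powr (- c)))
      \<longlonglongrightarrow> 1 / (1 + p * s powr (- c))"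
  proof (rule tendsto_divide[OF tendsto_const tendsto_add[OF tendsto_const tendsto_mult[OF e r]]])
    show "1 + p * s powr (- c) \<noteq> 0" using mult_nonneg_nonneg[OF p powr_ge_zero[of s "- c"]] by simp
  qed
  thus ?thesis
  proof (rule Lim_transform_eventually)
    show "\<forall>\<^sub>F n in sequentially. 1 / (1 + (exp (p * u n) - 1) / u n * (real (v n) / real (k n)) powr (- c))
       = lap c (\<kappa> n) (real (nat \<lceil>real (k n) * s\<rceil>))"
      using ev
    proof eventually_elim
      case (elim n)
      note kn = k_pos[of n]
      have 1: "p / (real n / real (k n)) powr c = p * u n"
        using elim kn by (simp add: u_def powr_divide)
      have 2: "\<kappa> n / real (v n) powr c = (exp (p * u n) - 1) / u n * (real (v n) / real (k n)) powr (- c)"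
        using elim kn unfolding \<kappa>_def 1 by (simp add: u_def powr_divide powr_minus)
      have "lap c (\<kappa> n) (real (v n)) = 1 / (1 + \<kappa> n / real (v n) powr c)"
        using elim by (simp add: lap_def add_divide_distrib[symmetric] field_simps)
      hence "1 / (1 + (exp (p * u n) - 1) / u n * (real (v n) / real (k n)) powr (- c)) = lap c (\<kappa> n) (real (v n))"
        unfolding 2 by simp
      thus ?case unfolding v_def .
    qed
  qed
qed

text \<open>By the choice of \<open>\<kappa>\<close> and \<open>\<mu>\<close> the terminal function
  is an almost invariant product up to a scalar. Both parameters vary with \<open>n\<close>, so the
  argument relies on the uniformity of \<open>steps_lap_bound\<close>, whose error is O(1 / v
  n).\<close>

lemma steps_exp_limit:
  fixes p q s :: real
  assumes p: "0 \<le> p" and q: "0 \<le> q" and s: "0 < s" and ij: "i \<le> 1" "j \<le> 1"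
  shows "(\<lambda>n. steps (nat \<lceil>real (k n) * s\<rceil>) (n - nat \<lceil>real (k n) * s\<rceil>)
        (\<lambda>i j. exp (- p * (real i / b1 n)) * exp (- q * (real j / b2 n))) i j)
     \<longlonglongrightarrow> (1 / (1 + p * s powr (- c1))) powr (real i + d1) * (1 / (1 + q * s powr (- c2))) powr (real j + d2)"
proof -
  define v where "v n = nat \<lceil>real (k n) * s\<rceil>" for n
  define h where "h n = (\<lambda>i j. exp (- p * (real i / b1 n)) * exp (- q * (real j / b2 n)))" for n
  define \<kappa> where "\<kappa> n = (exp (p / (real n / real (k n)) powr c1) - 1) * real n powr c1" for n
  define \<mu> where "\<mu> n = (exp (q / (real n / real (k n)) powr c2) - 1) * real n powr c2" for n
  define \<Phi> where "\<Phi> n t i j = lap c1 (\<kappa> n) (real t) powr (real i + d1) * lap c2 (\<mu> n) (real t) powr (real j + d2)" for n t i j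
  \<comment> \<open>The exponents in \<open>\<Phi>\<close> are shifted by \<open>d1\<close> and
    \<open>d2\<close>; \<open>\<delta> n\<close> is the resulting excess factor and tends to
    1.\<close>
  define \<delta> where "\<delta> n = exp (- p * (d1 / b1 n)) * exp (- q * (d2 / b2 n))" for n
  define E where "E n = 6 * (1 / real (v n)) + 3 * (1 / real (v n)) ^ 2" for n
  have \<kappa>0: "0 \<le> \<kappa> n" "0 \<le> \<mu> n" for n using p q by (simp_all add: \<kappa>_def \<mu>_def)
  have ev: "\<forall>\<^sub>F n in sequentially. 1 \<le> n \<and> 1 \<le> v n \<and> v n \<le> n"
    by (rule eventually_mono[OF eventually_ceiling_le[OF s]]) (unfold v_def, metis order_trans)
  have \<Phi>_n: "\<Phi> n n = (\<lambda>i j. \<delta> n * h n i j)" if n: "1 \<le> n" for n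
  proof (intro ext)
    fix i j
    have "lap c1 (\<kappa> n) (real n) = exp (- (p / b1 n))" "lap c2 (\<mu> n) (real n) = exp (- (q / b2 n))"
      using n by (simp_all add: lap_def \<kappa>_def \<mu>_def b1_def b2_def exp_minus field_simps)
    thus "\<Phi> n n i j = \<delta> n * h n i j"
      unfolding \<Phi>_def by (simp add: powr_def \<delta>_def h_def exp_add[symmetric]) (simp add: add_divide_distrib algebra_simps)
  qed
  have b_inv: "(\<lambda>n. x / (real n / real (k n)) powr c) \<longlonglongrightarrow> 0" if c: "0 < c" for x c :: real
  proof -
    have "(\<lambda>n. x * (real (k n) / real n) powr c) \<longlonglongrightarrow> x * 0"
      using c by (intro tendsto_mult tendsto_const tendsto_zero_powrI[OF k_small tendsto_const]) auto
    thus ?thesis by (simp add: powr_divide)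
  qed
  have to0: "(\<lambda>n. x / f n) \<longlonglongrightarrow> 0" if "filterlim f at_top sequentially" for x :: real and f
    using that by (intro tendsto_divide_0[OF tendsto_const] filterlim_at_top_imp_at_infinity)
  have "(\<lambda>n. exp (- p * (d1 / b1 n)) * exp (- q * (d2 / b2 n))) \<longlonglongrightarrow> exp (- p * 0) * exp (- q * 0)"
    unfolding b1_def b2_def by (intro tendsto_intros b_inv c1_pos c2_pos)
  hence \<delta>: "\<delta> \<longlonglongrightarrow> 1" by (simp add: \<delta>_def[abs_def])
  have "filterlim (\<lambda>n. real (v n)) at_top sequentially"
  proof (rule filterlim_at_top_mono)
    show "filterlim (\<lambda>n. s * real (k n)) at_top sequentially"
      by (rule filterlim_tendsto_pos_mult_at_top[OF tendsto_const s real_k_at_top])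
    show "\<forall>\<^sub>F n in sequentially. s * real (k n) \<le> real (v n)"
      unfolding v_def by (auto simp: mult.commute real_nat_ceiling_ge)
  qed
  hence "E \<longlonglongrightarrow> 6 * 0 + 3 * 0 ^ 2" unfolding E_def by (intro tendsto_intros to0)
  hence E: "E \<longlonglongrightarrow> 0" by simp
  have \<Phi>lim: "(\<lambda>n. \<Phi> n (v n) i j) \<longlonglongrightarrow> (1 / (1 + p * s powr (- c1))) powr (real i + d1) * (1 / (1 + q * s powr (- c2))) powr (real j + d2)"
    (is "_ \<longlonglongrightarrow> ?L")
  proof -
    have pos: "0 < 1 + p * s powr (- c1)" "0 < 1 + q * s powr (- c2)"
      using p q by (auto intro!: add_pos_nonneg)
    show ?thesis
      unfolding \<Phi>_def v_def \<kappa>_def \<mu>_def using pos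
      by (intro tendsto_intros lap_at_ceiling c1_pos c2_pos p q s) auto
  qed
  have bound: "\<forall>\<^sub>F n in sequentially. norm (\<delta> n * steps (v n) (n - v n) (h n) i j - \<Phi> n (v n) i j) \<le> E n"
    using ev
  proof eventually_elim
    case (elim n)
    have "\<bar>steps (v n) (n - v n) (\<Phi> n (v n + (n - v n))) i j - \<Phi> n (v n) i j\<bar>
      \<le> 6 * (1 / real (v n) - 1 / real (v n + (n - v n))) + 3 * (1 / (real (v n))\<^sup>2 - 1 / (real (v n + (n - v n)))\<^sup>2)"
      using elim ij unfolding \<Phi>_def by (intro steps_lap_bound \<kappa>0) auto
    also have "\<dots> \<le> 6 * (1 / real (v n) - 0) + 3 * (1 / (real (v n))\<^sup>2 - 0)"
      by (intro add_mono mult_left_mono diff_mono) auto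
    also have "\<dots> = E n" by (simp add: E_def power_one_over)
    finally show ?case using elim by (simp add: \<Phi>_n steps_scale)
  qed
  have "(\<lambda>n. \<delta> n * steps (v n) (n - v n) (h n) i j - \<Phi> n (v n) i j) \<longlonglongrightarrow> 0"
    by (rule Lim_null_comparison[OF bound E])
  from tendsto_divide[OF tendsto_add[OF this \<Phi>lim] \<delta>]
  have "(\<lambda>n. \<delta> n * steps (v n) (n - v n) (h n) i j / \<delta> n) \<longlonglongrightarrow> ?L" by simp
  moreover have "\<delta> n \<noteq> 0" for n by (simp add: \<delta>_def)
  ultimately have "(\<lambda>n. steps (v n) (n - v n) (h n) i j) \<longlonglongrightarrow> ?L" by simp
  thus ?thesis unfolding v_def h_def .
qed

section \<open>Decay in s of the contribution of late nodes\<close>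

lemma pochhammer_ge_power: "0 \<le> x \<Longrightarrow> x ^ p \<le> pochhammer (x :: real) p"
  using prod_mono[of "{0..<p}" "\<lambda>_. x" "\<lambda>i. x + real i"] by (simp add: pochhammer_prod)

text \<open>Where \<open>h\<close> is nonzero, some degree is at least e times its scale b, so |h|
  is at most B / (e b)^p times a rising factorial. The expectation of the latter grows like (n /
  v)^(c p), while b^p = (n / k_n)^(c p); the quotient is (k_n / v)^(c p) \<le> s^(- c p).\<close>

lemma steps_tail_bound:
  assumes B: "0 \<le> B" and e: "0 < e"
  obtains K where "0 \<le> K" and "\<And>n v s h i j. 1 \<le> n \<Longrightarrow> 1 \<le> v \<Longrightarrow> v \<le> n \<Longrightarrow> i \<le> 1 \<Longrightarrow> j \<le> 1 \<Longrightarrow> 0 < s \<Longrightarrow>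
    real (k n) * s \<le> real v \<Longrightarrow> (\<And>i j. \<bar>h i j\<bar> \<le> B) \<Longrightarrow>
    (\<And>i j. h i j \<noteq> 0 \<Longrightarrow> e \<le> real i / b1 n \<or> e \<le> real j / b2 n) \<Longrightarrow>
    \<bar>steps v (n - v) h i j\<bar> \<le> K / (1 + s\<^sup>2)"
proof -
  \<comment> \<open>The order \<open>p\<close> is large enough that s^(- c p) \<le> s^(- 2) for s >
    1 in both coordinates, which is integrable at infinity.\<close>
  obtain p where p: "2 / c1 \<le> real p" "2 / c2 \<le> real p"
    using real_arch_simple[of "max (2 / c1) (2 / c2)"] by auto
  have cp: "2 \<le> c1 * real p" "2 \<le> c2 * real p"
    using p c1_pos c2_pos by (simp_all add: field_simps)
  define A where "A = B / e ^ p * (exp (c1 * real p) * pochhammer (1 + d1) p + exp (c2 * real p) * pochhammer (1 + d2) p)"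
  \<comment> \<open>Joins the bound \<open>B\<close> for s \<le> 1 and the bound A / s^2 for s > 1:
    1 + s^2 is at most 2 in the first case and at most 2 s^2 in the second.\<close>
  define K where "K = 2 * A + 2 * B"
  have poch0: "0 \<le> pochhammer (real i + d1) p" "0 \<le> pochhammer (real j + d2) p" for i j
    using d1_pos d2_pos by (intro pochhammer_nonneg; simp)+
  have A0: "0 \<le> A" using B e poch0(1)[of 1] poch0(2)[of 1] by (simp add: A_def)
  show thesis
  proof (rule that[of K])
    show "0 \<le> K" using A0 B by (simp add: K_def)
    fix n v s h and i j :: nat
    assume n: "1 \<le> n" and v: "1 \<le> v" "v \<le> n" and ij: "i \<le> 1" "j \<le> 1" and s: "0 < s" "real (k n) * s \<le> real v"
      and hB: "\<And>i j. \<bar>h i j\<bar> \<le> B" and h0: "\<And>i j. h i j \<noteq> 0 \<Longrightarrow> e \<le> real i / b1 n \<or> e \<le> real j / b2 n"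
    have kn: "0 < k n" using k_pos n by simp
    have "\<bar>steps v (n - v) h i j\<bar> \<le> B" using v ij by (intro steps_abs_bound hB) auto
    moreover have "\<bar>steps v (n - v) h i j\<bar> \<le> A / s\<^sup>2" if s1: "1 < s"
    proof -
      let ?P = "\<lambda>i j :: nat. pochhammer (real i + d1) p" and ?Q = "\<lambda>i j :: nat. pochhammer (real j + d2) p"
      have le: "\<bar>h i j\<bar> \<le> (B / e ^ p / b1 n ^ p) * ?P i j + (B / e ^ p / b2 n ^ p) * ?Q i j" for i j
      proof -
        have *: "B \<le> (B / e ^ p / b ^ p) * pochhammer (real l + d) p" if "e \<le> real l / b" "0 < b" "0 < d" for l :: nat and b d
        proof -
          have "(e * b) ^ p \<le> (real l + d) ^ p"
            using that e by (intro power_mono) (auto simp: field_simps)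
          also have "\<dots> \<le> pochhammer (real l + d) p" using that by (intro pochhammer_ge_power) auto
          finally have "1 \<le> pochhammer (real l + d) p / (e ^ p * b ^ p)"
            using that e by (simp add: power_mult_distrib)
          from mult_left_mono[OF this B] show ?thesis by simp
        qed
        have nn: "0 \<le> (B / e ^ p / b1 n ^ p) * ?P i j" "0 \<le> (B / e ^ p / b2 n ^ p) * ?Q i j"
          using B e poch0 b_pos[OF n] by (intro mult_nonneg_nonneg divide_nonneg_nonneg; simp)+
        show ?thesis
        proof (cases "h i j = 0")
          case False
          from h0[OF this] show ?thesis
            using hB[of i j] nn *[of i "b1 n" d1] *[of j "b2 n" d2] b_pos[OF n] d1_pos d2_pos by fastforce
        qed (use nn in auto)
      qed
      have mult: "(1 / b ^ p) * steps v (n - v) g i j \<le> exp (c * real p) * C / s\<^sup>2"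
        if st: "\<And>t. 1 \<le> t \<Longrightarrow> step t g = (\<lambda>i j. (1 + c * real p / real t) * g i j)"
          and g: "0 \<le> g i j" "g i j \<le> C" and c: "0 < c" "2 \<le> c * real p" and b: "b = (real n / real (k n)) powr c"
        for g b c C
      proof -
        have bp: "b ^ p = (real n / real (k n)) powr (c * real p)" "0 < b ^ p"
          using n kn by (auto simp: b powr_realpow[symmetric] powr_powr)
        have "steps v (n - v) g i j \<le> exp (c * real p / real v - c * real p / real (v + (n - v)))
            * (real (v + (n - v)) / real v) powr (c * real p) * g i j"
          using c v g by (intro steps_multiplier st) auto
        also have "\<dots> \<le> exp (c * real p) * (real n / real v) powr (c * real p) * C"
        proof (intro mult_mono)
          have "c * real p / real v \<le> c * real p"
            using c v divide_left_mono[of 1 "real v" "c * real p"] by simp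
          moreover have "0 \<le> c * real p / real (v + (n - v))" using c by simp
          ultimately show "exp (c * real p / real v - c * real p / real (v + (n - v))) \<le> exp (c * real p)" by simp
        qed (use v g in auto)
        finally have "(1 / b ^ p) * steps v (n - v) g i j \<le> (1 / b ^ p) * (exp (c * real p) * (real n / real v) powr (c * real p) * C)"
          using bp by (intro mult_left_mono) auto
        also have "\<dots> = exp (c * real p) * C * (real (k n) / real v) powr (c * real p)"
          using n kn v by (simp add: bp powr_divide)
        also have "\<dots> \<le> exp (c * real p) * C * (1 / s\<^sup>2)"
        proof (rule mult_left_mono)
          have "(real (k n) / real v) powr (c * real p) \<le> (1 / s) powr (c * real p)"
            using s v c by (intro powr_mono2) (auto simp: field_simps)
          also have "\<dots> \<le> (1 / s) powr 2" using s1 c by (intro powr_mono') auto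
          also have "\<dots> = 1 / s\<^sup>2" using s by (simp add: powr_numeral power_one_over)
          finally show "(real (k n) / real v) powr (c * real p) \<le> 1 / s\<^sup>2" .
        qed (use g in auto)
        finally show ?thesis by simp
      qed
      have P: "?P i j \<le> pochhammer (1 + d1) p" "?Q i j \<le> pochhammer (1 + d2) p"
        unfolding pochhammer_prod using ij d1_pos d2_pos by (intro prod_mono; simp)+
      have "\<bar>steps v (n - v) h i j\<bar> \<le> steps v (n - v) (\<lambda>i j. (B / e ^ p / b1 n ^ p) * ?P i j + (B / e ^ p / b2 n ^ p) * ?Q i j) i j"
        using v ij by (intro steps_abs_le le) auto
      also have "\<dots> = B / e ^ p * ((1 / b1 n ^ p) * steps v (n - v) ?P i j + (1 / b2 n ^ p) * steps v (n - v) ?Q i j)"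
        by (simp only: steps_linear) (simp add: algebra_simps)
      also have "\<dots> \<le> B / e ^ p * (exp (c1 * real p) * pochhammer (1 + d1) p / s\<^sup>2 + exp (c2 * real p) * pochhammer (1 + d2) p / s\<^sup>2)"
        using B e
        by (intro mult_left_mono add_mono mult step_pochhammer1 step_pochhammer2 P poch0 c1_pos c2_pos cp b1_def b2_def) auto
      also have "\<dots> = A / s\<^sup>2" by (simp add: A_def add_divide_distrib distrib_left)
      finally show ?thesis .
    qed
    ultimately show "\<bar>steps v (n - v) h i j\<bar> \<le> K / (1 + s\<^sup>2)"
    proof (cases "1 < s")
      case True
      have "A / s\<^sup>2 \<le> 2 * A / (1 + s\<^sup>2)"
      proof -
        have "1 \<le> s\<^sup>2" using True by simp
        hence "2 * A / (2 * s\<^sup>2) \<le> 2 * A / (1 + s\<^sup>2)"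
          using A0 by (intro divide_left_mono mult_pos_pos add_pos_nonneg) auto
        thus ?thesis by simp
      qed
      also have "\<dots> \<le> K / (1 + s\<^sup>2)" using B by (intro divide_right_mono) (auto simp: K_def)
      finally show ?thesis using \<open>1 < s \<Longrightarrow> _\<close>[OF True] by simp
    next
      case False
      hence "s\<^sup>2 \<le> 1" using s by (simp add: power_le_one)
      hence "B * (1 + s\<^sup>2) \<le> B * 2" using B by (intro mult_left_mono) auto
      also have "\<dots> \<le> K" using A0 by (simp add: K_def)
      finally have "B \<le> K / (1 + s\<^sup>2)" by (simp add: field_simps add_pos_nonneg)
      thus ?thesis using \<open>\<bar>steps v (n - v) h i j\<bar> \<le> B\<close> by simp
    qed
  qed
qed

end

section \<open>Gamma densities and Riemann sums\<close>

text \<open>The Gamma distribution with shape \<open>\<kappa>\<close> and scale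
  \<open>\<theta>\<close>.\<close>

definition gamma_dens :: "real \<Rightarrow> real \<Rightarrow> real \<Rightarrow> real" where
  "gamma_dens \<kappa> \<theta> x = (if 0 < x then x powr (\<kappa> - 1) * exp (- (x / \<theta>)) / (\<theta> powr \<kappa> * Gamma \<kappa>) else 0)"

lemma gamma_dens_nonneg: "0 < \<kappa> \<Longrightarrow> 0 \<le> gamma_dens \<kappa> \<theta> x"
  using Gamma_real_pos[of \<kappa>] by (auto simp: gamma_dens_def intro!: divide_nonneg_nonneg)

lemma borel_measurable_gamma_dens [measurable]:
  assumes [measurable]: "f \<in> borel_measurable M" "g \<in> borel_measurable M"
  shows "(\<lambda>x. gamma_dens \<kappa> (f x) (g x)) \<in> borel_measurable M"
  unfolding gamma_dens_def by measurable

lemma nn_integral_gamma_kernel: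
  fixes \<beta> \<kappa> :: real
  assumes "0 < \<beta>" "0 < \<kappa>"
  shows "(\<integral>\<^sup>+ x. ennreal (if 0 < x then x powr (\<kappa> - 1) * exp (- \<beta> * x) else 0) \<partial>lborel) = ennreal (Gamma \<kappa> / \<beta> powr \<kappa>)"
proof -
  let ?f = "\<lambda>t. ennreal (indicator {0..} t * t powr (\<kappa> - 1) / exp t)"
  have "ennreal (Gamma \<kappa>) = (\<integral>\<^sup>+ t. ?f t \<partial>lborel)"
    by (rule Gamma_conv_nn_integral_real) fact
  also have "\<dots> = ennreal \<beta> * (\<integral>\<^sup>+ x. ?f (0 + \<beta> * x) \<partial>lborel)"
    using assms by (subst nn_integral_real_affine[of _ \<beta> 0]) auto
  also have "(\<integral>\<^sup>+ x. ?f (0 + \<beta> * x) \<partial>lborel)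
      = (\<integral>\<^sup>+ x. ennreal (\<beta> powr (\<kappa> - 1)) * ennreal (if 0 < x then x powr (\<kappa> - 1) * exp (- \<beta> * x) else 0) \<partial>lborel)"
    (is "_ = (\<integral>\<^sup>+ x. _ * ennreal (?g x) \<partial>lborel)")
  proof (intro nn_integral_cong_AE AE_mp[OF AE_lborel_singleton[of 0] AE_I2] impI)
    fix x :: real assume "x \<noteq> 0"
    thus "?f (0 + \<beta> * x) = ennreal (\<beta> powr (\<kappa> - 1)) * ennreal (?g x)"
      using assms by (auto simp: ennreal_mult[symmetric] powr_mult exp_minus field_simps
          zero_le_mult_iff indicator_def intro!: arg_cong[of _ _ ennreal])
  qed
  also have "\<dots> = ennreal (\<beta> powr (\<kappa> - 1)) * (\<integral>\<^sup>+ x. ennreal (?g x) \<partial>lborel)"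
    by (rule nn_integral_cmult) measurable
  also have "ennreal \<beta> * (ennreal (\<beta> powr (\<kappa> - 1)) * (\<integral>\<^sup>+ x. ennreal (?g x) \<partial>lborel))
      = ennreal (\<beta> powr \<kappa>) * (\<integral>\<^sup>+ x. ennreal (?g x) \<partial>lborel)"
    using assms by (simp add: mult.assoc[symmetric] ennreal_mult[symmetric] powr_mult_base)
  finally have *: "ennreal (Gamma \<kappa>) = ennreal (\<beta> powr \<kappa>) * (\<integral>\<^sup>+ x. ennreal (?g x) \<partial>lborel)" .
  have "ennreal (1 / \<beta> powr \<kappa>) * ennreal (Gamma \<kappa>) = (ennreal (1 / \<beta> powr \<kappa>) * ennreal (\<beta> powr \<kappa>)) * (\<integral>\<^sup>+ x. ennreal (?g x) \<partial>lborel)"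
    unfolding * by (simp only: mult.assoc)
  thus ?thesis using assms by (simp add: ennreal_mult[symmetric] Gamma_real_pos less_imp_le)
qed

lemma nn_integral_gamma_dens_exp:
  assumes "0 < \<kappa>" "0 < \<theta>" "0 \<le> p"
  shows "(\<integral>\<^sup>+ x. ennreal (gamma_dens \<kappa> \<theta> x * exp (- p * x)) \<partial>lborel) = ennreal ((1 / (1 + p * \<theta>)) powr \<kappa>)"
proof -
  have b: "0 < 1 / \<theta> + p" using assms by (simp add: add_pos_nonneg)
  have G: "0 < Gamma \<kappa>" using assms by (simp add: Gamma_real_pos)
  have "(\<integral>\<^sup>+ x. ennreal (gamma_dens \<kappa> \<theta> x * exp (- p * x)) \<partial>lborel)
     = (\<integral>\<^sup>+ x. ennreal (1 / (\<theta> powr \<kappa> * Gamma \<kappa>)) *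
          ennreal (if 0 < x then x powr (\<kappa> - 1) * exp (- (1 / \<theta> + p) * x) else 0) \<partial>lborel)"
    using G by (intro nn_integral_cong)
      (auto simp: gamma_dens_def ennreal_mult[symmetric] distrib_right exp_diff exp_minus field_simps exp_add
        intro!: arg_cong[of _ _ ennreal])
  also have "\<dots> = ennreal (1 / (\<theta> powr \<kappa> * Gamma \<kappa>)) * ennreal (Gamma \<kappa> / (1 / \<theta> + p) powr \<kappa>)"
    unfolding nn_integral_gamma_kernel[OF b assms(1), symmetric] by (rule nn_integral_cmult) measurable
  also have "\<dots> = ennreal (1 / (\<theta> powr \<kappa> * (1 / \<theta> + p) powr \<kappa>))"
    using G by (simp add: ennreal_mult[symmetric] field_simps)
  also have "\<theta> powr \<kappa> * (1 / \<theta> + p) powr \<kappa> = (1 + p * \<theta>) powr \<kappa>"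
    using assms b by (subst powr_mult[symmetric]) (auto simp: distrib_left mult.commute)
  also have "1 / (1 + p * \<theta>) powr \<kappa> = (1 / (1 + p * \<theta>)) powr \<kappa>"
    using assms by (simp add: powr_divide)
  finally show ?thesis .
qed

definition gamma_dens2 :: "real \<Rightarrow> real \<Rightarrow> real \<Rightarrow> real \<Rightarrow> real \<times> real \<Rightarrow> real" where
  "gamma_dens2 \<kappa> \<theta> \<kappa>' \<theta>' p = gamma_dens \<kappa> \<theta> (fst p) * gamma_dens \<kappa>' \<theta>' (snd p)"

lemma gamma_dens2_nonneg: "0 < \<kappa> \<Longrightarrow> 0 < \<kappa>' \<Longrightarrow> 0 \<le> gamma_dens2 \<kappa> \<theta> \<kappa>' \<theta>' p"
  by (simp add: gamma_dens2_def gamma_dens_nonneg)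

lemma borel_measurable_fst_snd [measurable]:
  fixes g :: "'a \<Rightarrow> 'b :: topological_space \<times> 'c :: topological_space"
  assumes "g \<in> borel_measurable M"
  shows "(\<lambda>x. fst (g x)) \<in> borel_measurable M" "(\<lambda>x. snd (g x)) \<in> borel_measurable M"
  by (rule measurable_compose[OF assms]; intro borel_measurable_continuous_onI continuous_intros)+

lemma borel_measurable_gamma_dens2 [measurable]:
  assumes [measurable]: "f \<in> borel_measurable M" "f' \<in> borel_measurable M" "g \<in> M \<rightarrow>\<^sub>M borel"
  shows "(\<lambda>x. gamma_dens2 \<kappa> (f x) \<kappa>' (f' x) (g x)) \<in> borel_measurable M"
  unfolding gamma_dens2_def by measurable

lemma gamma_dens2_laplace:
  assumes "0 < \<kappa>" "0 < \<theta>" "0 < \<kappa>'" "0 < \<theta>'" "0 \<le> p" "0 \<le> q"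
  shows "has_bochner_integral lborel (\<lambda>z. gamma_dens2 \<kappa> \<theta> \<kappa>' \<theta>' z * (exp (- p * fst z) * exp (- q * snd z)))
    ((1 / (1 + p * \<theta>)) powr \<kappa> * (1 / (1 + q * \<theta>')) powr \<kappa>')"
proof (rule has_bochner_integral_nn_integral)
  let ?g = "\<lambda>x. ennreal (gamma_dens \<kappa> \<theta> x * exp (- p * x))"
  let ?h = "\<lambda>y. ennreal (gamma_dens \<kappa>' \<theta>' y * exp (- q * y))"
  show "(\<lambda>z. gamma_dens2 \<kappa> \<theta> \<kappa>' \<theta>' z * (exp (- p * fst z) * exp (- q * snd z))) \<in> borel_measurable lborel"
    by measurable
  have "(\<integral>\<^sup>+ z. ennreal (gamma_dens2 \<kappa> \<theta> \<kappa>' \<theta>' z * (exp (- p * fst z) * exp (- q * snd z))) \<partial>lborel)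
     = (\<integral>\<^sup>+ z. ?g (fst z) * ?h (snd z) \<partial>(lborel \<Otimes>\<^sub>M lborel))"
    unfolding lborel_prod using assms
    by (intro nn_integral_cong) (auto simp: gamma_dens2_def ennreal_mult[symmetric] gamma_dens_nonneg mult_ac)
  also have "\<dots> = (\<integral>\<^sup>+ x. \<integral>\<^sup>+ y. ?g x * ?h y \<partial>lborel \<partial>lborel)"
    by (subst lborel.nn_integral_fst[symmetric]) auto
  also have "\<dots> = ennreal ((1 / (1 + p * \<theta>)) powr \<kappa>) * ennreal ((1 / (1 + q * \<theta>')) powr \<kappa>')"
    using assms by (simp add: nn_integral_cmult nn_integral_multc nn_integral_gamma_dens_exp[simplified])
  finally show "(\<integral>\<^sup>+ z. ennreal (gamma_dens2 \<kappa> \<theta> \<kappa>' \<theta>' z * (exp (- p * fst z) * exp (- q * snd z))) \<partial>lborel)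
     = ennreal ((1 / (1 + p * \<theta>)) powr \<kappa> * (1 / (1 + q * \<theta>')) powr \<kappa>')"
    by (simp add: ennreal_mult)
qed (auto simp: assms gamma_dens2_nonneg)

lemma integrable_gamma_dens2:
  assumes "0 < \<kappa>" "0 < \<theta>" "0 < \<kappa>'" "0 < \<theta>'"
  shows "integrable lborel (gamma_dens2 \<kappa> \<theta> \<kappa>' \<theta>')" "(LINT z|lborel. gamma_dens2 \<kappa> \<theta> \<kappa>' \<theta>' z) = 1"
  using gamma_dens2_laplace[OF assms, of 0 0] by (auto simp: has_bochner_integral_iff)

lemma set_integrable_inverse_1_plus_square: "set_integrable lborel {0<..} (\<lambda>x. K / (1 + x\<^sup>2 :: real))"
proof -
  have "set_integrable lborel {0<..} (\<lambda>x. K * (1 / (1 + x\<^sup>2 :: real)))"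
    using integrable_I0i_1_div_plus_square
    by (intro set_integrable_mult_right) (simp add: interval_lebesgue_integrable_def einterval_eq zero_ereal_def)
  thus ?thesis by simp
qed

text \<open>The normalised sum is the integral of the step function with value \<open>g n v\<close>
  on ((v - 1) / k_n, v / k_n], to which dominated convergence applies. As \<open>bound\<close> is
  assumed for every s up to v / k_n, it dominates the step function on the whole interval.\<close>

lemma riemann_sum_limit:
  fixes k :: "nat \<Rightarrow> nat" and g :: "nat \<Rightarrow> nat \<Rightarrow> real" and H :: "real \<Rightarrow> real"
  assumes k_pos: "\<And>n. 1 \<le> n \<Longrightarrow> 0 < k n" and k_small: "(\<lambda>n. real (k n) / real n) \<longlonglongrightarrow> 0"
    and lim: "\<And>s. 0 < s \<Longrightarrow> (\<lambda>n. g n (nat \<lceil>real (k n) * s\<rceil>)) \<longlonglongrightarrow> H s"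
    and bound: "\<And>n v s. 1 \<le> n \<Longrightarrow> 1 \<le> v \<Longrightarrow> v \<le> n \<Longrightarrow> 0 < s \<Longrightarrow> real (k n) * s \<le> real v \<Longrightarrow> \<bar>g n v\<bar> \<le> K / (1 + s\<^sup>2)"
  shows "set_integrable lborel {0<..} H"
    and "(\<lambda>n. (\<Sum>v=1..n. g n v) / real (k n)) \<longlonglongrightarrow> (LINT s:{0<..}|lborel. H s)"
proof -
  define G where "G n s = (\<Sum>v=1..n. g n v * indicator {(real v - 1) / real (k n)<..real v / real (k n)} s)" for n s
  have G_eq: "G n s = (if 0 < s \<and> s \<le> real n / real (k n) then g n (nat \<lceil>real (k n) * s\<rceil>) else 0)"
    if n: "1 \<le> n" for n s
  proof -
    have kn: "0 < real (k n)" using k_pos n by simp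
    \<comment> \<open>Intervals closed on the right are the level sets of the ceiling, so
      \<open>G n s\<close> evaluates \<open>g\<close> exactly at the index used in
      \<open>lim\<close>.\<close>
    have mem: "s \<in> {(real v - 1) / real (k n)<..real v / real (k n)} \<longleftrightarrow> \<lceil>real (k n) * s\<rceil> = int v" for v
      using kn by (simp add: ceiling_eq_iff field_simps)
    show ?thesis
    proof (cases "0 < s \<and> s \<le> real n / real (k n)")
      case True
      define w where "w = nat \<lceil>real (k n) * s\<rceil>"
      have "0 < real (k n) * s" "real (k n) * s \<le> real n" using True kn by (auto simp: field_simps)
      hence w: "w \<in> {1..n}" "\<lceil>real (k n) * s\<rceil> = int w" unfolding w_def by (auto; linarith)+
      have "G n s = (\<Sum>v=1..n. if v = w then g n v else 0)"
        unfolding G_def by (intro sum.cong refl) (auto simp: indicator_def mem w(2) simp del: greaterThanAtMost_iff)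
      also have "\<dots> = g n w" using w by simp
      finally show ?thesis using True by (simp add: w_def)
    next
      case False
      have "indicator {(real v - 1) / real (k n)<..real v / real (k n)} s = (0::real)" if "v \<in> {1..n}" for v
      proof -
        have "s \<notin> {(real v - 1) / real (k n)<..real v / real (k n)}"
        proof
          assume s: "s \<in> {(real v - 1) / real (k n)<..real v / real (k n)}"
          have "0 \<le> (real v - 1) / real (k n)" using that kn by simp
          moreover have "real v / real (k n) \<le> real n / real (k n)" using that by (intro divide_right_mono) auto
          ultimately show False using s False by auto
        qed
        thus ?thesis by (simp del: greaterThanAtMost_iff)
      qed
      thus ?thesis using False unfolding G_def by (subst sum.neutral) auto
    qed
  qed
  have G0: "G 0 s = 0" for s by (simp add: G_def)
  have int_G: "(LINT s|lborel. G n s) = (\<Sum>v=1..n. g n v) / real (k n)" if n: "1 \<le> n" for n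
  proof -
    have kn: "0 < real (k n)" using k_pos n by simp
    have len: "measure lborel {(real v - 1) / real (k n)<..real v / real (k n)} = 1 / real (k n)" for v
      using kn by (subst measure_lborel_Ioc) (auto simp: divide_right_mono diff_divide_distrib)
    have fin: "emeasure lborel {(real v - 1) / real (k n)<..real v / real (k n)} < \<infinity>" for v
      using kn by (subst emeasure_lborel_Ioc) (auto simp: divide_right_mono)
    have "(LINT s|lborel. G n s) = (\<Sum>v=1..n. g n v * (1 / real (k n)))"
      unfolding G_def by (subst Bochner_Integration.integral_sum) (auto simp: len integrable_real_indicator[OF _ fin])
    thus ?thesis by (simp add: sum_divide_distrib)
  qed
  have [measurable]: "G n \<in> borel_measurable borel" for n
    unfolding G_def by measurable
  define H' where "H' s = indicator {0<..} s * H s" for s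
  define w where "w s = indicator {0<..} s * (K / (1 + s\<^sup>2))" for s
  have inv_k: "filterlim (\<lambda>n. real n / real (k n)) at_top sequentially"
  proof -
    have "filterlim (\<lambda>n. real (k n) / real n) (at_right 0) sequentially"
      using k_pos by (intro tendsto_imp_filterlim_at_right k_small eventually_sequentiallyI[of 1]) auto
    hence "filterlim (\<lambda>n. inverse (real (k n) / real n)) at_top sequentially"
      by (rule filterlim_compose[OF filterlim_inverse_at_top_right])
    thus ?thesis by simp
  qed
  have pt: "(\<lambda>n. G n s) \<longlonglongrightarrow> H' s" for s
  proof (cases "0 < s")
    case True
    have "\<forall>\<^sub>F n in sequentially. s \<le> real n / real (k n)"
      using inv_k unfolding filterlim_at_top by blast
    hence "\<forall>\<^sub>F n in sequentially. g n (nat \<lceil>real (k n) * s\<rceil>) = G n s"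
      using eventually_ge_at_top[of "1::nat"] by eventually_elim (simp add: G_eq True)
    from Lim_transform_eventually[OF lim[OF True] this] show ?thesis using True by (simp add: H'_def)
  next
    case False
    have "G n s = 0" for n using False by (cases "1 \<le> n") (auto simp: G_eq G0 not_le)
    thus ?thesis using False by (simp add: H'_def)
  qed
  \<comment> \<open>Where \<open>G n\<close> vanishes the majorant still has to be nonnegative; the
    sign of \<open>K\<close> is read off from \<open>bound\<close> at a single admissible
    point.\<close>
  have K0: "0 \<le> K"
  proof -
    have "\<bar>g 1 1\<bar> \<le> K / (1 + (1 / real (k 1))\<^sup>2)"
      using k_pos[of 1] by (intro bound) auto
    hence "0 \<le> K / (1 + (1 / real (k 1))\<^sup>2)" by linarith
    moreover have "0 < 1 + (1 / real (k 1))\<^sup>2" by (simp add: add_pos_nonneg)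
    ultimately show ?thesis by (simp add: zero_le_divide_iff)
  qed
  have dom: "norm (G n s) \<le> w s" for n s
  proof (cases "1 \<le> n \<and> 0 < s \<and> s \<le> real n / real (k n)")
    case True
    have kn: "0 < real (k n)" using k_pos True by simp
    have "0 < real (k n) * s" "real (k n) * s \<le> real n" using True kn by (auto simp: field_simps)
    hence "1 \<le> nat \<lceil>real (k n) * s\<rceil>" "nat \<lceil>real (k n) * s\<rceil> \<le> n" by linarith+
    hence "\<bar>g n (nat \<lceil>real (k n) * s\<rceil>)\<bar> \<le> K / (1 + s\<^sup>2)"
      using True by (intro bound real_nat_ceiling_ge) auto
    thus ?thesis using True by (simp add: G_eq w_def)
  next
    case False
    hence "G n s = 0" by (cases "1 \<le> n") (auto simp: G_eq G0 not_le)
    thus ?thesis using K0 by (simp add: w_def indicator_def)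
  qed
  have w: "integrable lborel w"
    using set_integrable_inverse_1_plus_square[of K] by (simp add: w_def[abs_def] set_integrable_def)
  have [measurable]: "H' \<in> borel_measurable borel"
    by (rule borel_measurable_LIMSEQ_real[OF pt]) measurable
  have DC: "integrable lborel H'" "(\<lambda>n. LINT s|lborel. G n s) \<longlonglongrightarrow> (LINT s|lborel. H' s)"
    using integrable_dominated_convergence[of H' lborel G w] integral_dominated_convergence[of H' lborel G w]
      w pt dom by auto
  show "set_integrable lborel {0<..} H" using DC(1) by (simp add: set_integrable_def H'_def[abs_def])
  have "(\<lambda>n. (\<Sum>v=1..n. g n v) / real (k n)) \<longlonglongrightarrow> (LINT s|lborel. H' s)"
    by (rule Lim_transform_eventually[OF DC(2)])
      (use int_G in \<open>auto intro!: eventually_sequentiallyI[of 1]\<close>)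
  thus "(\<lambda>n. (\<Sum>v=1..n. g n v) / real (k n)) \<longlonglongrightarrow> (LINT s:{0<..}|lborel. H s)"
    by (simp add: set_lebesgue_integral_def H'_def[abs_def])
qed

section \<open>The compactified quadrant\<close>

lemma compact_ennreal_pair: "compact (UNIV :: (ennreal \<times> ennreal) set)"
  by (metis UNIV_Times_UNIV compact_Times compact_UNIV)

lemma continuous_ennreal_pair_bounded:
  fixes f :: "ennreal \<times> ennreal \<Rightarrow> real"
  assumes "continuous_on UNIV f"
  obtains B where "0 < B" "\<And>z. \<bar>f z\<bar> \<le> B"
proof -
  have "bounded (range f)"
    by (intro compact_imp_bounded compact_continuous_image assms compact_ennreal_pair)
  then obtain B where "0 < B" "\<forall>x\<in>range f. norm x \<le> B" unfolding bounded_pos by blast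
  thus thesis using that by auto
qed

text \<open>The continuous extension of exp (- x) to [0, \<infinity>]. The case distinction is
  essential because \<open>enn2real\<close> sends \<infinity> to 0, which would give the value 1.
  Being injective, it serves as the coordinate that separates points in the approximation
  argument.\<close>

definition expm :: "ennreal \<Rightarrow> real" where
  "expm x = (if x = top then 0 else exp (- enn2real x))"

lemma expm_ennreal: "0 \<le> x \<Longrightarrow> expm (ennreal x) = exp (- x)"
  by (simp add: expm_def)

lemma expm_inj: "expm x = expm y \<Longrightarrow> x = y"
  by (cases x; cases y) (auto simp: expm_def split: if_splits)

lemma continuous_on_expm: "continuous_on UNIV expm"
proof -
  have "isCont expm x" for x
  proof (cases x)
    case (real r)
    have "((\<lambda>y. exp (- enn2real y)) \<longlongrightarrow> exp (- r)) (at x)"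
      using real by (intro tendsto_intros) auto
    hence "(expm \<longlongrightarrow> exp (- r)) (at x)"
    proof (rule Lim_transform_eventually)
      have "\<forall>\<^sub>F y in at x. y < top"
        using real by (intro order_tendstoD(2)[OF tendsto_ident_at]) auto
      thus "\<forall>\<^sub>F y in at x. exp (- enn2real y) = expm y"
        by eventually_elim (simp add: expm_def)
    qed
    thus ?thesis using real by (simp add: isCont_def expm_ennreal)
  next
    case top
    have "(expm \<longlongrightarrow> 0) (at x)"
    proof (rule tendstoI)
      fix e :: real assume e: "0 < e"
      define r where "r = max 0 (- ln e)"
      have "\<forall>\<^sub>F y in at x. ennreal r < y"
        using top by (intro order_tendstoD(1)[OF tendsto_ident_at]) auto
      thus "\<forall>\<^sub>F y in at x. dist (expm y) 0 < e"
      proof eventually_elim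
        case (elim y)
        show ?case
        proof (cases y)
          case (real q)
          have "0 \<le> r" by (simp add: r_def)
          hence "r < q" using elim real by (simp add: ennreal_less_iff)
          hence "- ln e < q" by (simp add: r_def)
          hence "exp (- q) < exp (ln e)" by simp
          thus ?thesis using e real by (simp add: expm_ennreal)
        qed (use e in \<open>auto simp: expm_def\<close>)
      qed
    qed
    thus ?thesis using top by (simp add: isCont_def expm_def)
  qed
  thus ?thesis by (simp add: continuous_on_eq_continuous_at)
qed

text \<open>Negative coordinates are clipped to 0; the densities transported along
  \<open>emb\<close> vanish there.\<close>

definition emb :: "real \<times> real \<Rightarrow> ennreal \<times> ennreal" where
  "emb z = (ennreal (fst z), ennreal (snd z))"

lemma continuous_on_emb: "continuous_on A emb"
  unfolding emb_def by (intro continuous_on_Pair continuous_on_ennreal continuous_intros)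

lemma borel_measurable_emb [measurable]: "emb \<in> borel \<rightarrow>\<^sub>M borel"
  by (rule borel_measurable_continuous_onI[OF continuous_on_emb])

section \<open>Limit law of a single scaled node\<close>

context scaled_attachment begin

text \<open>Limit density of the scaled degrees of node \<lceil>k_n s\<rceil> when its degrees at
  birth are \<open>(i, j)\<close>.\<close>

definition lim_dens :: "nat \<Rightarrow> nat \<Rightarrow> real \<Rightarrow> real \<times> real \<Rightarrow> real" where
  "lim_dens i j s z = gamma_dens2 (real i + d1) (s powr - c1) (real j + d2) (s powr - c2) z"

definition lim_fun :: "(ennreal \<times> ennreal \<Rightarrow> real) \<Rightarrow> nat \<Rightarrow> nat \<Rightarrow> real \<Rightarrow> real" where
  "lim_fun f i j s = (LINT z|lborel. lim_dens i j s z * f (emb z))"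

definition scaled :: "nat \<Rightarrow> nat \<Rightarrow> nat \<Rightarrow> ennreal \<times> ennreal" where
  "scaled n i j = (ennreal (real i / b1 n), ennreal (real j / b2 n))"

lemma lim_dens_nonneg: "0 \<le> lim_dens i j s z"
  using d1_pos d2_pos by (simp add: lim_dens_def gamma_dens2_nonneg add_nonneg_pos)

lemma lim_dens_integrable:
  assumes "0 < s"
  shows "integrable lborel (lim_dens i j s)" "(LINT z|lborel. lim_dens i j s z) = 1"
  using integrable_gamma_dens2[of "real i + d1" "s powr - c1" "real j + d2" "s powr - c2"] d1_pos d2_pos assms
  by (simp_all add: lim_dens_def[abs_def] add_nonneg_pos)

lemma lim_fun_integrable:
  assumes s: "0 < s" and f: "continuous_on UNIV f"
  shows "integrable lborel (\<lambda>z. lim_dens i j s z * f (emb z))"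
proof -
  obtain B where B: "0 < B" "\<And>z. \<bar>f z\<bar> \<le> B" using continuous_ennreal_pair_bounded[OF f] by blast
  have [measurable]: "f \<in> borel_measurable borel" by (rule borel_measurable_continuous_onI[OF f])
  have [measurable]: "lim_dens i j s \<in> borel_measurable borel"
    unfolding lim_dens_def[abs_def] by measurable
  show ?thesis
  proof (rule Bochner_Integration.integrable_bound)
    show "integrable lborel (\<lambda>z. B * lim_dens i j s z)" using lim_dens_integrable[OF s] by simp
    show "AE z in lborel. norm (lim_dens i j s z * f (emb z)) \<le> norm (B * lim_dens i j s z)"
    proof (rule AE_I2)
      fix z
      show "norm (lim_dens i j s z * f (emb z)) \<le> norm (B * lim_dens i j s z)"
        using mult_left_mono[OF B(2)[of "emb z"] lim_dens_nonneg[of i j s z]] B(1) lim_dens_nonneg[of i j s z]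
        by (simp add: abs_mult mult.commute)
    qed
  qed simp
qed

lemma lim_fun_linear:
  assumes "0 < s" "continuous_on UNIV f" "continuous_on UNIV g"
  shows "lim_fun (\<lambda>z. a * f z + b * g z) i j s = a * lim_fun f i j s + b * lim_fun g i j s"
proof -
  have "lim_fun (\<lambda>z. a * f z + b * g z) i j s =
      (LINT z|lborel. a * (lim_dens i j s z * f (emb z)) + b * (lim_dens i j s z * g (emb z)))"
    unfolding lim_fun_def by (intro Bochner_Integration.integral_cong) (auto simp: algebra_simps)
  thus ?thesis using lim_fun_integrable[OF assms(1,2)] lim_fun_integrable[OF assms(1,3)]
    by (simp add: lim_fun_def)
qed

lemma lim_fun_diff_le:
  assumes s: "0 < s" and f: "continuous_on UNIV f" and g: "continuous_on UNIV g" and e: "\<And>z. \<bar>f z - g z\<bar> \<le> e"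
  shows "\<bar>lim_fun f i j s - lim_fun g i j s\<bar> \<le> e"
proof -
  have "lim_fun f i j s - lim_fun g i j s = lim_fun (\<lambda>z. 1 * f z + (-1) * g z) i j s"
    by (subst lim_fun_linear[OF s f g]) simp
  also have "\<bar>\<dots>\<bar> \<le> (LINT z|lborel. e * lim_dens i j s z)"
    unfolding lim_fun_def
  proof (rule Bochner_Integration.integral_abs_bound_integral)
    show "integrable lborel (\<lambda>z. lim_dens i j s z * (1 * f (emb z) + (-1) * g (emb z)))"
      by (rule lim_fun_integrable[OF s]) (intro continuous_intros f g)
    show "\<bar>lim_dens i j s z * (1 * f (emb z) + (-1) * g (emb z))\<bar> \<le> e * lim_dens i j s z" for z
      using mult_left_mono[OF e[of "emb z"] lim_dens_nonneg[of i j s z]] lim_dens_nonneg[of i j s z]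
      by (simp add: abs_mult mult.commute)
  qed (use lim_dens_integrable[OF s] in simp)
  also have "\<dots> = e" using lim_dens_integrable[OF s] by simp
  finally show ?thesis .
qed

lemma lim_fun_expm:
  assumes s: "0 < s"
  shows "lim_fun (\<lambda>z. expm (fst z) ^ p * expm (snd z) ^ q) i j s =
    (1 / (1 + real p * s powr (- c1))) powr (real i + d1) * (1 / (1 + real q * s powr (- c2))) powr (real j + d2)"
proof -
  have "lim_fun (\<lambda>z. expm (fst z) ^ p * expm (snd z) ^ q) i j s =
     (LINT z|lborel. lim_dens i j s z * (exp (- real p * fst z) * exp (- real q * snd z)))"
    unfolding lim_fun_def
    by (intro Bochner_Integration.integral_cong refl)
      (auto simp: lim_dens_def gamma_dens2_def gamma_dens_def emb_def expm_ennreal exp_of_nat_mult[symmetric])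
  also have "\<dots> = (1 / (1 + real p * s powr (- c1))) powr (real i + d1) * (1 / (1 + real q * s powr (- c2))) powr (real j + d2)"
    unfolding lim_dens_def using s d1_pos d2_pos
    by (intro has_bochner_integral_integral_eq gamma_dens2_laplace) auto
  finally show ?thesis .
qed

text \<open>Both sides are linear in \<open>f\<close> and move by at most \<epsilon> when
  \<open>f\<close> moves uniformly by \<epsilon>, so convergence holds on a closed subspace. It
  contains all products of powers of \<open>expm\<close> in the two coordinates, by the limit of
  Laplace transforms, and these span an algebra that separates points.\<close>

lemma steps_limit:
  assumes s: "0 < s" and ij: "i \<le> 1" "j \<le> 1" and f: "continuous_on UNIV f"
  shows "(\<lambda>n. steps (nat \<lceil>real (k n) * s\<rceil>) (n - nat \<lceil>real (k n) * s\<rceil>) (\<lambda>i j. f (scaled n i j)) i j)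
    \<longlonglongrightarrow> lim_fun f i j s"
proof -
  define v where "v n = nat \<lceil>real (k n) * s\<rceil>" for n
  define L where "L \<psi> n = steps (v n) (n - v n) (\<lambda>i j. \<psi> (scaled n i j)) i j" for \<psi> :: "ennreal \<times> ennreal \<Rightarrow> real" and n
  have L_linear: "L (\<lambda>z. a * \<phi> z + b * \<psi> z) = (\<lambda>n. a * L \<phi> n + b * L \<psi> n)" for a b \<phi> \<psi>
    unfolding L_def by (simp only: steps_linear)
  define T where "T \<psi> \<longleftrightarrow> continuous_on UNIV \<psi> \<and> L \<psi> \<longlonglongrightarrow> lim_fun \<psi> i j s" for \<psi>
  have T_linear: "T (\<lambda>z. a * \<phi> z + b * \<psi> z)" if "T \<phi>" "T \<psi>" for a b \<phi> \<psi>
    using that unfolding T_def L_linear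
    by (auto simp: lim_fun_linear[OF s] intro!: continuous_intros tendsto_intros)
  define e where "e p q z = expm (fst z) ^ p * expm (snd z) ^ q" for p q :: nat and z
  have e_cont: "continuous_on UNIV (e p q)" for p q
    unfolding e_def by (intro continuous_intros continuous_on_compose2[OF continuous_on_expm]) auto
  have e_T: "T (e p q)" for p q
  proof -
    have "L (e p q) = (\<lambda>n. steps (v n) (n - v n) (\<lambda>i j. exp (- real p * (real i / b1 n)) * exp (- real q * (real j / b2 n))) i j)"
    proof
      fix n
      have "0 \<le> b1 n" "0 \<le> b2 n" by (simp_all add: b1_def b2_def)
      thus "L (e p q) n = steps (v n) (n - v n) (\<lambda>i j. exp (- real p * (real i / b1 n)) * exp (- real q * (real j / b2 n))) i j"
        by (simp add: L_def e_def scaled_def expm_ennreal exp_of_nat_mult[symmetric])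
    qed
    thus ?thesis using steps_exp_limit[of "real p" "real q" s i j] s ij e_cont
      by (simp add: T_def v_def e_def[abs_def] lim_fun_expm)
  qed
  \<comment> \<open>\<open>R\<close> consists of the multipliers of \<open>C\<close>; this makes it closed under products without
    expanding polynomials into monomials.\<close>
  define C where "C = {\<psi>. \<forall>p q. T (\<lambda>z. e p q z * \<psi> z)}"
  define R where "R = {\<phi>. continuous_on UNIV \<phi> \<and> (\<forall>\<psi>\<in>C. (\<lambda>z. \<phi> z * \<psi> z) \<in> C)}"
  have C_linear: "(\<lambda>z. a * \<phi> z + b * \<psi> z) \<in> C" if "\<phi> \<in> C" "\<psi> \<in> C" for a b \<phi> \<psi>
    using that T_linear[of "\<lambda>z. e _ _ z * \<phi> z" "\<lambda>z. e _ _ z * \<psi> z" a b]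
    unfolding C_def by (auto simp: algebra_simps)
  interpret function_ring_on R "UNIV :: (ennreal \<times> ennreal) set"
  proof
    show "(\<lambda>z. f z + g z) \<in> R" if "f \<in> R" "g \<in> R" for f g
      using that C_linear[of "\<lambda>z. f z * _ z" "\<lambda>z. g z * _ z" 1 1] unfolding R_def
      by (auto simp: distrib_right intro!: continuous_intros)
    show "(\<lambda>z. f z * g z) \<in> R" if "f \<in> R" "g \<in> R" for f g
      using that unfolding R_def by (auto simp: mult.assoc intro!: continuous_intros)
    show "(\<lambda>_. c) \<in> R" for c
      unfolding R_def using C_linear[of _ _ c 0] by fastforce
    have "(\<lambda>z. expm (fst z)) \<in> R" "(\<lambda>z. expm (snd z)) \<in> R"
    proof -
      have "(\<lambda>z. expm (fst z) * \<psi> z) \<in> C" "(\<lambda>z. expm (snd z) * \<psi> z) \<in> C" if "\<psi> \<in> C" for \<psi>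
      proof -
        \<comment> \<open>Multiplying by \<open>expm\<close> of a coordinate only raises the
          exponent \<open>p\<close> or \<open>q\<close> by one, and membership in \<open>C\<close>
          covers all exponents.\<close>
        have "T (\<lambda>z. e (Suc p) q z * \<psi> z)" "T (\<lambda>z. e p (Suc q) z * \<psi> z)" for p q
          using that by (auto simp: C_def)
        thus "(\<lambda>z. expm (fst z) * \<psi> z) \<in> C" "(\<lambda>z. expm (snd z) * \<psi> z) \<in> C"
          by (auto simp: C_def e_def mult_ac)
      qed
      moreover have "continuous_on UNIV (\<lambda>z :: ennreal \<times> ennreal. expm (fst z))"
        "continuous_on UNIV (\<lambda>z :: ennreal \<times> ennreal. expm (snd z))"
        by (intro continuous_on_compose2[OF continuous_on_expm] continuous_intros; simp)+
      ultimately show "(\<lambda>z. expm (fst z)) \<in> R" "(\<lambda>z. expm (snd z)) \<in> R" by (auto simp: R_def)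
    qed
    thus "\<exists>f\<in>R. f x \<noteq> f y" if "x \<noteq> y" for x y
      using that expm_inj by (metis prod_eqI)
  qed (auto simp: R_def compact_ennreal_pair)
  \<comment> \<open>As 1 belongs to \<open>C\<close>, so does every multiplier \<open>\<phi>\<close>
    in \<open>R\<close>, and the exponents p = q = 0 then give \<open>T \<phi>\<close>.\<close>
  have one: "(\<lambda>_. 1) \<in> C" using e_T by (simp add: C_def)
  have R_T: "T \<phi>" if "\<phi> \<in> R" for \<phi>
  proof -
    have "\<forall>\<psi>\<in>C. (\<lambda>z. \<phi> z * \<psi> z) \<in> C" using that by (simp add: R_def)
    from bspec[OF this one] have "T (\<lambda>z. e 0 0 z * (\<phi> z * 1))" unfolding C_def by simp
    thus ?thesis by (simp add: e_def)
  qed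
  have "L f \<longlonglongrightarrow> lim_fun f i j s"
  proof (rule LIMSEQ_I)
    fix r :: real assume r: "0 < r"
    hence "0 < r / 3" by simp
    from Stone_Weierstrass_basic[OF f this] obtain g where g: "g \<in> R" "\<And>z. \<bar>f z - g z\<bar> < r / 3" by auto
    have gc: "continuous_on UNIV g" using g by (simp add: R_def)
    have "L g \<longlonglongrightarrow> lim_fun g i j s" using R_T[OF g(1)] by (simp add: T_def)
    hence "\<forall>\<^sub>F n in sequentially. \<bar>L g n - lim_fun g i j s\<bar> < r / 3"
      using r by (auto dest!: tendstoD[where e = "r / 3"] simp: dist_real_def)
    moreover have "\<forall>\<^sub>F n in sequentially. \<bar>L f n - L g n\<bar> \<le> r / 3"
      using eventually_ceiling_le[OF s]
    proof eventually_elim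
      case (elim n)
      have "\<bar>steps (v n) (n - v n) (\<lambda>i j. f (scaled n i j) - g (scaled n i j)) i j\<bar> \<le> r / 3"
      proof (rule steps_abs_bound)
        show "\<bar>f (scaled n i' j') - g (scaled n i' j')\<bar> \<le> r / 3" for i' j'
          using g(2) by (intro less_imp_le)
        show "1 \<le> v n" "i \<le> v n" "j \<le> v n"
          using elim[folded v_def] ij by auto
      qed
      thus ?case by (simp add: L_def steps_diff)
    qed
    ultimately have "\<forall>\<^sub>F n in sequentially. norm (L f n - lim_fun f i j s) < r"
    proof eventually_elim
      case (elim n)
      have "\<bar>lim_fun f i j s - lim_fun g i j s\<bar> \<le> r / 3"
        using g(2) by (intro lim_fun_diff_le s f gc less_imp_le)
      thus ?case using elim unfolding real_norm_def by linarith
    qed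
    thus "\<exists>no. \<forall>n\<ge>no. norm (L f n - lim_fun f i j s) < r" by (simp add: eventually_sequentially)
  qed
  thus ?thesis by (simp add: L_def[abs_def] v_def)
qed

section \<open>Convergence of the empirical integrals\<close>

definition limit_fun :: "(ennreal \<times> ennreal \<Rightarrow> real) \<Rightarrow> real \<Rightarrow> real" where
  "limit_fun f s = \<alpha> * lim_fun f 0 1 s + \<gamma> * lim_fun f 1 0 s"

text \<open>The support condition with \<open>e\<close> activates the tail bound, which supplies the
  majorant for the Riemann sum. Integrability of the limit comes out of the same dominated
  convergence and is reused for the limit measure.\<close>

lemma mean_limit:
  assumes f: "continuous_on UNIV f" and e: "0 < e" "\<And>z. f z \<noteq> 0 \<Longrightarrow> ennreal e \<le> fst z \<or> ennreal e \<le> snd z"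
  shows "set_integrable lborel {0<..} (limit_fun f)"
    and "(\<lambda>n. measure_pmf.expectation (PA n) (degree_sum (\<lambda>i j. f (scaled n i j)) n) / real (k n))
      \<longlonglongrightarrow> (LINT s:{0<..}|lborel. limit_fun f s)"
proof -
  obtain B where B: "0 < B" "\<And>z. \<bar>f z\<bar> \<le> B" using continuous_ennreal_pair_bounded[OF f] by blast
  define h where "h n = (\<lambda>i j. f (scaled n i j))" for n
  define g where "g n v = \<alpha> * steps v (n - v) (h n) 0 1 + \<gamma> * steps v (n - v) (h n) 1 0" for n v
  have hB: "\<bar>h n i j\<bar> \<le> B" for n i j by (simp add: h_def B)
  obtain K where K: "0 \<le> K" and tail: "\<And>n v s h i j. 1 \<le> n \<Longrightarrow> 1 \<le> v \<Longrightarrow> v \<le> n \<Longrightarrow> i \<le> 1 \<Longrightarrow> j \<le> 1 \<Longrightarrow> 0 < s \<Longrightarrow>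
    real (k n) * s \<le> real v \<Longrightarrow> (\<And>i j. \<bar>h i j\<bar> \<le> B) \<Longrightarrow>
    (\<And>i j. h i j \<noteq> 0 \<Longrightarrow> e \<le> real i / b1 n \<or> e \<le> real j / b2 n) \<Longrightarrow>
    \<bar>steps v (n - v) h i j\<bar> \<le> K / (1 + s\<^sup>2)"
    using steps_tail_bound[OF less_imp_le[OF B(1)] e(1)] by blast
  have lim: "(\<lambda>n. g n (nat \<lceil>real (k n) * s\<rceil>)) \<longlonglongrightarrow> limit_fun f s" if "0 < s" for s
    unfolding g_def limit_fun_def h_def by (intro tendsto_intros steps_limit that f) auto
  have bound: "\<bar>g n v\<bar> \<le> K / (1 + s\<^sup>2)"
    if a: "1 \<le> n" "1 \<le> v" "v \<le> n" "0 < s" "real (k n) * s \<le> real v" for n v s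
  proof -
    have supp: "e \<le> real i / b1 n \<or> e \<le> real j / b2 n" if "h n i j \<noteq> 0" for i j
      using e(2)[of "scaled n i j"] that b_pos[OF a(1)] e(1)
      by (auto simp: h_def scaled_def ennreal_le_iff)
    have 1: "\<bar>steps v (n - v) (h n) 0 1\<bar> \<le> K / (1 + s\<^sup>2)" "\<bar>steps v (n - v) (h n) 1 0\<bar> \<le> K / (1 + s\<^sup>2)"
      using a hB supp by (intro tail; simp)+
    have "\<bar>g n v\<bar> \<le> \<alpha> * \<bar>steps v (n - v) (h n) 0 1\<bar> + \<gamma> * \<bar>steps v (n - v) (h n) 1 0\<bar>"
      using \<alpha>_pos \<gamma>_pos unfolding g_def by (intro order_trans[OF abs_triangle_ineq]) (simp add: abs_mult)
    also have "\<dots> \<le> \<alpha> * (K / (1 + s\<^sup>2)) + \<gamma> * (K / (1 + s\<^sup>2))"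
      using \<alpha>_pos \<gamma>_pos by (intro add_mono mult_left_mono 1) auto
    also have "\<dots> = (\<alpha> + \<gamma>) * (K / (1 + s\<^sup>2))" by (simp only: distrib_right)
    also have "\<dots> = K / (1 + s\<^sup>2)" by (simp add: \<gamma>_eq)
    finally show ?thesis .
  qed
  show "set_integrable lborel {0<..} (limit_fun f)"
    by (rule riemann_sum_limit(1)[where g = g and k = k, OF k_pos k_small lim bound])
  have *: "(\<lambda>n. (\<Sum>v=1..n. g n v) / real (k n)) \<longlonglongrightarrow> (LINT s:{0<..}|lborel. limit_fun f s)"
    by (rule riemann_sum_limit(2)[where g = g and k = k, OF k_pos k_small lim bound])
  \<comment> \<open>Node 1 starts from \<open>(1, 1)\<close> and does not fit the pattern of
    \<open>g\<close>; exchanging its term changes the sum by at most 2 B, which disappears after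
    division by \<open>k n\<close>.\<close>
  have "(\<lambda>n. (steps 1 (n - 1) (h n) 1 1 - g n 1) / real (k n)) \<longlonglongrightarrow> 0"
  proof (rule Lim_null_comparison)
    show "\<forall>\<^sub>F n in sequentially. norm ((steps 1 (n - 1) (h n) 1 1 - g n 1) / real (k n)) \<le> 2 * B / real (k n)"
    proof (rule eventually_sequentiallyI[of 1])
      fix n :: nat assume n: "1 \<le> n"
      have 1: "\<bar>steps 1 (n - 1) (h n) i j\<bar> \<le> B" if "i \<le> 1" "j \<le> 1" for i j
        using that by (intro steps_abs_bound hB) auto
      have "\<bar>g n 1\<bar> \<le> \<alpha> * \<bar>steps 1 (n - 1) (h n) 0 1\<bar> + \<gamma> * \<bar>steps 1 (n - 1) (h n) 1 0\<bar>"
        using \<alpha>_pos \<gamma>_pos unfolding g_def by (intro order_trans[OF abs_triangle_ineq]) (simp add: abs_mult)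
      also have "\<dots> \<le> \<alpha> * B + \<gamma> * B"
        using \<alpha>_pos \<gamma>_pos by (intro add_mono mult_left_mono 1) auto
      also have "\<dots> = B" by (simp add: \<gamma>_eq algebra_simps)
      finally have "\<bar>steps 1 (n - 1) (h n) 1 1 - g n 1\<bar> \<le> 2 * B" using 1[of 1 1] by linarith
      thus "norm ((steps 1 (n - 1) (h n) 1 1 - g n 1) / real (k n)) \<le> 2 * B / real (k n)"
        by (simp add: divide_right_mono)
    qed
    show "(\<lambda>n. 2 * B / real (k n)) \<longlonglongrightarrow> 0"
      using real_k_at_top by (intro tendsto_divide_0[OF tendsto_const] filterlim_at_top_imp_at_infinity)
  qed
  from tendsto_add[OF * this]
  have "(\<lambda>n. (\<Sum>v=1..n. g n v) / real (k n) + (steps 1 (n - 1) (h n) 1 1 - g n 1) / real (k n))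
      \<longlonglongrightarrow> (LINT s:{0<..}|lborel. limit_fun f s)" by simp
  hence "(\<lambda>n. measure_pmf.expectation (PA n) (degree_sum (h n) n) / real (k n)) \<longlonglongrightarrow> (LINT s:{0<..}|lborel. limit_fun f s)"
  proof (rule Lim_transform_eventually)
    show "\<forall>\<^sub>F n in sequentially. (\<Sum>v=1..n. g n v) / real (k n) + (steps 1 (n - 1) (h n) 1 1 - g n 1) / real (k n)
        = measure_pmf.expectation (PA n) (degree_sum (h n) n) / real (k n)"
    proof (rule eventually_sequentiallyI[of 1])
      fix n :: nat assume n: "1 \<le> n"
      have "(\<Sum>v=1..n. g n v) = g n 1 + (\<Sum>v=2..n. g n v)"
        using sum.atLeast_Suc_atMost[OF n, of "g n"] by (simp add: numeral_2_eq_2)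
      thus "(\<Sum>v=1..n. g n v) / real (k n) + (steps 1 (n - 1) (h n) 1 1 - g n 1) / real (k n)
          = measure_pmf.expectation (PA n) (degree_sum (h n) n) / real (k n)"
        unfolding expectation_degree_sum[OF n] by (simp add: g_def add_divide_distrib[symmetric])
    qed
  qed
  thus "(\<lambda>n. measure_pmf.expectation (PA n) (degree_sum (\<lambda>i j. f (scaled n i j)) n) / real (k n))
      \<longlonglongrightarrow> (LINT s:{0<..}|lborel. limit_fun f s)" by (simp add: h_def)
qed

text \<open>Squared bias plus variance: the former vanishes by \<open>mean_limit\<close>, the latter
  is at most 9 B^2 n / k_n^2.\<close>

lemma L2_limit:
  assumes f: "continuous_on UNIV f" and e: "0 < e" "\<And>z. f z \<noteq> 0 \<Longrightarrow> ennreal e \<le> fst z \<or> ennreal e \<le> snd z"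
  defines "m \<equiv> (LINT s:{0<..}|lborel. limit_fun f s)"
  shows "(\<lambda>n. measure_pmf.expectation (PA n) (\<lambda>G. (degree_sum (\<lambda>i j. f (scaled n i j)) n G / real (k n) - m)\<^sup>2)) \<longlonglongrightarrow> 0"
proof -
  obtain B where B: "0 < B" "\<And>z. \<bar>f z\<bar> \<le> B" using continuous_ennreal_pair_bounded[OF f] by blast
  define h where "h n = (\<lambda>i j. f (scaled n i j))" for n
  define \<mu> where "\<mu> n = measure_pmf.expectation (PA n) (degree_sum (h n) n)" for n
  have lim: "(\<lambda>n. (\<mu> n / real (k n) - m)\<^sup>2 + 9 * B\<^sup>2 * (real n / (real (k n))\<^sup>2)) \<longlonglongrightarrow> (m - m)\<^sup>2 + 9 * B\<^sup>2 * 0"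
    using mean_limit(2)[OF f e] k_large
    unfolding \<mu>_def h_def m_def by (intro tendsto_intros)
  show ?thesis
  proof (rule Lim_null_comparison)
    show "(\<lambda>n. (\<mu> n / real (k n) - m)\<^sup>2 + 9 * B\<^sup>2 * (real n / (real (k n))\<^sup>2)) \<longlonglongrightarrow> 0" using lim by simp
    show "\<forall>\<^sub>F n in sequentially. norm (measure_pmf.expectation (PA n)
       (\<lambda>G. (degree_sum (\<lambda>i j. f (scaled n i j)) n G / real (k n) - m)\<^sup>2))
       \<le> (\<mu> n / real (k n) - m)\<^sup>2 + 9 * B\<^sup>2 * (real n / (real (k n))\<^sup>2)"
    proof (rule eventually_sequentiallyI[of 1])
      fix n :: nat assume n: "1 \<le> n"
      let ?Y = "\<lambda>G. degree_sum (h n) n G / real (k n)"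
      have "measure_pmf.expectation (PA n) (\<lambda>G. (?Y G - m)\<^sup>2)
         \<le> (measure_pmf.expectation (PA n) ?Y - m)\<^sup>2 + measure_pmf.expectation (PA n) (\<lambda>G. (?Y G - \<mu> n / real (k n))\<^sup>2)"
        by (rule pmf_second_moment_le[OF finite_PA[OF n]])
      also have "measure_pmf.expectation (PA n) ?Y = \<mu> n / real (k n)" by (simp add: \<mu>_def)
      also have "measure_pmf.expectation (PA n) (\<lambda>G. (?Y G - \<mu> n / real (k n))\<^sup>2)
         = measure_pmf.expectation (PA n) (\<lambda>G. (degree_sum (h n) n G - \<mu> n)\<^sup>2) / (real (k n))\<^sup>2"
        by (simp add: diff_divide_distrib[symmetric] power_divide)
      also have "\<dots> \<le> 9 * B\<^sup>2 * real n / (real (k n))\<^sup>2"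
        unfolding \<mu>_def using B n by (intro divide_right_mono variance_degree_sum) (auto simp: h_def)
      finally show "norm (measure_pmf.expectation (PA n)
         (\<lambda>G. (degree_sum (\<lambda>i j. f (scaled n i j)) n G / real (k n) - m)\<^sup>2))
         \<le> (\<mu> n / real (k n) - m)\<^sup>2 + 9 * B\<^sup>2 * (real n / (real (k n))\<^sup>2)"
        by (simp add: h_def)
    qed
  qed
qed

end

section \<open>The limit measure\<close>

text \<open>For s \<le> 1 the left side is at most 1. For s > 1 put M = (b + 2) / c and w = x s^c
  and raise w / M \<le> exp (w / M) to the power M: then exp (- w) is at most a constant times s^(-
  (b + 2)), which beats s^b with s^(- 2) to spare.\<close>

lemma scale_kernel_bound:
  fixes c b x y s c' :: real
  assumes c: "0 < c" and b: "0 \<le> b" and x: "0 < x" and y: "0 \<le> y" and s: "0 < s"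
  shows "s powr b * exp (- (x * s powr c + y * s powr c'))
    \<le> (2 + 2 * ((b + 2) / c / x) powr ((b + 2) / c)) / (1 + s\<^sup>2)"
proof -
  define M where "M = (b + 2) / c"
  have M: "0 < M" "c * M = b + 2" using b c by (auto simp: M_def)
  have E1: "exp (- (x * s powr c + y * s powr c')) \<le> exp (- (x * s powr c))" using y by simp
  have C0: "0 \<le> (M / x) powr M" by simp
  show ?thesis
  proof (cases "s \<le> 1")
    case True
    have "s powr b * exp (- (x * s powr c + y * s powr c')) \<le> 1 * 1"
    proof (intro mult_mono powr_le1)
      have "0 \<le> x * s powr c + y * s powr c'" using x y by simp
      thus "exp (- (x * s powr c + y * s powr c')) \<le> 1" by (simp only: exp_le_one_iff neg_le_0_iff_le)
    qed (use True s b in auto)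
    also have "\<dots> \<le> 2 / (1 + s\<^sup>2)" using True s by (simp add: power_le_one add_pos_nonneg)
    also have "\<dots> \<le> (2 + 2 * (M / x) powr M) / (1 + s\<^sup>2)"
      using C0 by (intro divide_right_mono) auto
    finally show ?thesis by (simp add: M_def)
  next
    case False
    define w where "w = x * s powr c"
    have w: "0 < w" using x s by (simp add: w_def)
    have "w / M \<le> exp (w / M)" using exp_ge_add_one_self[of "w / M"] by linarith
    hence "(w / M) powr M \<le> exp (w / M) powr M" using w M by (intro powr_mono2) auto
    also have "\<dots> = exp w" using M by (simp add: exp_powr_real)
    finally have "exp (- w) \<le> 1 / (w / M) powr M"
      using w M by (simp add: exp_minus field_simps)
    also have "\<dots> = (M / x) powr M * s powr (- (b + 2))"
    proof -
      have "(w / M) powr M = ((x / M) * s powr c) powr M" by (simp add: w_def)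
      also have "\<dots> = (x / M) powr M * s powr (b + 2)"
        unfolding powr_mult powr_powr M(2) ..
      finally show ?thesis by (simp only: powr_minus_divide powr_divide) simp
    qed
    finally have e: "exp (- w) \<le> (M / x) powr M * s powr (- (b + 2))" .
    have "s powr b * exp (- (x * s powr c + y * s powr c')) \<le> s powr b * ((M / x) powr M * s powr (- (b + 2)))"
      using order_trans[OF E1 e[unfolded w_def]] by (rule mult_left_mono) simp
    also have "\<dots> = (M / x) powr M * (s powr b * s powr (- (b + 2)))" by simp
    also have "s powr b * s powr (- (b + 2)) = s powr (- 2)"
      by (simp add: powr_add[symmetric])
    also have "s powr (- 2) = 1 / s\<^sup>2" using s by (simp add: powr_minus powr_numeral divide_inverse)
    also have "(M / x) powr M * (1 / s\<^sup>2) = 2 * (M / x) powr M / (2 * s\<^sup>2)" by simp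
    also have "\<dots> \<le> 2 * (M / x) powr M / (1 + s\<^sup>2)"
      using False s by (intro divide_left_mono mult_pos_pos add_pos_nonneg) auto
    also have "\<dots> \<le> (2 + 2 * (M / x) powr M) / (1 + s\<^sup>2)" by (intro divide_right_mono) auto
    finally show ?thesis by (simp add: M_def)
  qed
qed

lemma scale_kernel_integrable:
  fixes c b x y c' :: real
  assumes "0 < c" "0 \<le> b" "0 < x" "0 \<le> y"
  shows "set_integrable lborel {0<..} (\<lambda>s. s powr b * exp (- (x * s powr c + y * s powr c')))"
  unfolding set_integrable_def
proof (rule Bochner_Integration.integrable_bound)
  show "integrable lborel (\<lambda>s :: real. indicator {0<..} s *\<^sub>R ((2 + 2 * ((b + 2) / c / x) powr ((b + 2) / c)) / (1 + s\<^sup>2)))"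
    using set_integrable_inverse_1_plus_square unfolding set_integrable_def .
  show "AE s in lborel. norm (indicator {0<..} s *\<^sub>R (s powr b * exp (- (x * s powr c + y * s powr c'))))
     \<le> norm (indicator {0<..} s *\<^sub>R ((2 + 2 * ((b + 2) / c / x) powr ((b + 2) / c)) / (1 + s\<^sup>2)))"
    using scale_kernel_bound[OF assms(1-4)]
    by (auto intro!: AE_I2 simp: indicator_def intro: order_trans[OF _ abs_ge_self])
qed simp

text \<open>The substitution \<open>z = s powr (-c)\<close> turns the mixing variable of the densities \<open>f1\<close>, \<open>f2\<close> into
  the rescaled label \<open>s = v / k\<close> of a node.\<close>

lemma mixing_integral_substitution:
  fixes c c' \<kappa> \<kappa>' x y :: real
  assumes c: "0 < c" "0 < c'" and \<kappa>: "0 < \<kappa>" "0 < \<kappa>'" and xy: "0 < x" "0 < y"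
  shows "(LINT z:{0<..}|lborel. z powr (- (1 + 1 / c + \<kappa> + c' / c * \<kappa>')) * exp (- (x / z + y / z powr (c' / c))))
    = c * (LINT s:{0<..}|lborel. s powr (c * \<kappa> + c' * \<kappa>') * exp (- (x * s powr c + y * s powr c')))"
proof -
  define A where "A = 1 + 1 / c + \<kappa> + c' / c * \<kappa>'"
  define F where "F z = z powr (- A) * exp (- (x / z + y / z powr (c' / c)))" for z
  define J where "J s = s powr (c * \<kappa> + c' * \<kappa>') * exp (- (x * s powr c + y * s powr c'))" for s
  define g where "g s = s powr (- c)" for s :: real
  define g' where "g' s = - c * s powr (- c - 1)" for s :: real
  let ?S = "{0<..} :: real set"
  have J: "set_integrable lborel ?S J"
    unfolding J_def using assms by (intro scale_kernel_integrable) auto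
  hence J': "set_integrable lborel ?S (\<lambda>s. c * J s)" by simp
  have [measurable]: "F \<in> borel_measurable borel" "J \<in> borel_measurable borel"
    unfolding F_def[abs_def] J_def[abs_def] by measurable
  have eq: "\<bar>g' s\<bar> * F (g s) = c * J s" if "s \<in> ?S" for s
  proof -
    have s: "0 < s" using that by simp
    have "s powr (- c - 1) * (s powr (- c)) powr (- A) = s powr (- c - 1 + c * A)"
      using s by (simp add: powr_powr powr_add[symmetric])
    also have "- c - 1 + c * A = c * \<kappa> + c' * \<kappa>'" using c by (simp add: A_def field_simps)
    finally have 1: "s powr (- c - 1) * (s powr (- c)) powr (- A) = s powr (c * \<kappa> + c' * \<kappa>')" .
    have 2: "x / s powr (- c) + y / (s powr (- c)) powr (c' / c) = x * s powr c + y * s powr c'"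
    proof -
      have "(s powr (- c)) powr (c' / c) = s powr (- c')" using c by (simp add: powr_powr)
      thus ?thesis by (simp add: powr_minus divide_inverse)
    qed
    have "\<bar>g' s\<bar> * F (g s) = c * (s powr (- c - 1) * (s powr (- c)) powr (- A)) *
       exp (- (x / s powr (- c) + y / (s powr (- c)) powr (c' / c)))"
      using c by (simp add: g'_def g_def F_def abs_mult)
    thus ?thesis unfolding 1 2 by (simp add: J_def)
  qed
  have inj: "inj_on g ?S"
  proof (rule inj_onI)
    fix s t assume "s \<in> ?S" "t \<in> ?S" "g s = g t"
    hence "(s powr (- c)) powr (- 1 / c) = (t powr (- c)) powr (- 1 / c)" by (simp add: g_def)
    thus "s = t" using c \<open>s \<in> ?S\<close> \<open>t \<in> ?S\<close> by (simp add: powr_powr)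
  qed
  have img: "g ` ?S = ?S"
  proof (intro equalityI subsetI)
    fix z assume "z \<in> ?S"
    hence "z = g (z powr (- 1 / c))" "z powr (- 1 / c) \<in> ?S" using c by (auto simp: g_def powr_powr)
    thus "z \<in> g ` ?S" by blast
  qed (auto simp: g_def)
  have leb: "set_integrable lebesgue ?S (\<lambda>s. c * J s)"
    using J' unfolding set_integrable_def by (subst integrable_completion) auto
  have "(\<lambda>s. \<bar>g' s\<bar> * F (g s)) absolutely_integrable_on ?S \<and>
     integral ?S (\<lambda>s. \<bar>g' s\<bar> * F (g s)) = integral ?S (\<lambda>s. c * J s)"
  proof
    show "integral ?S (\<lambda>s. \<bar>g' s\<bar> * F (g s)) = integral ?S (\<lambda>s. c * J s)"
      by (rule Henstock_Kurzweil_Integration.integral_cong) (rule eq)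
    have "set_integrable lebesgue ?S (\<lambda>s. \<bar>g' s\<bar> * F (g s)) = set_integrable lebesgue ?S (\<lambda>s. c * J s)"
      by (rule set_integrable_cong) (use eq in auto)
    thus "(\<lambda>s. \<bar>g' s\<bar> * F (g s)) absolutely_integrable_on ?S" using leb by blast
  qed
  moreover have "(g has_field_derivative g' s) (at s within ?S)" if "s \<in> ?S" for s
    using that unfolding g_def g'_def by (auto intro!: derivative_eq_intros)
  ultimately have F: "F absolutely_integrable_on ?S" "integral ?S F = integral ?S (\<lambda>s. c * J s)"
    using has_absolute_integral_change_of_variables_1'[of ?S g g' F "integral ?S (\<lambda>s. c * J s)"] inj img
    by auto
  have "(LINT z:?S|lborel. F z) = (LINT z:?S|lebesgue. F z)"
    unfolding set_lebesgue_integral_def by (subst integral_completion) auto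
  also have "\<dots> = integral ?S (\<lambda>s. c * J s)"
    using set_lebesgue_integral_eq_integral(2)[OF F(1)] F(2) by simp
  also have "\<dots> = (LINT s:?S|lborel. c * J s)"
    by (rule set_borel_integral_eq_integral(2)[OF J', symmetric])
  finally show ?thesis by (simp add: F_def A_def J_def)
qed

section \<open>Test functions and weak convergence\<close>

text \<open>A neighbourhood of the origin contains a box. Since [0, \<infinity>]^2 is compact,
  staying away from the origin is the only restriction on closed sets to be compact in
  \<open>EE\<close>; points at infinity are included.\<close>

lemma closed_away_from_zero:
  fixes S :: "(ennreal \<times> ennreal) set"
  assumes "closed S" "(0, 0) \<notin> S"
  obtains e where "0 < e" "\<And>z. z \<in> S \<Longrightarrow> ennreal e \<le> fst z \<or> ennreal e \<le> snd z"
proof -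
  have "open (- S)" "(0, 0) \<in> - S" using assms by auto
  then obtain A B where AB: "open A" "open B" "0 \<in> A" "0 \<in> B" "A \<times> B \<subseteq> - S"
    by (auto elim!: open_prod_elim)
  obtain a where a: "0 < a" "{0..<a} \<subseteq> A" using open_right[OF AB(1,3), of 1] by auto
  obtain b where b: "0 < b" "{0..<b} \<subseteq> B" using open_right[OF AB(2,4), of 1] by auto
  have "0 < min a b" using a b by simp
  then obtain c where c: "0 < c" "c < min a b" using dense by blast
  obtain e where e: "c = ennreal e" "0 < e"
    using c by (cases c) (auto simp: ennreal_less_iff)
  have "ennreal e \<le> fst z \<or> ennreal e \<le> snd z" if "z \<in> S" for z
  proof (rule ccontr)
    assume "\<not> ?thesis"
    hence "fst z \<in> A" "snd z \<in> B" using a b c e by (auto simp: not_le)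
    hence "z \<in> A \<times> B" by (simp add: mem_Times_iff)
    thus False using AB that by auto
  qed
  thus thesis by (rule that[OF e(2)])
qed

lemma expm_bounds:
  assumes "0 \<le> e"
  shows "ennreal e \<le> x \<Longrightarrow> expm x \<le> exp (- e)" "expm x < exp (- e) \<Longrightarrow> ennreal e \<le> x"
  using assms by (cases x; auto simp: expm_def ennreal_le_iff split: if_splits)+

text \<open>The cutoff \<open>\<phi>\<close> is piecewise affine in \<open>expm x\<close>, which
  keeps it continuous up to \<infinity>; it is 0 for x \<le> e / 2 and at least 1 for x \<ge> e.
  Adding the two coordinates covers points with only one large coordinate. The result dominates the
  indicator of \<open>S\<close> and serves to bound measures of compact sets.\<close>

lemma bump_function:
  fixes S :: "(ennreal \<times> ennreal) set"
  assumes "closed S" "(0, 0) \<notin> S"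
  obtains f :: "ennreal \<times> ennreal \<Rightarrow> real" and e where "continuous_on UNIV f" "0 < e" "\<And>z. 0 \<le> f z"
    "\<And>z. z \<in> S \<Longrightarrow> 1 \<le> f z" "\<And>z. f z \<noteq> 0 \<Longrightarrow> ennreal e \<le> fst z \<or> ennreal e \<le> snd z"
proof -
  obtain e where e: "0 < e" "\<And>z. z \<in> S \<Longrightarrow> ennreal e \<le> fst z \<or> ennreal e \<le> snd z"
    using closed_away_from_zero[OF assms] by blast
  define \<phi> where "\<phi> x = max 0 ((exp (- e / 2) - expm x) / (exp (- e / 2) - exp (- e)))" for x
  have D: "0 < exp (- e / 2) - exp (- e)" using e by simp
  have \<phi>0: "0 \<le> \<phi> x" for x by (simp add: \<phi>_def)
  have \<phi>1: "1 \<le> \<phi> x" if "ennreal e \<le> x" for x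
  proof -
    have "1 \<le> (exp (- e / 2) - expm x) / (exp (- e / 2) - exp (- e))"
      using D expm_bounds(1)[OF less_imp_le[OF e(1)] that] by (simp add: le_divide_eq)
    thus ?thesis by (simp add: \<phi>_def)
  qed
  have \<phi>2: "ennreal (e / 2) \<le> x" if "\<phi> x \<noteq> 0" for x
  proof -
    define q where "q = (exp (- e / 2) - expm x) / (exp (- e / 2) - exp (- e))"
    have "\<phi> x = max 0 q" by (simp only: \<phi>_def q_def)
    hence "0 < q" using that by (simp add: max_def split: if_splits)
    hence "0 < (exp (- e / 2) - expm x) / (exp (- e / 2) - exp (- e))" by (simp only: q_def)
    hence "expm x < exp (- (e / 2))" using D by (simp add: zero_less_divide_iff)
    thus ?thesis using e by (intro expm_bounds(2)) auto
  qed
  have c: "continuous_on UNIV \<phi>"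
    unfolding \<phi>_def using D by (intro continuous_intros continuous_on_expm) auto
  show thesis
  proof (rule that[of "\<lambda>z. \<phi> (fst z) + \<phi> (snd z)" "e / 2"])
    show "continuous_on UNIV (\<lambda>z :: ennreal \<times> ennreal. \<phi> (fst z) + \<phi> (snd z))"
      by (intro continuous_intros continuous_on_compose2[OF c]) auto
    show "1 \<le> \<phi> (fst z) + \<phi> (snd z)" if "z \<in> S" for z
      using e(2)[OF that] \<phi>1[of "fst z"] \<phi>1[of "snd z"] \<phi>0[of "fst z"] \<phi>0[of "snd z"] by linarith
    show "ennreal (e / 2) \<le> fst z \<or> ennreal (e / 2) \<le> snd z" if "\<phi> (fst z) + \<phi> (snd z) \<noteq> 0" for z
      using that \<phi>2[of "fst z"] \<phi>2[of "snd z"] by (cases "\<phi> (fst z) = 0") simp_all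
  qed (use e \<phi>0 in auto)
qed

text \<open>The open sets \<open>EE\<close> and \<open>- S\<close>, with \<open>S\<close> the
  support of \<open>f\<close>, cover the whole space because \<open>S\<close> is closed and omits
  the origin; on the second set the extension is 0. Gluing gives continuity at the origin as
  well.\<close>

lemma test_function_extension:
  assumes "f \<in> test_functions"
  defines "g \<equiv> \<lambda>z. if z \<in> EE then f z else 0"
  obtains e where "continuous_on UNIV g" "0 < e" "\<And>z. g z \<noteq> 0 \<Longrightarrow> ennreal e \<le> fst z \<or> ennreal e \<le> snd z"
proof -
  define S where "S = EE \<inter> closure {p \<in> EE. f p \<noteq> 0}"
  have f: "continuous_on EE f" "compact S" using assms(1) by (auto simp: test_functions_def S_def)
  have S: "closed S" "(0, 0) \<notin> S" using f compact_imp_closed by (auto simp: S_def EE_def)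
  have g0: "g z = 0" if "z \<notin> S" for z
    using that closure_subset[of "{p \<in> EE. f p \<noteq> 0}"] by (auto simp: g_def S_def)
  obtain e where e: "0 < e" "\<And>z. z \<in> S \<Longrightarrow> ennreal e \<le> fst z \<or> ennreal e \<le> snd z"
    using closed_away_from_zero[OF S] by blast
  have "continuous_on (EE \<union> - S) g"
  proof (rule continuous_on_open_Un)
    show "open EE" unfolding EE_def by (intro open_Diff) auto
    show "open (- S)" using S by auto
    show "continuous_on EE g" using f(1) by (rule continuous_on_eq) (auto simp: g_def)
    show "continuous_on (- S) g" by (rule continuous_on_eq[OF continuous_on_const[of _ 0]]) (use g0 in auto)
  qed
  moreover have "EE \<union> - S = UNIV" by (auto simp: S_def)
  ultimately have "continuous_on UNIV g" by simp
  moreover have "ennreal e \<le> fst z \<or> ennreal e \<le> snd z" if "g z \<noteq> 0" for z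
    using that g0 by (intro e(2)) blast
  ultimately show thesis by (rule that[OF _ e(1)])
qed

lemma scale_measure_conv_density: "scale_measure c M = density M (\<lambda>_. c)"
  by (rule measure_eqI) (auto simp: emeasure_density_const)

text \<open>Extending \<open>f\<close> by 0 accounts for the restriction to \<open>EE\<close>: nodes
  mapped to the origin contribute nothing to the sum.\<close>

lemma integral_degree_measure:
  assumes g: "continuous_on UNIV (\<lambda>z. if z \<in> EE then f z else 0 :: real)" (is "continuous_on _ ?g")
  shows "(LINT z|degree_measure c c' n k G. f z) = (\<Sum>v=1..n. ?g
      (ennreal (real (D_in G v) / (real n / real k) powr c),
       ennreal (real (D_out G v) / (real n / real k) powr c'))) / real k"
proof -
  let ?p = "\<lambda>v. (ennreal (real (D_in G v) / (real n / real k) powr c),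
             ennreal (real (D_out G v) / (real n / real k) powr c'))"
  let ?N = "distr (count_space {1..n}) borel ?p"
  have m: "?p \<in> measurable (count_space {1..n}) borel" by simp
  have mg: "?g \<in> borel_measurable borel" by (rule borel_measurable_continuous_onI[OF g])
  have mf: "f \<in> borel_measurable (restrict_space ?N EE)"
  proof -
    have "(\<lambda>z. indicator EE z *\<^sub>R f z) = ?g" by (auto simp: indicator_def)
    thus ?thesis using mg EE_in_borel by (subst borel_measurable_restrict_space_iff) auto
  qed
  have "(LINT z|degree_measure c c' n k G. f z) = (LINT z|restrict_space ?N EE. (1 / real k) *\<^sub>R f z)"
    unfolding degree_measure_def scale_measure_conv_density
    by (rule integral_density) (use mf in auto)
  also have "\<dots> = (LINT z|?N. (1 / real k) * ?g z)"
    using EE_in_borel by (subst integral_restrict_space)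
      (auto intro!: Bochner_Integration.integral_cong simp: indicator_def)
  also have "\<dots> = (LINT v|count_space {1..n}. (1 / real k) * ?g (?p v))"
    using mg by (intro integral_distr m) auto
  also have "\<dots> = (\<Sum>v=1..n. (1 / real k) * ?g (?p v))"
    by (simp only: lebesgue_integral_count_space_finite finite_atLeastAtMost)
  finally show ?thesis by (simp only: times_divide_eq_left mult_1 sum_divide_distrib)
qed

lemma degree_measure_radon: "degree_measure c c' n k G \<in> radon_measures"
proof -
  have "sets (degree_measure c c' n k G) = sets (restrict_space borel EE)"
    unfolding degree_measure_def sets_scale_measure by (intro sets_restrict_space_cong) simp
  moreover have "emeasure (degree_measure c c' n k G) K < \<infinity>" if "compact K" "K \<subseteq> EE" for K
  proof -
    have "K \<in> sets borel" using that by (intro borel_closed compact_imp_closed)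
    thus ?thesis using that by (subst emeasure_degree_measure)
      (auto simp: ennreal_mult_eq_top_iff less_top[symmetric] indicator_def)
  qed
  ultimately show ?thesis by (simp add: radon_measures_def)
qed

section \<open>Weak convergence to a deterministic limit\<close>

lemma measurable_measure_pmf_borel_of:
  assumes "\<And>w. X w \<in> topspace T"
  shows "X \<in> measurable (measure_pmf p) (borel_of T)"
proof (rule measurableI)
  show "X w \<in> space (borel_of T)" for w
    using assms by (simp add: borel_of_def space_measure_of_conv)
qed simp

text \<open>It suffices that every member of the generating family around \<open>m\<close> captures
  \<open>X n\<close> with probability tending to 1. The property passes to intersections of two sets
  by the union bound and to unions through one member, hence to all open sets around
  \<open>m\<close>. A bounded continuous \<open>F\<close> is then within r / 2 of \<open>F m\<close>
  except on an event of vanishing probability, where it is off by at most 2 B.\<close>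

lemma pmf_weak_limit_const:
  fixes X :: "nat \<Rightarrow> 'w \<Rightarrow> 'a"
  assumes X: "\<And>n w. X n w \<in> topspace (topology_generated_by \<S>)" and m: "m \<in> topspace (topology_generated_by \<S>)"
    and lim: "\<And>U. U \<in> \<S> \<Longrightarrow> m \<in> U \<Longrightarrow> (\<lambda>n. measure_pmf.prob (p n) {w. X n w \<notin> U}) \<longlonglongrightarrow> 0"
  shows "converges_weakly (topology_generated_by \<S>) (\<lambda>n. measure_pmf (p n)) X (measure_pmf (return_pmf ())) (\<lambda>_. m)"
proof -
  let ?T = "topology_generated_by \<S>"
  have open_lim: "(\<lambda>n. measure_pmf.prob (p n) {w. X n w \<notin> U}) \<longlonglongrightarrow> 0"
    if "generate_topology_on \<S> U" "m \<in> U" for U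
    using that
  proof (induction rule: generate_topology_on.induct)
    case (Int A B)
    have lim0: "(\<lambda>n. measure_pmf.prob (p n) {w. X n w \<notin> A} + measure_pmf.prob (p n) {w. X n w \<notin> B}) \<longlonglongrightarrow> 0"
      using tendsto_add[of "\<lambda>n. measure_pmf.prob (p n) {w. X n w \<notin> A}" 0] Int by fastforce
    have "{w. X n w \<notin> A \<inter> B} = {w. X n w \<notin> A} \<union> {w. X n w \<notin> B}" for n by auto
    hence "measure_pmf.prob (p n) {w. X n w \<notin> A \<inter> B}
        \<le> measure_pmf.prob (p n) {w. X n w \<notin> A} + measure_pmf.prob (p n) {w. X n w \<notin> B}" for n
      by (simp add: measure_Un_le)
    thus ?case
      by (intro tendsto_sandwich[OF _ _ tendsto_const lim0]) auto
  next
    case (UN K)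
    then obtain A where A: "A \<in> K" "m \<in> A" by auto
    show ?case
    proof (rule tendsto_sandwich[OF _ _ tendsto_const UN.IH[OF A]])
      show "\<forall>\<^sub>F n in sequentially. measure_pmf.prob (p n) {w. X n w \<notin> \<Union> K} \<le> measure_pmf.prob (p n) {w. X n w \<notin> A}"
        using A by (auto intro!: always_eventually measure_pmf.finite_measure_mono)
    qed auto
  qed (use lim in auto)
  have "(\<lambda>n. LINT w|measure_pmf (p n). F (X n w)) \<longlonglongrightarrow> F m"
    if F: "continuous_map ?T euclideanreal F" "bounded (F ` topspace ?T)" for F
  proof (rule LIMSEQ_I)
    fix r :: real assume r: "0 < r"
    obtain B where B: "0 < B" "\<And>x. x \<in> topspace ?T \<Longrightarrow> \<bar>F x\<bar> \<le> B"
      using F(2) unfolding bounded_pos by auto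
    define U where "U = {x \<in> topspace ?T. F x \<in> ball (F m) (r / 2)}"
    have "openin ?T U"
      unfolding U_def by (rule openin_continuous_map_preimage[OF F(1)]) simp
    hence "generate_topology_on \<S> U" by (rule openin_topology_generated_by)
    moreover have "m \<in> U" using m r by (simp add: U_def)
    ultimately have "(\<lambda>n. measure_pmf.prob (p n) {w. X n w \<notin> U}) \<longlonglongrightarrow> 0" by (rule open_lim)
    hence "(\<lambda>n. r / 2 + 2 * B * measure_pmf.prob (p n) {w. X n w \<notin> U}) \<longlonglongrightarrow> r / 2 + 2 * B * 0"
      by (intro tendsto_intros)
    hence "\<forall>\<^sub>F n in sequentially. r / 2 + 2 * B * measure_pmf.prob (p n) {w. X n w \<notin> U} < r"
      by (rule order_tendstoD(2)) (use r in simp)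
    hence "\<forall>\<^sub>F n in sequentially. norm ((LINT w|measure_pmf (p n). F (X n w)) - F m) < r"
    proof eventually_elim
      case (elim n)
      have int: "integrable (measure_pmf (p n)) (\<lambda>w. F (X n w))"
        using B X by (intro measure_pmf.integrable_const_bound[of _ B]) auto
      have "norm ((LINT w|measure_pmf (p n). F (X n w)) - F m) = norm (LINT w|measure_pmf (p n). F (X n w) - F m)"
        using int by simp
      also have "\<dots> \<le> (LINT w|measure_pmf (p n). norm (F (X n w) - F m))"
        by (rule integral_norm_bound)
      also have "\<dots> \<le> (LINT w|measure_pmf (p n). r / 2 + 2 * B * indicator {w. X n w \<notin> U} w)"
      proof (rule integral_mono)
        show "integrable (measure_pmf (p n)) (\<lambda>w. norm (F (X n w) - F m))" using int by simp
        show "integrable (measure_pmf (p n)) (\<lambda>w. r / 2 + 2 * B * indicator {w. X n w \<notin> U} w :: real)"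
          by (intro Bochner_Integration.integrable_add integrable_mult_right integrable_real_indicator)
            (auto simp: measure_pmf.emeasure_eq_measure)
        fix w
        show "norm (F (X n w) - F m) \<le> r / 2 + 2 * B * indicator {w. X n w \<notin> U} w"
        proof (cases "X n w \<in> U")
          case True
          thus ?thesis by (simp add: U_def dist_real_def abs_minus_commute)
        next
          case False
          have "\<bar>F (X n w) - F m\<bar> \<le> 2 * B" using B(2)[OF X[of n w]] B(2)[OF m] by linarith
          thus ?thesis using False r by simp
        qed
      qed
      also have "\<dots> = r / 2 + 2 * B * measure_pmf.prob (p n) {w. X n w \<notin> U}"
        by (subst Bochner_Integration.integral_add)
          (auto simp: measure_pmf.emeasure_eq_measure intro!: integrable_mult_right integrable_real_indicator)
      finally show ?case using elim by linarith
    qed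
    thus "\<exists>no. \<forall>n\<ge>no. norm ((LINT w|measure_pmf (p n). F (X n w)) - F m) < r"
      by (simp add: eventually_sequentially)
  qed
  moreover have "random_element (measure_pmf (p n)) ?T (X n)" for n
    unfolding random_element_def using X measurable_measure_pmf_borel_of[of "X n" ?T "p n"]
    by (simp add: measure_pmf.prob_space_axioms)
  moreover have "random_element (measure_pmf (return_pmf ())) ?T (\<lambda>_. m)"
    unfolding random_element_def using m measurable_measure_pmf_borel_of[of "\<lambda>_. m" ?T "return_pmf ()"]
    by (simp add: measure_pmf.prob_space_axioms)
  ultimately show ?thesis
    unfolding converges_weakly_def by (auto simp: measure_pmf.prob_space)
qed

context scaled_attachment begin

section \<open>Identification of the limit\<close>

text \<open>Joint intensity of the rescaled birth time s and the scaled degrees z. Its integral over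
  z is 1 for each s > 0, so its total mass is infinite.\<close>

definition mix_dens :: "real \<Rightarrow> real \<times> real \<Rightarrow> real" where
  "mix_dens s z = indicator {0<..} s * (\<alpha> * lim_dens 0 1 s z + \<gamma> * lim_dens 1 0 s z)"

text \<open>The limit with s as mixing variable, as the Riemann sums produce it;
  \<open>limit_measure_eq\<close> matches it with the stated densities.\<close>

definition limit_measure :: "(ennreal \<times> ennreal) measure" where
  "limit_measure = restrict_space
     (distr (density lborel (\<lambda>z. ennreal (LINT s|lborel. mix_dens s z))) borel emb) EE"

lemma mix_dens_nonneg: "0 \<le> mix_dens s z"
  using \<alpha>_pos \<gamma>_pos by (simp add: mix_dens_def lim_dens_nonneg)

lemma borel_measurable_lim_dens [measurable]:
  "(\<lambda>p. lim_dens i j (fst p) (snd p)) \<in> borel_measurable (lborel \<Otimes>\<^sub>M lborel)"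
  unfolding lim_dens_def by measurable

lemma borel_measurable_mix_dens [measurable]:
  "(\<lambda>p. mix_dens (fst p) (snd p)) \<in> borel_measurable (lborel \<Otimes>\<^sub>M lborel)"
  unfolding mix_dens_def by measurable

lemma borel_measurable_mixture [measurable]:
  "(\<lambda>z. LINT s|lborel. mix_dens s z) \<in> borel_measurable borel"
proof -
  have "(\<lambda>p. mix_dens (snd p) (fst p)) \<in> borel_measurable (lborel \<Otimes>\<^sub>M lborel)"
    using measurable_compose[OF measurable_pair_swap' borel_measurable_mix_dens] by (simp add: case_prod_beta)
  hence "(\<lambda>z. LINT s|lborel. mix_dens s z) \<in> borel_measurable lborel"
    by (intro lborel.borel_measurable_lebesgue_integral) (simp add: case_prod_beta)
  thus ?thesis by simp
qed

section \<open>Integration against the limit measure\<close>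

lemma mix_dens_integral:
  assumes f: "continuous_on UNIV f"
  shows "(LINT z|lborel. mix_dens s z * f (emb z)) = indicator {0<..} s * limit_fun f s"
    and "integrable lborel (\<lambda>z. mix_dens s z * f (emb z))"
proof -
  have "integrable lborel (\<lambda>z. mix_dens s z * f (emb z)) \<and>
    (LINT z|lborel. mix_dens s z * f (emb z)) = indicator {0<..} s * limit_fun f s"
  proof (cases "0 < s")
    case True
    note i = lim_fun_integrable[OF True f]
    have "(\<lambda>z. mix_dens s z * f (emb z)) =
       (\<lambda>z. \<alpha> * (lim_dens 0 1 s z * f (emb z)) + \<gamma> * (lim_dens 1 0 s z * f (emb z)))"
      using True by (auto simp: mix_dens_def algebra_simps)
    thus ?thesis using True i[of 0 1] i[of 1 0] by (simp add: limit_fun_def lim_fun_def)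
  qed (simp add: mix_dens_def)
  thus "(LINT z|lborel. mix_dens s z * f (emb z)) = indicator {0<..} s * limit_fun f s"
    "integrable lborel (\<lambda>z. mix_dens s z * f (emb z))" by auto
qed

text \<open>The hypothesis of Fubini's theorem is not computed from the densities:
  \<open>mean_limit\<close> for |f| already contains the integrability in s, inherited from the
  bounds before the limit.\<close>

lemma mix_dens_pair_integrable:
  assumes f: "continuous_on UNIV f" and e: "0 < e" "\<And>z. f z \<noteq> 0 \<Longrightarrow> ennreal e \<le> fst z \<or> ennreal e \<le> snd z"
  shows "integrable (lborel \<Otimes>\<^sub>M lborel) (\<lambda>(s, z). mix_dens s z * f (emb z))"
proof (rule lborel_pair.Fubini_integrable)
  have [measurable]: "f \<in> borel_measurable borel" by (rule borel_measurable_continuous_onI[OF f])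
  show "(\<lambda>(s, z). mix_dens s z * f (emb z)) \<in> borel_measurable (lborel \<Otimes>\<^sub>M lborel)"
    unfolding case_prod_beta by measurable
  have af: "continuous_on UNIV (\<lambda>z. \<bar>f z\<bar>)" by (intro continuous_intros f)
  have "(LINT z|lborel. norm (case (s, z) of (s, z) \<Rightarrow> mix_dens s z * f (emb z))) = indicator {0<..} s * limit_fun (\<lambda>z. \<bar>f z\<bar>) s" for s
    using mix_dens_integral(1)[OF af, of s] mix_dens_nonneg by (simp add: abs_mult)
  moreover have "set_integrable lborel {0<..} (limit_fun (\<lambda>z. \<bar>f z\<bar>))"
    using e by (intro mean_limit(1)[OF af]) auto
  ultimately show "integrable lborel (\<lambda>s. LINT z|lborel. norm (case (s, z) of (s, z) \<Rightarrow> mix_dens s z * f (emb z)))"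
    by (simp add: set_integrable_def)
qed (use mix_dens_integral(2)[OF f] in auto)

lemma limit_measure_integral:
  assumes g: "continuous_on UNIV (\<lambda>z. if z \<in> EE then f z else 0)" (is "continuous_on _ ?g")
    and e: "0 < e" "\<And>z. (if z \<in> EE then f z else 0) \<noteq> 0 \<Longrightarrow> ennreal e \<le> fst z \<or> ennreal e \<le> snd z"
  shows "(LINT z|limit_measure. f z) = (LINT s:{0<..}|lborel. limit_fun ?g s)"
    and "integrable limit_measure f"
proof -
  let ?W = "\<lambda>z. LINT s|lborel. mix_dens s z"
  let ?D = "density lborel (\<lambda>z. ennreal (?W z))"
  have W0: "0 \<le> ?W z" for z by (intro Bochner_Integration.integral_nonneg mix_dens_nonneg)
  have mg [measurable]: "?g \<in> borel_measurable borel" by (rule borel_measurable_continuous_onI[OF g])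
  have ind: "(\<lambda>z. indicator EE z *\<^sub>R f z) = ?g" by (auto simp: indicator_def)
  have EE: "EE \<inter> space (distr ?D borel emb) \<in> sets (distr ?D borel emb)" using EE_in_borel by simp
  have pair: "integrable (lborel \<Otimes>\<^sub>M lborel) (\<lambda>(s, z). mix_dens s z * ?g (emb z))"
    by (rule mix_dens_pair_integrable[OF g e])
  have Wg: "?W z * ?g (emb z) = (LINT s|lborel. mix_dens s z * ?g (emb z))" for z by simp
  have D: "(LINT z|distr ?D borel emb. ?g z) = (LINT z|lborel. ?W z * ?g (emb z))"
  proof -
    have "(LINT z|distr ?D borel emb. ?g z) = (LINT z|?D. ?g (emb z))"
      by (rule integral_distr) (use mg in auto)
    also have "\<dots> = (LINT z|lborel. ?W z *\<^sub>R ?g (emb z))"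
      by (rule integral_density) (use W0 in auto)
    finally show ?thesis by simp
  qed
  have "(LINT z|limit_measure. f z) = (LINT z|distr ?D borel emb. ?g z)"
    unfolding limit_measure_def integral_restrict_space[OF EE] ind ..
  also have "\<dots> = (LINT z|lborel. LINT s|lborel. mix_dens s z * ?g (emb z))"
    unfolding D Wg ..
  also have "\<dots> = (LINT s|lborel. LINT z|lborel. mix_dens s z * ?g (emb z))"
    by (rule lborel_pair.Fubini_integral[OF pair])
  also have "\<dots> = (LINT s:{0<..}|lborel. limit_fun ?g s)"
    unfolding mix_dens_integral(1)[OF g] set_lebesgue_integral_def by simp
  finally show "(LINT z|limit_measure. f z) = (LINT s:{0<..}|lborel. limit_fun ?g s)" .
  have "integrable lborel (\<lambda>z. ?W z * ?g (emb z))"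
    unfolding Wg by (rule lborel_pair.integrable_snd[OF pair])
  hence "integrable ?D (\<lambda>z. ?g (emb z))"
    by (subst integrable_density) (use W0 in auto)
  hence "integrable (distr ?D borel emb) ?g"
    by (subst integrable_distr_eq) auto
  thus "integrable limit_measure f"
    unfolding limit_measure_def integrable_restrict_space[OF EE] ind .
qed

lemma limit_measure_radon: "limit_measure \<in> radon_measures"
proof -
  have sets: "sets limit_measure = sets (restrict_space borel EE)"
    unfolding limit_measure_def by (intro sets_restrict_space_cong) simp
  moreover have "emeasure limit_measure K < \<infinity>" if K: "compact K" "K \<subseteq> EE" for K
  proof -
    have K': "closed K" "(0, 0) \<notin> K" using K compact_imp_closed by (auto simp: EE_def)
    obtain f e where f: "continuous_on UNIV f" "0 < e" "\<And>z. (0::real) \<le> f z" "\<And>z. z \<in> K \<Longrightarrow> 1 \<le> f z"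
      "\<And>z. f z \<noteq> 0 \<Longrightarrow> ennreal e \<le> fst z \<or> ennreal e \<le> snd z"
      using bump_function[OF K'] by metis
    have g: "(\<lambda>z. if z \<in> EE then f z else 0) = f"
      using f(2,5) by (fastforce simp: EE_def fun_eq_iff)
    have "integrable limit_measure f"
    proof (rule limit_measure_integral(2)[of f e])
      show "continuous_on UNIV (\<lambda>z. if z \<in> EE then f z else 0)" unfolding g by (rule f(1))
      show "ennreal e \<le> fst z \<or> ennreal e \<le> snd z" if "(if z \<in> EE then f z else 0) \<noteq> 0" for z
        using that by (intro f(5)) (auto split: if_splits)
    qed (rule f(2))
    hence "(\<integral>\<^sup>+ z. ennreal (norm (f z)) \<partial>limit_measure) < \<infinity>" by (simp add: integrable_iff_bounded)
    moreover have "K \<in> sets limit_measure"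
      unfolding sets using K' K by (auto simp: sets_restrict_space_iff EE_in_borel)
    hence "emeasure limit_measure K = (\<integral>\<^sup>+ z. indicator K z \<partial>limit_measure)" by simp
    moreover have "\<dots> \<le> (\<integral>\<^sup>+ z. ennreal (norm (f z)) \<partial>limit_measure)"
      using f(3,4) by (intro nn_integral_mono) (auto simp: indicator_def)
    ultimately show ?thesis by (simp add: order_le_less_trans)
  qed
  ultimately show ?thesis by (simp add: radon_measures_def)
qed

text \<open>For fixed x, y > 0 the product of Gamma densities is, as a function of s, a constant
  times the kernel of \<open>mixing_integral_substitution\<close>, since the scale s^(- c) turns
  \<theta>^(- \<kappa>) into s^(c \<kappa>). Inserting i + d1 and j + d2 as shapes gives the
  exponent of \<open>f1\<close> for \<open>(1, 0)\<close> and that of \<open>f2\<close> for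
  \<open>(0, 1)\<close>; the factor 1 / c1 stems from the Jacobian.\<close>

lemma lim_dens_mixture:
  assumes "i = 0 \<and> j = 1 \<or> i = 1 \<and> j = 0"
  shows "integrable lborel (\<lambda>s. indicator {0<..} s * lim_dens i j s z)"
    and "(LINT s|lborel. indicator {0<..} s * lim_dens i j s z) =
      indicator ({0<..} \<times> {0<..}) z * (if i = 1 then f1 c1 (c2 / c1) d1 d2 (fst z) (snd z) else f2 c1 (c2 / c1) d1 d2 (fst z) (snd z))"
proof -
  obtain x y where z: "z = (x, y)" by (cases z)
  define \<kappa> \<kappa>' where "\<kappa> = real i + d1" and "\<kappa>' = real j + d2"
  have \<kappa>: "0 < \<kappa>" "0 < \<kappa>'" using d1_pos d2_pos by (auto simp: \<kappa>_def \<kappa>'_def)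
  define J where "J s = s powr (c1 * \<kappa> + c2 * \<kappa>') * exp (- (x * s powr c1 + y * s powr c2))" for s
  define C where "C = x powr (\<kappa> - 1) * y powr (\<kappa>' - 1) / (Gamma \<kappa> * Gamma \<kappa>')"
  have "integrable lborel (\<lambda>s. indicator {0<..} s * lim_dens i j s z) \<and>
    (LINT s|lborel. indicator {0<..} s * lim_dens i j s z) =
      indicator ({0<..} \<times> {0<..}) z * (if i = 1 then f1 c1 (c2 / c1) d1 d2 (fst z) (snd z) else f2 c1 (c2 / c1) d1 d2 (fst z) (snd z))"
  proof (cases "0 < x \<and> 0 < y")
    case True
    have eq: "(\<lambda>s. indicator {0<..} s * lim_dens i j s z) = (\<lambda>s. C * (indicator {0<..} s *\<^sub>R J s))"
    proof
      fix s :: real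
      show "indicator {0<..} s * lim_dens i j s z = C * (indicator {0<..} s *\<^sub>R J s)"
      proof (cases "0 < s")
        case s: True
        have th: "(s powr - c) powr l = 1 / s powr (c * l)" for c l
          by (simp add: powr_powr powr_minus_divide[of s "c * l"])
        have q: "x / s powr - c1 = x * s powr c1" "y / s powr - c2 = y * s powr c2"
          by (simp_all add: powr_minus divide_inverse)
        have "lim_dens i j s z = x powr (\<kappa> - 1) * exp (- (x * s powr c1)) / (1 / s powr (c1 * \<kappa>) * Gamma \<kappa>) *
            (y powr (\<kappa>' - 1) * exp (- (y * s powr c2)) / (1 / s powr (c2 * \<kappa>') * Gamma \<kappa>'))"
          using True by (simp only: lim_dens_def gamma_dens2_def gamma_dens_def z fst_conv snd_conv
              \<kappa>_def[symmetric] \<kappa>'_def[symmetric] th q if_True)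
        moreover have "J s = s powr (c1 * \<kappa>) * s powr (c2 * \<kappa>') * (exp (- (x * s powr c1)) * exp (- (y * s powr c2)))"
          by (simp add: J_def powr_add exp_add[symmetric])
        ultimately show ?thesis using s by (simp add: C_def divide_inverse mult_ac)
      qed simp
    qed
    have J: "set_integrable lborel {0<..} J"
      unfolding J_def using True c1_pos c2_pos \<kappa> by (intro scale_kernel_integrable) auto
    have "(LINT s:{0<..}|lborel. J s) = (1 / c1) * (LINT z:{0<..}|lborel.
        z powr (- (1 + 1 / c1 + \<kappa> + c2 / c1 * \<kappa>')) * exp (- (x / z + y / z powr (c2 / c1))))"
      unfolding J_def using True c1_pos c2_pos \<kappa> by (subst mixing_integral_substitution) auto
    moreover have "C * ((1 / c1) * (LINT z:{0<..}|lborel.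
        z powr (- (1 + 1 / c1 + \<kappa> + c2 / c1 * \<kappa>')) * exp (- (x / z + y / z powr (c2 / c1)))))
       = (if i = 1 then f1 c1 (c2 / c1) d1 d2 x y else f2 c1 (c2 / c1) d1 d2 x y)"
    proof (cases "i = 1")
      case True
      have "1 + 1 / c1 + \<kappa> + c2 / c1 * \<kappa>' = 2 + 1 / c1 + d1 + c2 / c1 * d2"
        using True assms by (simp add: \<kappa>_def \<kappa>'_def)
      note E = this
      show ?thesis unfolding E f1_def C_def using True assms by (simp add: \<kappa>_def \<kappa>'_def mult_ac)
    next
      case False
      have "1 + 1 / c1 + \<kappa> + c2 / c1 * \<kappa>' = 1 + c2 / c1 + 1 / c1 + d1 + c2 / c1 * d2"
        using False assms by (simp add: \<kappa>_def \<kappa>'_def algebra_simps add_divide_distrib)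
      note E = this
      show ?thesis unfolding E f2_def C_def using False assms by (simp add: \<kappa>_def \<kappa>'_def mult_ac)
    qed
    ultimately show ?thesis
      using J True unfolding eq by (simp add: z set_integrable_def set_lebesgue_integral_def)
  next
    case False
    hence "(\<lambda>s. indicator {0<..} s * lim_dens i j s z) = (\<lambda>s. 0)"
      by (auto simp: lim_dens_def gamma_dens2_def gamma_dens_def z)
    thus ?thesis using False by (auto simp: z)
  qed
  thus "integrable lborel (\<lambda>s. indicator {0<..} s * lim_dens i j s z)"
    "(LINT s|lborel. indicator {0<..} s * lim_dens i j s z) =
      indicator ({0<..} \<times> {0<..}) z * (if i = 1 then f1 c1 (c2 / c1) d1 d2 (fst z) (snd z) else f2 c1 (c2 / c1) d1 d2 (fst z) (snd z))"
    by auto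
qed

definition node_mixture :: "nat \<Rightarrow> nat \<Rightarrow> real \<times> real \<Rightarrow> real" where
  "node_mixture i j z = (LINT s|lborel. indicator {0<..} s * lim_dens i j s z)"

lemma node_mixture_nonneg: "0 \<le> node_mixture i j z"
  unfolding node_mixture_def by (intro Bochner_Integration.integral_nonneg mult_nonneg_nonneg lim_dens_nonneg) auto

lemma borel_measurable_node_mixture [measurable]: "node_mixture i j \<in> borel_measurable borel"
proof -
  have m: "(\<lambda>p. indicator {0<..} (fst p) * lim_dens i j (fst p) (snd p)) \<in> borel_measurable (lborel \<Otimes>\<^sub>M lborel)"
    by measurable
  have "(\<lambda>p. indicator {0<..} (snd p) * lim_dens i j (snd p) (fst p)) \<in> borel_measurable (lborel \<Otimes>\<^sub>M lborel)"
    using measurable_compose[OF measurable_pair_swap' m] by (simp add: case_prod_beta)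
  hence "(\<lambda>z. LINT s|lborel. indicator {0<..} s * lim_dens i j s z) \<in> borel_measurable lborel"
    by (intro lborel.borel_measurable_lebesgue_integral) (simp add: case_prod_beta)
  thus ?thesis by (simp add: node_mixture_def[abs_def])
qed

lemma mixture_eq: "(LINT s|lborel. mix_dens s z) = \<gamma> * node_mixture 1 0 z + \<alpha> * node_mixture 0 1 z"
proof -
  have "(LINT s|lborel. mix_dens s z) = (LINT s|lborel. \<gamma> * (indicator {0<..} s * lim_dens 1 0 s z) + \<alpha> * (indicator {0<..} s * lim_dens 0 1 s z))"
    by (intro Bochner_Integration.integral_cong) (auto simp: mix_dens_def algebra_simps)
  also have "\<dots> = \<gamma> * node_mixture 1 0 z + \<alpha> * node_mixture 0 1 z"
    using lim_dens_mixture(1)[of 1 0 z] lim_dens_mixture(1)[of 0 1 z]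
    by (simp add: node_mixture_def)
  finally show ?thesis .
qed

lemma quadrant_density_eq:
  assumes "\<And>z. node_mixture i j z = indicator ({0<..} \<times> {0<..}) z * f (fst z) (snd z)"
  shows "quadrant_density f = restrict_space (distr (density lborel (\<lambda>z. ennreal (node_mixture i j z))) borel emb) EE"
proof -
  have "(\<lambda>(x, y). indicator ({0<..} \<times> {0<..}) (x, y) * ennreal (f x y)) = (\<lambda>z. ennreal (node_mixture i j z))"
    unfolding assms by (auto simp: fun_eq_iff indicator_def)
  moreover have "(\<lambda>(x, y). (ennreal x, ennreal y)) = emb" by (auto simp: emb_def)
  ultimately show ?thesis unfolding quadrant_density_def by simp
qed

lemma limit_measure_eq:
  "add_measure (scale_measure (ennreal \<gamma>) (quadrant_density (f1 c1 (c2 / c1) d1 d2)))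
     (scale_measure (ennreal \<alpha>) (quadrant_density (f2 c1 (c2 / c1) d1 d2))) = limit_measure"
proof -
  let ?Q = "\<lambda>h. restrict_space (distr (density lborel (\<lambda>z :: real \<times> real. ennreal (h z))) borel emb) EE"
  have Q: "quadrant_density (f1 c1 (c2 / c1) d1 d2) = ?Q (node_mixture 1 0)"
    "quadrant_density (f2 c1 (c2 / c1) d1 d2) = ?Q (node_mixture 0 1)"
    by (rule quadrant_density_eq, unfold node_mixture_def, subst lim_dens_mixture(2); simp)+
  have sets_Q: "sets (?Q h) = sets (restrict_space borel EE)" for h
    by (intro sets_restrict_space_cong) simp
  have em: "emeasure (?Q h) A = (\<integral>\<^sup>+ z. ennreal (h z) * indicator (emb -` A) z \<partial>lborel)"
    if A: "A \<in> sets (restrict_space borel EE)" and h [measurable]: "h \<in> borel_measurable borel" for h A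
  proof -
    have A': "A \<in> sets borel" "A \<subseteq> EE" using A EE_in_borel by (auto simp: sets_restrict_space_iff)
    have "emb -` A \<inter> space borel \<in> sets borel" by (rule measurable_sets[OF borel_measurable_emb A'(1)])
    thus ?thesis using A' EE_in_borel
      by (simp add: emeasure_restrict_space emeasure_distr emeasure_density)
  qed
  show ?thesis
  proof (rule measure_eqI)
    have "sets (add_measure \<mu> \<nu>) = sets \<mu>" for \<mu> \<nu> :: "(ennreal \<times> ennreal) measure"
      unfolding add_measure_def by (rule sets.sets_measure_of_eq)
    thus *: "sets (add_measure (scale_measure (ennreal \<gamma>) (quadrant_density (f1 c1 (c2 / c1) d1 d2)))
       (scale_measure (ennreal \<alpha>) (quadrant_density (f2 c1 (c2 / c1) d1 d2)))) = sets limit_measure"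
      unfolding Q limit_measure_def by (simp add: sets_Q)
    fix A assume "A \<in> sets (add_measure (scale_measure (ennreal \<gamma>) (quadrant_density (f1 c1 (c2 / c1) d1 d2)))
       (scale_measure (ennreal \<alpha>) (quadrant_density (f2 c1 (c2 / c1) d1 d2))))"
    hence A: "A \<in> sets (restrict_space borel EE)" unfolding * limit_measure_def sets_Q .
    have A': "emb -` A \<in> sets borel"
      using measurable_sets[OF borel_measurable_emb, of A] A EE_in_borel by (auto simp: sets_restrict_space_iff)
    have split: "ennreal (\<gamma> * x + \<alpha> * y) = ennreal \<gamma> * ennreal x + ennreal \<alpha> * ennreal y" if "0 \<le> x" "0 \<le> y" for x y
      using \<alpha>_pos \<gamma>_pos that by (simp add: ennreal_mult)
    have "emeasure limit_measure A = (\<integral>\<^sup>+ z. ennreal \<gamma> * (ennreal (node_mixture 1 0 z) * indicator (emb -` A) z)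
        + ennreal \<alpha> * (ennreal (node_mixture 0 1 z) * indicator (emb -` A) z) \<partial>lborel)"
      unfolding limit_measure_def em[OF A borel_measurable_mixture]
      unfolding mixture_eq split[OF node_mixture_nonneg node_mixture_nonneg]
      by (simp only: distrib_right mult.assoc)
    also have "\<dots> = ennreal \<gamma> * emeasure (?Q (node_mixture 1 0)) A + ennreal \<alpha> * emeasure (?Q (node_mixture 0 1)) A"
      using A' by (subst nn_integral_add) (auto simp: em[OF A] nn_integral_cmult)
    finally show "emeasure (add_measure (scale_measure (ennreal \<gamma>) (quadrant_density (f1 c1 (c2 / c1) d1 d2)))
       (scale_measure (ennreal \<alpha>) (quadrant_density (f2 c1 (c2 / c1) d1 d2)))) A = emeasure limit_measure A"
      unfolding Q using A by (subst emeasure_add_measure) (auto simp: sets_Q)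
  qed
qed

text \<open>A subbasic neighbourhood of the limit is given by one test function \<open>f\<close> and
  an open set \<open>U\<close> around \<open>m\<close>. Leaving it means that the integral of
  \<open>f\<close> is at least \<open>d\<close> away from \<open>m\<close>, so Chebyshev's
  inequality and \<open>L2_limit\<close> apply.\<close>

lemma degree_measure_converges:
  "converges_weakly vague_topology (\<lambda>n. measure_pmf (PA n)) (\<lambda>n. degree_measure c1 c2 n (k n))
     (measure_pmf (return_pmf ())) (\<lambda>_. limit_measure)"
proof -
  let ?B = "{{\<mu> \<in> radon_measures. (LINT p|\<mu>. f p) \<in> U} | f U. f \<in> test_functions \<and> open U}"
  have top: "topspace (topology_generated_by ?B) = radon_measures"
    using topspace_vague_topology unfolding vague_topology_def .
  show ?thesis unfolding vague_topology_def
  proof (rule pmf_weak_limit_const)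
    show "degree_measure c1 c2 n (k n) w \<in> topspace (topology_generated_by ?B)" for n w
      unfolding top by (rule degree_measure_radon)
    show "limit_measure \<in> topspace (topology_generated_by ?B)"
      unfolding top by (rule limit_measure_radon)
    fix V assume "V \<in> ?B" "limit_measure \<in> V"
    then obtain f U where V: "V = {\<mu> \<in> radon_measures. (LINT p|\<mu>. f p) \<in> U}"
      and f: "f \<in> test_functions" and U: "open U" "(LINT p|limit_measure. f p) \<in> U" by auto
    define g where "g = (\<lambda>z. if z \<in> EE then f z else 0)"
    obtain e where e: "continuous_on UNIV g" "0 < e" "\<And>z. g z \<noteq> 0 \<Longrightarrow> ennreal e \<le> fst z \<or> ennreal e \<le> snd z"
      using test_function_extension[OF f] unfolding g_def by metis
    define m where "m = (LINT s:{0<..}|lborel. limit_fun g s)"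
    have m: "m = (LINT p|limit_measure. f p)"
      unfolding m_def g_def by (rule limit_measure_integral(1)[symmetric]) (use e in \<open>auto simp: g_def\<close>)
    define Y where "Y n G = degree_sum (\<lambda>i j. g (scaled n i j)) n G / real (k n)" for n G
    have Y: "(LINT p|degree_measure c1 c2 n (k n) G. f p) = Y n G" for n G
      unfolding Y_def degree_sum_def scaled_def b1_def b2_def
      using e(1) unfolding g_def by (rule integral_degree_measure)
    obtain d where d: "0 < d" "ball m d \<subseteq> U" using U unfolding m[symmetric] by (auto elim: openE)
    have lim: "(\<lambda>n. measure_pmf.expectation (PA n) (\<lambda>G. (Y n G - m)\<^sup>2) / d\<^sup>2) \<longlonglongrightarrow> 0 / d\<^sup>2"
      unfolding Y_def m_def using d by (intro tendsto_divide tendsto_const L2_limit[OF e]) auto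
    show "(\<lambda>n. measure_pmf.prob (PA n) {w. degree_measure c1 c2 n (k n) w \<notin> V}) \<longlonglongrightarrow> 0"
    proof (rule tendsto_sandwich[OF _ _ tendsto_const])
      show "(\<lambda>n. measure_pmf.expectation (PA n) (\<lambda>G. (Y n G - m)\<^sup>2) / d\<^sup>2) \<longlonglongrightarrow> 0" using lim by simp
      show "\<forall>\<^sub>F n in sequentially. measure_pmf.prob (PA n) {w. degree_measure c1 c2 n (k n) w \<notin> V}
         \<le> measure_pmf.expectation (PA n) (\<lambda>G. (Y n G - m)\<^sup>2) / d\<^sup>2"
      proof (rule eventually_sequentiallyI[of 1])
        fix n :: nat assume n: "1 \<le> n"
        have "measure_pmf.prob (PA n) {w. degree_measure c1 c2 n (k n) w \<notin> V}
            = measure_pmf.expectation (PA n) (indicator {w. degree_measure c1 c2 n (k n) w \<notin> V})" by simp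
        also have "\<dots> \<le> measure_pmf.expectation (PA n) (\<lambda>G. (Y n G - m)\<^sup>2 / d\<^sup>2)"
        proof (intro integral_mono integrable_PA n)
          fix G
          show "indicator {w. degree_measure c1 c2 n (k n) w \<notin> V} G \<le> (Y n G - m)\<^sup>2 / d\<^sup>2"
          proof (cases "degree_measure c1 c2 n (k n) G \<in> V")
            case False
            hence "Y n G \<notin> U" using degree_measure_radon by (auto simp: V Y)
            hence "d \<le> \<bar>Y n G - m\<bar>" using d by (auto simp: dist_real_def abs_minus_commute not_less subset_iff)
            hence "d\<^sup>2 \<le> (Y n G - m)\<^sup>2" using d by (metis abs_le_square_iff abs_of_pos)
            thus ?thesis using False d by simp
          qed simp
        qed
        also have "\<dots> = measure_pmf.expectation (PA n) (\<lambda>G. (Y n G - m)\<^sup>2) / d\<^sup>2" by simp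
        finally show "measure_pmf.prob (PA n) {w. degree_measure c1 c2 n (k n) w \<notin> V}
         \<le> measure_pmf.expectation (PA n) (\<lambda>G. (Y n G - m)\<^sup>2) / d\<^sup>2" .
      qed
    qed auto
  qed
qed

end

text \<open>Any c strictly between 0 and the lower limit satisfies k_n > c sqrt (n ln n) eventually,
  so the ratio is at most 1 / (c^2 ln n).\<close>

lemma intermediate_sequence_large:
  fixes k :: "nat \<Rightarrow> nat"
  assumes "liminf (\<lambda>n. ereal (real (k n) / sqrt (real n * ln (real n)))) > 0"
  shows "(\<lambda>n. real n / (real (k n))\<^sup>2) \<longlonglongrightarrow> 0"
proof -
  obtain c where c: "0 < ereal c" "ereal c < liminf (\<lambda>n. ereal (real (k n) / sqrt (real n * ln (real n))))"
    using ereal_dense2[OF assms] by blast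
  have "0 < c" using c by simp
  have ev: "\<forall>\<^sub>F n in sequentially. c < real (k n) / sqrt (real n * ln (real n))"
    using less_LiminfD[OF c(2)] by simp
  have ln_top: "filterlim (\<lambda>n. ln (real n)) at_top sequentially"
    by (rule filterlim_compose[OF ln_at_top filterlim_real_sequentially])
  have lim: "(\<lambda>n. 1 / c\<^sup>2 / ln (real n)) \<longlonglongrightarrow> 0"
    by (intro tendsto_divide_0[OF tendsto_const] filterlim_at_top_imp_at_infinity ln_top)
  show ?thesis
  proof (rule tendsto_sandwich[OF _ _ tendsto_const lim])
    show "\<forall>\<^sub>F n in sequentially. real n / (real (k n))\<^sup>2 \<le> 1 / c\<^sup>2 / ln (real n)"
      using ev eventually_ge_at_top[of "2::nat"]
    proof eventually_elim
      case (elim n)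
      have pos: "0 < real n * ln (real n)" using elim by simp
      have lt: "c * sqrt (real n * ln (real n)) < real (k n)" using elim pos by (simp add: pos_less_divide_eq)
      have p0: "0 < c * sqrt (real n * ln (real n))"
        using pos \<open>0 < c\<close> by (intro mult_pos_pos) (simp_all only: real_sqrt_gt_zero)
      have k0: "0 < real (k n)" using less_trans[OF p0 lt] .
      have "(c * sqrt (real n * ln (real n)))\<^sup>2 \<le> (real (k n))\<^sup>2"
        by (rule power_mono[OF less_imp_le[OF lt] less_imp_le[OF p0]])
      moreover have "(sqrt (real n * ln (real n)))\<^sup>2 = real n * ln (real n)"
        using pos by (intro real_sqrt_pow2 less_imp_le)
      ultimately have "c\<^sup>2 * (real n * ln (real n)) \<le> (real (k n))\<^sup>2" by (simp only: power_mult_distrib)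
      hence "real n / (real (k n))\<^sup>2 \<le> real n / (c\<^sup>2 * (real n * ln (real n)))"
        using elim k0 \<open>0 < c\<close> by (intro divide_left_mono mult_pos_pos zero_less_power) auto
      also have "\<dots> = 1 / c\<^sup>2 / ln (real n)" using elim by simp
      finally show ?case .
    qed
  qed auto
qed

text \<open>The limit is a fixed measure, hence a random element on a one-point probability
  space.\<close>

theorem theorem5p4:
  fixes \<alpha> \<gamma> \<delta>\<^sub>i\<^sub>n \<delta>\<^sub>o\<^sub>u\<^sub>t c\<^sub>i\<^sub>n c\<^sub>o\<^sub>u\<^sub>t a :: real and k :: "nat \<Rightarrow> nat"
  assumes "0 < \<alpha>" "\<alpha> < 1" "\<gamma> = 1 - \<alpha>" "\<delta>\<^sub>i\<^sub>n > 0" "\<delta>\<^sub>o\<^sub>u\<^sub>t > 0"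
    and "c\<^sub>i\<^sub>n = \<alpha> / (1 + \<delta>\<^sub>i\<^sub>n)" "c\<^sub>o\<^sub>u\<^sub>t = \<gamma> / (1 + \<delta>\<^sub>o\<^sub>u\<^sub>t)" "a = c\<^sub>o\<^sub>u\<^sub>t / c\<^sub>i\<^sub>n"
    and "\<And>n. n \<ge> 1 \<Longrightarrow> k n > 0"
    and "liminf (\<lambda>n. ereal (real (k n) / sqrt (real n * ln (real n)))) > 0"
    and "(\<lambda>n. real (k n) / real n) \<longlonglongrightarrow> 0"
  shows "converges_weakly vague_topology
    (\<lambda>n. measure_pmf (pref_attach \<alpha> \<delta>\<^sub>i\<^sub>n \<delta>\<^sub>o\<^sub>u\<^sub>t n)) (\<lambda>n. degree_measure c\<^sub>i\<^sub>n c\<^sub>o\<^sub>u\<^sub>t n (k n))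
    (measure_pmf (return_pmf ()))
    (\<lambda>_. add_measure (scale_measure (ennreal \<gamma>) (quadrant_density (f1 c\<^sub>i\<^sub>n a \<delta>\<^sub>i\<^sub>n \<delta>\<^sub>o\<^sub>u\<^sub>t)))
                     (scale_measure (ennreal \<alpha>) (quadrant_density (f2 c\<^sub>i\<^sub>n a \<delta>\<^sub>i\<^sub>n \<delta>\<^sub>o\<^sub>u\<^sub>t))))"
proof -
  interpret scaled_attachment \<alpha> \<gamma> \<delta>\<^sub>i\<^sub>n \<delta>\<^sub>o\<^sub>u\<^sub>t c\<^sub>i\<^sub>n c\<^sub>o\<^sub>u\<^sub>t k
    by unfold_locales (use assms intermediate_sequence_large in auto)
  show ?thesis
    using degree_measure_converges unfolding limit_measure_eq[symmetric] \<open>a = _\<close> .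
qed

end
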